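(* Let $p>1$, $\alpha\ge 0$, and let $\{S_t=u_tC_{\phi_t} : t\in\,]0,1[\}$ be an admissible family of weighted composition operators on $A^p_\alpha$ with direction $\xi\in\partial\mathbb D$. Assume that $\arg u_t(\xi)$ is constant for all $t\in\,]0,1[$. Then $$\sup_{(f_n)\in W_0(\partial B_{A^p_\alpha})}\limsup_n\Big\|\int_0^1 S_tf_n\,dt\Big\|_{A^p_\alpha}=\int_0^1\ \sup_{(f_n)\in W_0(\partial B_{A^p_\alpha})}\limsup_n\|S_tf_n\|_{A^p_\alpha}\,dt=\lim_{c}\int_0^1\|S_tf_{c,\xi}\|_{A^p_\alpha}\,dt .$$ Moreover, $$\Big\|\int_0^1 S_t\,dt\Big\|_{e}=\int_0^1\|S_t\|_{e}\,dt ,$$ where $\|\cdot\|_e$ is the essential norm on $A^p_\alpha$.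
   Context: $\mathbb D$ is the open unit disk in $\mathbb C$, $\mathcal H(\mathbb D)$ the holomorphic functions on $\mathbb D$, $B(z,r)$ the open disk with center $z$ and radius $r$, $dA(x+iy)=dx\,dy/\pi$, $dA_\alpha(z)=(1+\alpha)(1-|z|^2)^\alpha dA(z)$. For $p>1$, $\alpha\ge0$, $A^p_\alpha=\{f\in\mathcal H(\mathbb D):\|f\|^p_{A^p_\alpha}=\int_{\mathbb D}|f|^p\,dA_\alpha<\infty\}$. For a Banach space $X$: $\mathcal L(X)$ = bounded linear operators, $\mathcal K(X)$ = compact operators, $\|S\|_e=\inf_{K\in\mathcal K(X)}\|S-K\|$; $\partial B_X$ is the unit sphere, and $W_0(\partial B_X)$ is the set of weakly null sequences in $\partial B_X$. For holomorphic $\phi_t:\mathbb D\to\mathbb D$ and $u_t\in A^p_\alpha$, $S_t=u_tC_{\phi_t}:A^p_\alpha\to A^p_\alpha$, $f\mapsto u_t\,(f\circ\phi_t)$. The operator $\int_0^1S_t\,dt$ is defined by $f\mapsto\int_0^1S_tf\,dt$ (vector-valued integral in $A^p_\alpha$). The family $\{u_tC_{\phi_t}:t\in\,]0,1[\}$ has direction $\xi\in\partial\mathbb D$ if for every $t\in\,]0,1[$: (a) $\phi_t\in\mathcal H(\mathbb D)$ and $\phi_t'$ extends continuously to $\overline{\mathbb D}\cap B(\xi,\epsilon)$ for some $\epsilon=\epsilon(t)>0$; (b) $\phi_t(\xi)=\xi$; (c) $\overline{\phi_t(\mathbb D\setminus B(\xi,\epsilon))}\cap\partial\mathbb D=\emptyset$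 for every $\epsilon>0$; (d) for every $\epsilon>0$ the set $\overline{\phi_t(B(\xi,\epsilon)\cap\mathbb D)}$ contains a horocycle touching $\xi$ (a circle in $\overline{\mathbb D}$ internally tangent to $\partial\mathbb D$ at $\xi$); (e) $u_t$ extends continuously to $\overline{\mathbb D}\cap B(\xi,\epsilon)$ for some $\epsilon=\epsilon(t)>0$. Values of $\phi_t,\phi_t',u_t$ at $\xi$ are those of the continuous extensions; one has $\phi_t'(\xi)>0$. The family is admissible (with direction $\xi$) if it has direction $\xi$, $\int_0^1\|S_t\|_{\mathcal L(A^p_\alpha)}\,dt<\infty$, and for every $t_0\in\,]0,1[$: (i) $\lim_{t\to t_0}\sup_{z\in\mathbb D}|\phi_t(z)-\phi_{t_0}(z)|=0$; (ii) for every $\epsilon'>0$, $\lim_{t\to t_0}\int_{\mathbb D\setminus B(\xi,\epsilon')}|u_t-u_{t_0}|^p\,dA_\alpha=0$; (iii) for some $\epsilon'>0$, $\sup_{|t-t_0|<\epsilon'}\sup_{z\in B(\xi,\epsilon')\cap\mathbb D}|u_t(z)|<\infty$; (iv) for some $\epsilon'>0$, $\inf_{|t-t_0|<\epsilon'}\inf_{z\in B(\xi,\epsilon')\cap\mathbb D}|\phi_t'(z)|>0$. For $c<(2+\alpha)/p$, $f_{c,\xi}=\hat f_{c,\xi}/\|\hat f_{c,\xi}\|_{A^p_\alpha}$ with $\hat f_{c,\xi}(z)=(\xi-z)^{-c}$ (a holomorphic branch on $\mathbb D$), and $\lim_c$ denotes the limit along sequences $c=c_n<(2+\alpha)/p$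 with $c_n\to(2+\alpha)/p$. *)

theory Defs
  imports "HOL-Analysis.Analysis"
begin

section \<open>Operators on normed spaces of functions\<close>

text \<open>
  A normed space of complex-valued functions is given by a carrier set \<open>X\<close> (closed under the
  pointwise linear operations) and a norm \<open>N\<close> on it. Functions that represent the same element
  must be equal, see \<open>bergman\<close> below. Operators are total functions of which only the
  values on \<open>X\<close> matter.
\<close>

definition linear_operator :: "('a \<Rightarrow> complex) set \<Rightarrow> (('a \<Rightarrow> complex) \<Rightarrow> ('a \<Rightarrow> complex)) \<Rightarrow> bool" where
  "linear_operator X T \<longleftrightarrow>
     (\<forall>f\<in>X. T f \<in> X) \<and>
     (\<forall>f\<in>X. \<forall>g\<in>X. \<forall>a b. T (\<lambda>z. a * f z + b * g z) = (\<lambda>z. a * T f z + b * T g z))"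

definition bounded_operators ::
  "('a \<Rightarrow> complex) set \<Rightarrow> (('a \<Rightarrow> complex) \<Rightarrow> real) \<Rightarrow> (('a \<Rightarrow> complex) \<Rightarrow> ('a \<Rightarrow> complex)) set" where
  "bounded_operators X N = {T. linear_operator X T \<and> (\<exists>B. \<forall>f\<in>X. N (T f) \<le> B * N f)}"

definition compact_operators ::
  "('a \<Rightarrow> complex) set \<Rightarrow> (('a \<Rightarrow> complex) \<Rightarrow> real) \<Rightarrow> (('a \<Rightarrow> complex) \<Rightarrow> ('a \<Rightarrow> complex)) set" where
  "compact_operators X N = {K \<in> bounded_operators X N.
     \<forall>f :: nat \<Rightarrow> 'a \<Rightarrow> complex. (\<forall>n. f n \<in> X \<and> N (f n) \<le> 1) \<longrightarrow>
       (\<exists>r. \<exists>g\<in>X. strict_mono r \<and> (\<lambda>n. N (\<lambda>z. K (f (r n)) z - g z)) \<longlonglongrightarrow> 0)}"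

definition op_norm ::
  "('a \<Rightarrow> complex) set \<Rightarrow> (('a \<Rightarrow> complex) \<Rightarrow> real) \<Rightarrow> (('a \<Rightarrow> complex) \<Rightarrow> ('a \<Rightarrow> complex)) \<Rightarrow> ennreal" where
  "op_norm X N T = (SUP f\<in>{f \<in> X. N f \<le> 1}. ennreal (N (T f)))"

definition ess_norm ::
  "('a \<Rightarrow> complex) set \<Rightarrow> (('a \<Rightarrow> complex) \<Rightarrow> real) \<Rightarrow> (('a \<Rightarrow> complex) \<Rightarrow> ('a \<Rightarrow> complex)) \<Rightarrow> ennreal" where
  "ess_norm X N T = (INF K\<in>compact_operators X N. op_norm X N (\<lambda>f z. T f z - K f z))"

definition dual_space ::
  "('a \<Rightarrow> complex) set \<Rightarrow> (('a \<Rightarrow> complex) \<Rightarrow> real) \<Rightarrow> (('a \<Rightarrow> complex) \<Rightarrow> complex) set" where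
  "dual_space X N = {l.
     (\<forall>f\<in>X. \<forall>g\<in>X. \<forall>a b. l (\<lambda>z. a * f z + b * g z) = a * l f + b * l g) \<and>
     (\<exists>B. \<forall>f\<in>X. cmod (l f) \<le> B * N f)}"

text \<open>The weakly null sequences in the unit sphere, $W_0(\partial B_X)$.\<close>

definition W0_sphere ::
  "('a \<Rightarrow> complex) set \<Rightarrow> (('a \<Rightarrow> complex) \<Rightarrow> real) \<Rightarrow> (nat \<Rightarrow> 'a \<Rightarrow> complex) set" where
  "W0_sphere X N = {f. (\<forall>n. f n \<in> X \<and> N (f n) = 1) \<and>
     (\<forall>l\<in>dual_space X N. (\<lambda>n. l (f n)) \<longlonglongrightarrow> 0)}"

text \<open>
  The Bochner integral of an \<open>X\<close>-valued function, following \<open>has_bochner_integral\<close>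
  of the library, which is only available for Banach spaces that are types.
\<close>

definition simple_integral_in :: "'t measure \<Rightarrow> ('t \<Rightarrow> 'a \<Rightarrow> complex) \<Rightarrow> 'a \<Rightarrow> complex" where
  "simple_integral_in M s =
     (\<lambda>z. \<Sum>y\<in>s ` space M. complex_of_real (measure M {t \<in> space M. s t = y}) * y z)"

definition has_integral_in ::
  "('a \<Rightarrow> complex) set \<Rightarrow> (('a \<Rightarrow> complex) \<Rightarrow> real) \<Rightarrow> 't measure \<Rightarrow>
    ('t \<Rightarrow> 'a \<Rightarrow> complex) \<Rightarrow> ('a \<Rightarrow> complex) \<Rightarrow> bool" where
  "has_integral_in X N M F g \<longleftrightarrow> g \<in> X \<and> (\<forall>t\<in>space M. F t \<in> X) \<and>
     (\<exists>s :: nat \<Rightarrow> 't \<Rightarrow> 'a \<Rightarrow> complex.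
        (\<forall>i. simple_function M (s i) \<and> s i ` space M \<subseteq> X \<and>
             emeasure M {t \<in> space M. s i t \<noteq> (\<lambda>z. 0)} < \<infinity> \<and>
             (\<lambda>t. N (\<lambda>z. F t z - s i t z)) \<in> borel_measurable M) \<and>
        (\<lambda>i. \<integral>\<^sup>+t. ennreal (N (\<lambda>z. F t z - s i t z)) \<partial>M) \<longlonglongrightarrow> 0 \<and>
        (\<lambda>i. N (\<lambda>z. simple_integral_in M (s i) z - g z)) \<longlonglongrightarrow> 0)"

definition integral_operator ::
  "('a \<Rightarrow> complex) set \<Rightarrow> (('a \<Rightarrow> complex) \<Rightarrow> real) \<Rightarrow>
    (real \<Rightarrow> ('a \<Rightarrow> complex) \<Rightarrow> ('a \<Rightarrow> complex)) \<Rightarrow> ('a \<Rightarrow> complex) \<Rightarrow> ('a \<Rightarrow> complex)" where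
  "integral_operator X N S f =
     (THE g. has_integral_in X N (restrict_space lborel {0<..<1}) (\<lambda>t. S t f) g)"


section \<open>Weighted Bergman spaces\<close>

definition dA :: "real \<Rightarrow> complex measure" where
  "dA \<alpha> = density lborel
     (\<lambda>z. ennreal (indicator (ball 0 1) z * ((1 + \<alpha>) * (1 - (cmod z)\<^sup>2) powr \<alpha> / pi)))"

text \<open>
  Elements of $A^p_\alpha$ are functions on the unit disk. They are represented by
  functions on the complex plane that vanish outside the disk, so that equality of
  elements is equality of functions.
\<close>

definition bergman :: "real \<Rightarrow> real \<Rightarrow> (complex \<Rightarrow> complex) set" where
  "bergman p \<alpha> = {f. f holomorphic_on ball 0 1 \<and> (\<forall>z. z \<notin> ball 0 1 \<longrightarrow> f z = 0) \<and>
     (\<integral>\<^sup>+z. ennreal (cmod (f z) powr p) \<partial>dA \<alpha>) < \<infinity>}"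

definition bergman_norm :: "real \<Rightarrow> real \<Rightarrow> (complex \<Rightarrow> complex) \<Rightarrow> real" where
  "bergman_norm p \<alpha> f = (\<integral>z. cmod (f z) powr p \<partial>dA \<alpha>) powr (1 / p)"

text \<open>
  The branch of $(\xi - z)^{-c}$ comes from the holomorphic logarithm
  $\mathrm{Ln}\,\xi + \mathrm{Ln}(1 - z/\xi)$ of $\xi - z$ on the disk, where
  $1 - z/\xi$ has positive real part. Another branch differs by a unimodular constant.
\<close>

definition f_hat :: "complex \<Rightarrow> real \<Rightarrow> complex \<Rightarrow> complex" where
  "f_hat \<xi> c z =
     (if z \<in> ball 0 1 then exp (- complex_of_real c * (Ln \<xi> + Ln (1 - z / \<xi>))) else 0)"

definition f_test :: "real \<Rightarrow> real \<Rightarrow> complex \<Rightarrow> real \<Rightarrow> complex \<Rightarrow> complex" where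
  "f_test p \<alpha> \<xi> c = (\<lambda>z. f_hat \<xi> c z / complex_of_real (bergman_norm p \<alpha> (f_hat \<xi> c)))"


section \<open>Admissible families of weighted composition operators\<close>

definition wcomp :: "(complex \<Rightarrow> complex) \<Rightarrow> (complex \<Rightarrow> complex) \<Rightarrow> (complex \<Rightarrow> complex) \<Rightarrow> complex \<Rightarrow> complex" where
  "wcomp u \<phi> f = (\<lambda>z. u z * f (\<phi> z))"

definition extends_continuously_near :: "complex \<Rightarrow> (complex \<Rightarrow> complex) \<Rightarrow> bool" where
  "extends_continuously_near \<xi> g \<longleftrightarrow> (\<exists>\<epsilon>>0. \<exists>h. continuous_on (cball 0 1 \<inter> ball \<xi> \<epsilon>) h \<and>
     (\<forall>z\<in>ball 0 1 \<inter> ball \<xi> \<epsilon>. h z = g z))"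

text \<open>
  The value at a boundary point is that of the continuous extension from the disk;
  the value \<open>g \<xi>\<close> of the representing function is irrelevant.
\<close>

definition boundary_value :: "(complex \<Rightarrow> complex) \<Rightarrow> complex \<Rightarrow> complex" where
  "boundary_value g \<xi> = Lim (at \<xi> within ball 0 1) g"

definition weighted_composition_family ::
  "real \<Rightarrow> real \<Rightarrow> (real \<Rightarrow> complex \<Rightarrow> complex) \<Rightarrow> (real \<Rightarrow> complex \<Rightarrow> complex) \<Rightarrow> bool" where
  "weighted_composition_family p \<alpha> u \<phi> \<longleftrightarrow> (\<forall>t\<in>{0<..<1}.
     \<phi> t holomorphic_on ball 0 1 \<and> \<phi> t ` ball 0 1 \<subseteq> ball 0 1 \<and> u t \<in> bergman p \<alpha> \<and>
     wcomp (u t) (\<phi> t) \<in> bounded_operators (bergman p \<alpha>) (bergman_norm p \<alpha>))"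

text \<open>
  In the fourth condition below the horocycle is the circle of radius \<open>r < 1\<close> about
  \<open>(1 - r) \<xi>\<close>. In the second one the extension of \<open>\<phi> t\<close> to \<open>\<xi>\<close> exists because the
  derivative is bounded near \<open>\<xi>\<close>.
\<close>

definition has_direction ::
  "complex \<Rightarrow> (real \<Rightarrow> complex \<Rightarrow> complex) \<Rightarrow> (real \<Rightarrow> complex \<Rightarrow> complex) \<Rightarrow> bool" where
  "has_direction \<xi> u \<phi> \<longleftrightarrow> (\<forall>t\<in>{0<..<1}.
     \<phi> t holomorphic_on ball 0 1 \<and> extends_continuously_near \<xi> (deriv (\<phi> t)) \<and>
     (\<phi> t \<longlongrightarrow> \<xi>) (at \<xi> within ball 0 1) \<and>
     (\<forall>\<epsilon>>0. closure (\<phi> t ` (ball 0 1 - ball \<xi> \<epsilon>)) \<inter> sphere 0 1 = {}) \<and>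
     (\<forall>\<epsilon>>0. \<exists>r. 0 < r \<and> r < 1 \<and>
        sphere (complex_of_real (1 - r) * \<xi>) r \<subseteq> closure (\<phi> t ` (ball \<xi> \<epsilon> \<inter> ball 0 1))) \<and>
     extends_continuously_near \<xi> (u t))"

definition admissible ::
  "real \<Rightarrow> real \<Rightarrow> complex \<Rightarrow> (real \<Rightarrow> complex \<Rightarrow> complex) \<Rightarrow> (real \<Rightarrow> complex \<Rightarrow> complex) \<Rightarrow> bool" where
  "admissible p \<alpha> \<xi> u \<phi> \<longleftrightarrow>
     weighted_composition_family p \<alpha> u \<phi> \<and>
     has_direction \<xi> u \<phi> \<and>
     (\<integral>\<^sup>+t\<in>{0<..<1}. op_norm (bergman p \<alpha>) (bergman_norm p \<alpha>) (wcomp (u t) (\<phi> t)) \<partial>lborel) < \<infinity> \<and>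
     (\<forall>t0\<in>{0<..<1}.
        ((\<lambda>t. SUP z\<in>ball 0 1. cmod (\<phi> t z - \<phi> t0 z)) \<longlongrightarrow> 0) (at t0) \<and>
        (\<forall>\<epsilon>>0. ((\<lambda>t. \<integral>z\<in>ball 0 1 - ball \<xi> \<epsilon>. cmod (u t z - u t0 z) powr p \<partial>dA \<alpha>)
           \<longlongrightarrow> 0) (at t0)) \<and>
        (\<exists>\<epsilon>>0. (SUP t\<in>{0<..<1} \<inter> ball t0 \<epsilon>. SUP z\<in>ball \<xi> \<epsilon> \<inter> ball 0 1.
           ennreal (cmod (u t z))) < \<infinity>) \<and>
        (\<exists>\<epsilon>>0. (INF t\<in>{0<..<1} \<inter> ball t0 \<epsilon>. INF z\<in>ball \<xi> \<epsilon> \<inter> ball 0 1.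
           ennreal (cmod (deriv (\<phi> t) z))) > 0))"

end

theory Submission
  imports Defs "HOL-Complex_Analysis.Great_Picard"
begin

text \<open>
  Let \<open>w\<^sub>n z = ((1 + cnj \<xi> z) / 2) ^ n\<close>, a bounded holomorphic function that is \<open>1\<close> at \<open>\<xi>\<close>
  and tends to \<open>0\<close> away from \<open>\<xi>\<close>. Since \<open>\<phi>\<^sub>t\<close> maps the part of the disk away from \<open>\<xi>\<close> into a
  compact subset of the disk, \<open>(1 - w\<^sub>n) S\<^sub>t\<close> is compact, while a change of variables near \<open>\<xi>\<close>
  gives \<open>\<parallel>w\<^sub>n S\<^sub>t\<parallel> \<longrightarrow> W t\<close> with \<open>W t = |u\<^sub>t(\<xi>)| \<phi>\<^sub>t'(\<xi>) powr (- (2 + \<alpha>) / p)\<close>. The test functions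
  are weakly null and asymptotic eigenvectors: \<open>S\<^sub>t f\<^sub>c - \<sigma> W t f\<^sub>c \<longrightarrow> 0\<close> in norm, where
  \<open>\<sigma> = u\<^sub>t(\<xi>) / |u\<^sub>t(\<xi>)|\<close>. Hence \<open>W t\<close> is both the essential norm of \<open>S\<^sub>t\<close> and the supremum over weakly
  null sequences. As \<open>\<sigma>\<close> does not depend on \<open>t\<close>, all three facts pass to \<open>\<integral> S\<^sub>t dt\<close>, with
  \<open>\<integral> W t dt\<close> in place of \<open>W t\<close>, by Minkowski's integral inequality and dominated convergence.
\<close>

section \<open>Minkowski inequalities\<close>

text \<open>The cutoff must be holomorphic: an indicator of a disc about \<xi> would lead out of the
  Bergman space, and the essential norm admits only operators into it. The exponent 2 + \<alpha> in
  the limit value has two sources. Near \<xi> the symbol stretches lengths by almost d =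
  \<phi>'(\<xi>), so area contributes d^2; it also enlarges 1 - |z|^2 by a factor at least close to
  d, so the weight contributes d^\<alpha>. Both factors are needed with their sharp constants, since
  upper and lower bound have to meet. The common phase \<sigma> is what lets the lower bounds
  survive integration: the approximate eigenvalues add up to \<sigma> times the integral of
  \<open>W\<close> without cancellation. Two obstacles shape the rest. Weakly null sequences are
  handled without a description of the dual space: they are the norm bounded, pointwise null ones,
  by a gliding hump argument that uses p > 1. And the vector-valued integral requires strong
  measurability in t, while admissibility only yields pointwise continuity of \<open>S t f\<close>
  in t; a norm-separable range has to be extracted from that.\<close>

definition lp_bound :: "real \<Rightarrow> 'a measure \<Rightarrow> ('a \<Rightarrow> complex) \<Rightarrow> real \<Rightarrow> bool" where
  "lp_bound p M f b \<longleftrightarrow> 0 \<le> b \<and> f \<in> borel_measurable M \<and>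
     (\<integral>\<^sup>+z. ennreal (cmod (f z) powr p) \<partial>M) \<le> ennreal (b powr p)"

text \<open>The convex function \<open>x powr p\<close> lies above its tangent at \<open>y\<close>.
  Its value is the linearity in \<open>x\<close>: after integration it becomes a Jensen-type
  inequality, and this one estimate drives both Minkowski inequalities and the sub-mean-value
  property.\<close>

lemma powr_tangent:
  fixes x y p :: real
  assumes "p > 1" "x \<ge> 0" "y \<ge> 0"
  shows "p * y powr (p - 1) * x \<le> x powr p + (p - 1) * y powr p"
proof (cases "x = 0 \<or> y = 0")
  case True
  with assms show ?thesis by auto
next
  case False
  define q where "q = p / (p - 1)"
  have "q > 1" "1 / p + 1 / q = 1"
    using assms by (auto simp: q_def field_simps)
  then have "x * y powr (p - 1) \<le> x powr p / p + (y powr (p - 1)) powr q / q"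
    using assms by (intro Youngs_inequality) auto
  also have "(y powr (p - 1)) powr q = y powr p"
    using assms by (simp add: powr_powr q_def)
  finally have "p * (x * y powr (p - 1)) \<le> p * (x powr p / p + y powr p / q)"
    using assms by (intro mult_left_mono) auto
  also have "p * (x powr p / p + y powr p / q) = x powr p + (p - 1) * y powr p"
    using assms by (simp add: q_def field_simps)
  finally show ?thesis by (simp add: mult_ac)
qed

text \<open>Jensen's inequality for the values \<open>x / a\<close> and \<open>y / b\<close> with
  masses \<open>a\<close> and \<open>b\<close>. When \<open>a\<close> and \<open>b\<close> bound the
  norms of two functions, integrating the right side gives at most
  \<open>(a + b) powr p\<close>.\<close>

lemma powr_sum_le:
  fixes x y a b p :: real
  assumes p: "p > 1" and nn: "x \<ge> 0" "y \<ge> 0" and pos: "a > 0" "b > 0"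
  shows "(x + y) powr p \<le> (a + b) powr (p - 1) * (x powr p * a powr (1 - p) + y powr p * b powr (1 - p))"
proof -
  \<comment> \<open>The mean of \<open>x / a\<close> and \<open>y / b\<close> with masses
    \<open>a\<close> and \<open>b\<close>. Using the tangent at this common point for both terms
    lets the linear parts recombine to \<open>x + y\<close>.\<close>
  define m where "m = (x + y) / (a + b)"
  have m: "m \<ge> 0" using nn pos by (simp add: m_def)
  have c: "a * (x / a) powr p = x powr p * a powr (1 - p)" "b * (y / b) powr p = y powr p * b powr (1 - p)"
    using nn pos by (simp_all add: powr_divide powr_diff)
  have "a * (p * m powr (p - 1) * (x / a)) \<le> a * ((x / a) powr p + (p - 1) * m powr p)"
    using nn pos p m by (intro mult_left_mono powr_tangent) auto
  moreover have "b * (p * m powr (p - 1) * (y / b)) \<le> b * ((y / b) powr p + (p - 1) * m powr p)"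
    using nn pos p m by (intro mult_left_mono powr_tangent) auto
  ultimately have "p * m powr (p - 1) * (x + y)
      \<le> x powr p * a powr (1 - p) + y powr p * b powr (1 - p) + (p - 1) * m powr p * (a + b)"
    using pos c by (simp add: algebra_simps)
  moreover have "m powr (p - 1) * (x + y) = m powr p * (a + b)"
  proof -
    have "x + y = m * (a + b)" using pos by (simp add: m_def)
    moreover have "m powr (p - 1) * m = m powr p"
      using m p by (cases "m = 0") (auto simp: powr_diff)
    ultimately show ?thesis by (metis mult.assoc)
  qed
  ultimately have "p * (m powr p * (a + b)) \<le> x powr p * a powr (1 - p) + y powr p * b powr (1 - p) + (p - 1) * m powr p * (a + b)"
    by (metis mult.assoc)
  then have "m powr p * (a + b) \<le> x powr p * a powr (1 - p) + y powr p * b powr (1 - p)"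
    by (simp add: algebra_simps)
  then have "(a + b) powr (p - 1) * (m powr p * (a + b))
      \<le> (a + b) powr (p - 1) * (x powr p * a powr (1 - p) + y powr p * b powr (1 - p))"
    by (intro mult_left_mono) auto
  moreover have "(a + b) powr (p - 1) * (m powr p * (a + b)) = (x + y) powr p"
    using nn pos p by (simp add: m_def powr_divide powr_diff)
  ultimately show ?thesis by simp
qed

lemma lp_bound_mono:
  assumes "lp_bound p M f b" "b \<le> b'" "p > 0"
  shows "lp_bound p M f b'"
proof -
  have "ennreal (b powr p) \<le> ennreal (b' powr p)"
    using assms by (intro ennreal_leI powr_mono2) (auto simp: lp_bound_def)
  with assms show ?thesis
    unfolding lp_bound_def by (meson order_trans)
qed

lemma lp_bound_le:
  assumes "lp_bound p M g b" "f \<in> borel_measurable M" "AE z in M. cmod (f z) \<le> cmod (g z)" "p > 0"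
  shows "lp_bound p M f b"
proof -
  have "(\<integral>\<^sup>+z. ennreal (cmod (f z) powr p) \<partial>M) \<le> (\<integral>\<^sup>+z. ennreal (cmod (g z) powr p) \<partial>M)"
    using assms(3) by (intro nn_integral_mono_AE) (use assms in \<open>auto elim!: eventually_mono intro!: ennreal_leI powr_mono2\<close>)
  with assms show ?thesis unfolding lp_bound_def by auto
qed

lemma lp_bound_cmult:
  assumes "lp_bound p M f b" "p > 0"
  shows "lp_bound p M (\<lambda>z. c * f z) (cmod c * b)"
proof -
  have [measurable]: "f \<in> borel_measurable M" and b: "b \<ge> 0" using assms by (auto simp: lp_bound_def)
  have "(\<integral>\<^sup>+z. ennreal (cmod (c * f z) powr p) \<partial>M) = (\<integral>\<^sup>+z. ennreal (cmod c powr p) * ennreal (cmod (f z) powr p) \<partial>M)"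
    by (simp add: norm_mult powr_mult ennreal_mult)
  also have "\<dots> = ennreal (cmod c powr p) * (\<integral>\<^sup>+z. ennreal (cmod (f z) powr p) \<partial>M)"
    by (subst nn_integral_cmult) auto
  also have "\<dots> \<le> ennreal (cmod c powr p) * ennreal (b powr p)"
    using assms by (intro mult_left_mono) (auto simp: lp_bound_def)
  also have "\<dots> = ennreal ((cmod c * b) powr p)"
    using b by (simp add: powr_mult ennreal_mult)
  finally show ?thesis using b by (simp add: lp_bound_def)
qed

text \<open>The convexity arguments below divide by the bounds and so need them strictly positive;
  this limit recovers bounds that may vanish.\<close>

lemma lp_bound_limit:
  assumes "\<And>e. e > 0 \<Longrightarrow> lp_bound p M f (b + e)" "p > 0" "b \<ge> 0"
  shows "lp_bound p M f b"
proof -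
  let ?I = "\<integral>\<^sup>+z. ennreal (cmod (f z) powr p) \<partial>M"
  have lim: "(\<lambda>n. ennreal ((b + 1 / real (Suc n)) powr p)) \<longlonglongrightarrow> ennreal (b powr p)"
  proof (intro tendsto_ennrealI tendsto_powr2)
    show "(\<lambda>n. b + 1 / real (Suc n)) \<longlonglongrightarrow> b"
      using tendsto_add[OF tendsto_const LIMSEQ_inverse_real_of_nat, of b] by (simp add: inverse_eq_divide)
  qed (use assms in auto)
  have le: "?I \<le> ennreal ((b + 1 / real (Suc n)) powr p)" for n
    using assms(1)[of "1 / real (Suc n)"] by (auto simp: lp_bound_def)
  have "?I \<le> ennreal (b powr p)"
    by (rule LIMSEQ_le_const[OF lim]) (use le in blast)
  with assms(1)[of 1] \<open>b \<ge> 0\<close> show ?thesis by (auto simp: lp_bound_def)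
qed

lemma lp_bound_add:
  assumes p: "p > 1" and f: "lp_bound p M f a" and g: "lp_bound p M g b"
  shows "lp_bound p M (\<lambda>z. f z + g z) (a + b)"
proof -
  have [measurable]: "f \<in> borel_measurable M" "g \<in> borel_measurable M"
    and nn: "a \<ge> 0" "b \<ge> 0" using f g by (auto simp: lp_bound_def)
  have *: "lp_bound p M (\<lambda>z. f z + g z) (a + b)"
    if f: "lp_bound p M f a" and g: "lp_bound p M g b" and pos: "a > 0" "b > 0" for a b
  proof -
    have "(\<integral>\<^sup>+z. ennreal (cmod (f z + g z) powr p) \<partial>M) \<le>
      (\<integral>\<^sup>+z. ennreal ((a + b) powr (p - 1)) * (ennreal (a powr (1 - p)) * ennreal (cmod (f z) powr p)
        + ennreal (b powr (1 - p)) * ennreal (cmod (g z) powr p)) \<partial>M)"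
    proof (intro nn_integral_mono)
      fix z
      have "cmod (f z + g z) powr p \<le> (cmod (f z) + cmod (g z)) powr p"
        using p by (intro powr_mono2 norm_triangle_ineq) auto
      also have "\<dots> \<le> (a + b) powr (p - 1) * (cmod (f z) powr p * a powr (1 - p) + cmod (g z) powr p * b powr (1 - p))"
        using p pos by (intro powr_sum_le) auto
      finally show "ennreal (cmod (f z + g z) powr p) \<le> ennreal ((a + b) powr (p - 1)) *
          (ennreal (a powr (1 - p)) * ennreal (cmod (f z) powr p) + ennreal (b powr (1 - p)) * ennreal (cmod (g z) powr p))"
        by (simp add: mult.commute flip: ennreal_mult ennreal_plus)
    qed
    also have "\<dots> = ennreal ((a + b) powr (p - 1)) * (ennreal (a powr (1 - p)) * (\<integral>\<^sup>+z. ennreal (cmod (f z) powr p) \<partial>M)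
        + ennreal (b powr (1 - p)) * (\<integral>\<^sup>+z. ennreal (cmod (g z) powr p) \<partial>M))"
      by (simp add: nn_integral_cmult nn_integral_add)
    also have "\<dots> \<le> ennreal ((a + b) powr (p - 1)) * (ennreal (a powr (1 - p)) * ennreal (a powr p)
        + ennreal (b powr (1 - p)) * ennreal (b powr p))"
      using f g unfolding lp_bound_def by (intro mult_left_mono add_mono) auto
    also have "\<dots> = ennreal ((a + b) powr (p - 1) * (a + b))"
      using pos by (simp add: powr_diff flip: ennreal_mult ennreal_plus)
    also have "(a + b) powr (p - 1) * (a + b) = (a + b) powr p"
      using pos by (simp add: powr_diff)
    finally show ?thesis using pos by (simp add: lp_bound_def)
  qed
  show ?thesis
  proof (rule lp_bound_limit)
    fix e :: real assume e: "e > 0"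
    have "lp_bound p M (\<lambda>z. f z + g z) ((a + e / 2) + (b + e / 2))"
      using p e nn by (intro *) (auto intro!: lp_bound_mono[OF f] lp_bound_mono[OF g])
    then show "lp_bound p M (\<lambda>z. f z + g z) (a + b + e)" by (simp add: algebra_simps)
  qed (use p nn in auto)
qed

text \<open>Minkowski's integral inequality with a prescribed majorant \<open>b\<close> of the
  norms. It is the continuous form of \<open>powr_sum_le\<close>: for fixed z, Jensen's inequality
  for \<open>cmod (H t z) / b t\<close> with respect to the density \<open>b\<close>, followed by
  Fubini's theorem.\<close>

lemma lp_bound_integral:
  fixes H :: "'t \<Rightarrow> 'z \<Rightarrow> complex" and b :: "'t \<Rightarrow> real"
  assumes p: "p > 1" and "finite_measure M" "sigma_finite_measure M'"
    and H: "(\<lambda>(t, z). H t z) \<in> borel_measurable (M \<Otimes>\<^sub>M M')"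
    and b[measurable]: "b \<in> borel_measurable M" and bH: "\<And>t. t \<in> space M \<Longrightarrow> lp_bound p M' (H t) (b t)"
    and B: "(\<integral>\<^sup>+t. ennreal (b t) \<partial>M) \<le> ennreal B" "B \<ge> 0"
  shows "lp_bound p M' (\<lambda>z. \<integral>t. H t z \<partial>M) B"
proof -
  interpret M: finite_measure M by fact
  interpret M': sigma_finite_measure M' by fact
  interpret P: pair_sigma_finite M M' ..
  have [measurable]: "(\<lambda>z. H (fst z) (snd z)) \<in> borel_measurable (M \<Otimes>\<^sub>M M')"
    using H by (simp add: case_prod_unfold)
  have [measurable]: "(\<lambda>z. H (snd z) (fst z)) \<in> borel_measurable (M' \<Otimes>\<^sub>M M)"
    using measurable_compose[OF measurable_pair_swap' H] by (simp add: case_prod_unfold)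
  have meas: "(\<lambda>z. \<integral>t. H t z \<partial>M) \<in> borel_measurable M'"
    by (rule M.borel_measurable_lebesgue_integral) (use measurable_compose[OF measurable_pair_swap' H] in \<open>simp add: case_prod_unfold\<close>)
  have *: "lp_bound p M' (\<lambda>z. \<integral>t. H t z \<partial>M) B"
    if b[measurable]: "b \<in> borel_measurable M" and pos: "\<And>t. b t > 0"
     and bH: "\<And>t. t \<in> space M \<Longrightarrow> lp_bound p M' (H t) (b t)"
     and B: "(\<integral>\<^sup>+t. ennreal (b t) \<partial>M) \<le> ennreal B" "B > 0" for b B
  proof -
    define R where "R z = (\<integral>\<^sup>+t. ennreal (cmod (H t z) powr p * b t powr (1 - p)) \<partial>M)" for z
    have key: "ennreal (cmod (\<integral>t. H t z \<partial>M) powr p) \<le> ennreal (B powr (p - 1)) * R z" if z: "z \<in> space M'" for z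
    proof -
      have Hz[measurable]: "(\<lambda>t. H t z) \<in> borel_measurable M"
        using measurable_compose[OF measurable_Pair2'[OF z] H] by simp
      define x where "x = cmod (\<integral>t. H t z \<partial>M)"
      \<comment> \<open>The point of tangency; \<open>x / B\<close> plays the part of the mean of
        \<open>cmod (H t z) / b t\<close> for the density \<open>b t / B\<close>.\<close>
      define y where "y = x / B"
      have y: "y \<ge> 0" using B by (simp add: y_def x_def)
      have x: "ennreal x \<le> (\<integral>\<^sup>+t. ennreal (cmod (H t z)) \<partial>M)"
      \<comment> \<open>For a non-integrable section the integral has the default value 0, so the
        bound is trivial.\<close>
      proof (cases "integrable M (\<lambda>t. H t z)")
        case True
        then show ?thesis unfolding x_def by (rule integral_norm_bound_ennreal)
      qed (simp add: x_def not_integrable_integral_eq)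
      have pt: "p * y powr (p - 1) * cmod (H t z) \<le> cmod (H t z) powr p * b t powr (1 - p) + (p - 1) * y powr p * b t" for t
      proof -
        have "b t * (p * y powr (p - 1) * (cmod (H t z) / b t)) \<le> b t * ((cmod (H t z) / b t) powr p + (p - 1) * y powr p)"
          using pos[of t] y p by (intro mult_left_mono powr_tangent) auto
        moreover have "b t * (cmod (H t z) / b t) powr p = cmod (H t z) powr p * b t powr (1 - p)"
          using pos[of t] by (simp add: powr_divide powr_diff)
        ultimately show ?thesis using pos[of t] by (simp add: algebra_simps)
      qed
      have "ennreal (p * y powr (p - 1)) * ennreal x \<le> ennreal (p * y powr (p - 1)) * (\<integral>\<^sup>+t. ennreal (cmod (H t z)) \<partial>M)"
        by (intro mult_left_mono x) auto
      also have "\<dots> = (\<integral>\<^sup>+t. ennreal (p * y powr (p - 1)) * ennreal (cmod (H t z)) \<partial>M)"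
        by (simp add: nn_integral_cmult)
      also have "\<dots> \<le> (\<integral>\<^sup>+t. ennreal (cmod (H t z) powr p * b t powr (1 - p)) + ennreal ((p - 1) * y powr p) * ennreal (b t) \<partial>M)"
      proof (intro nn_integral_mono)
        fix t
        show "ennreal (p * y powr (p - 1)) * ennreal (cmod (H t z))
          \<le> ennreal (cmod (H t z) powr p * b t powr (1 - p)) + ennreal ((p - 1) * y powr p) * ennreal (b t)"
          using pt[of t] p pos[of t] by (simp add: less_imp_le flip: ennreal_mult ennreal_plus)
      qed
      also have "\<dots> = R z + ennreal ((p - 1) * y powr p) * (\<integral>\<^sup>+t. ennreal (b t) \<partial>M)"
        by (simp add: nn_integral_add nn_integral_cmult R_def)
      also have "\<dots> \<le> R z + ennreal ((p - 1) * y powr p) * ennreal B"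
        by (intro add_left_mono mult_left_mono B) auto
      finally have le: "ennreal (p * y powr (p - 1) * x) \<le> R z + ennreal ((p - 1) * y powr p * B)"
        using p y B x_def by (simp add: ennreal_mult)
      have "p * y powr (p - 1) * x = p * (y powr p * B)"
      proof -
        have "y powr (p - 1) * y = y powr p" using y p by (cases "y = 0") (auto simp: powr_diff)
        moreover have "x = y * B" using B by (simp add: y_def)
        ultimately show ?thesis by (metis mult.assoc)
      qed
      \<comment> \<open>The term with factor p - 1 is split off in order to be cancelled; it is
        finite, as cancellation in \<open>ennreal\<close> requires.\<close>
      then have "ennreal (y powr p * B) + ennreal ((p - 1) * y powr p * B) \<le> R z + ennreal ((p - 1) * y powr p * B)"
      proof -
        have "ennreal (y powr p * B) + ennreal ((p - 1) * y powr p * B) = ennreal (p * (y powr p * B))"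
          using p B mult_right_mono[of 1 p "y powr p"]
          by (subst ennreal_plus[symmetric]) (auto simp: algebra_simps)
        with le \<open>p * y powr (p - 1) * x = p * (y powr p * B)\<close> show ?thesis by simp
      qed
      then have yR: "ennreal (y powr p * B) \<le> R z"
        by (simp add: ennreal_add_left_cancel_le add.commute)
      have "x powr p = B powr (p - 1) * (y powr p * B)"
        using B x_def by (simp add: y_def powr_divide powr_diff)
      then have "ennreal (x powr p) = ennreal (B powr (p - 1)) * ennreal (y powr p * B)"
        using B by (simp add: ennreal_mult)
      also have "\<dots> \<le> ennreal (B powr (p - 1)) * R z" by (intro mult_left_mono yR) auto
      finally show ?thesis by (simp add: x_def)
    qed
    have "(\<integral>\<^sup>+z. ennreal (cmod (\<integral>t. H t z \<partial>M) powr p) \<partial>M') \<le> (\<integral>\<^sup>+z. ennreal (B powr (p - 1)) * R z \<partial>M')"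
      by (intro nn_integral_mono key)
    also have "\<dots> = ennreal (B powr (p - 1)) * (\<integral>\<^sup>+z. R z \<partial>M')"
      unfolding R_def by (intro nn_integral_cmult) measurable
    also have "(\<integral>\<^sup>+z. R z \<partial>M') = (\<integral>\<^sup>+t. (\<integral>\<^sup>+z. ennreal (cmod (H t z) powr p * b t powr (1 - p)) \<partial>M') \<partial>M)"
      unfolding R_def
      using P.Fubini[of "\<lambda>(t, z). ennreal (cmod (H t z) powr p * b t powr (1 - p))"] by (simp add: case_prod_unfold)
    also have "\<dots> \<le> (\<integral>\<^sup>+t. ennreal (b t) \<partial>M)"
    proof (intro nn_integral_mono)
      fix t assume t: "t \<in> space M"
      then have [measurable]: "H t \<in> borel_measurable M'" using bH by (auto simp: lp_bound_def)
      have "(\<integral>\<^sup>+z. ennreal (cmod (H t z) powr p * b t powr (1 - p)) \<partial>M') = (\<integral>\<^sup>+z. ennreal (b t powr (1 - p)) * ennreal (cmod (H t z) powr p) \<partial>M')"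
        by (simp add: ennreal_mult mult.commute)
      also have "\<dots> = ennreal (b t powr (1 - p)) * (\<integral>\<^sup>+z. ennreal (cmod (H t z) powr p) \<partial>M')"
        by (simp add: nn_integral_cmult)
      also have "\<dots> \<le> ennreal (b t powr (1 - p)) * ennreal (b t powr p)"
        using bH[OF t] by (intro mult_left_mono) (auto simp: lp_bound_def)
      also have "\<dots> = ennreal (b t)" using pos[of t] by (simp add: powr_diff flip: ennreal_mult)
      finally show "(\<integral>\<^sup>+z. ennreal (cmod (H t z) powr p * b t powr (1 - p)) \<partial>M') \<le> ennreal (b t)" .
    qed
    also have "\<dots> \<le> ennreal B" by (rule B)
    finally have "(\<integral>\<^sup>+z. ennreal (cmod (\<integral>t. H t z \<partial>M) powr p) \<partial>M') \<le> ennreal (B powr (p - 1)) * ennreal B"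
      by (simp add: mult_left_mono)
    also have "\<dots> = ennreal (B powr p)" using B by (simp add: powr_diff flip: ennreal_mult)
    finally show ?thesis using meas B by (simp add: lp_bound_def)
  qed
  show ?thesis
  proof (rule lp_bound_limit)
    fix e :: real assume e: "e > 0"
    \<comment> \<open>Raising every \<open>b t\<close> by \<open>d\<close> makes it positive at a
      total cost of at most \<open>e\<close>; the 1 in the denominator guards against total mass
      0.\<close>
    define d where "d = e / (measure M (space M) + 1)"
    have d: "d > 0" unfolding d_def using e by (intro divide_pos_pos) (auto simp: add_nonneg_pos)
    have de: "d * measure M (space M) \<le> e" 
    proof -
      have "d * measure M (space M) \<le> d * (measure M (space M) + 1)"
        using d by (intro mult_left_mono) auto
      also have "\<dots> = e" unfolding d_def by (simp add: add_nonneg_pos less_imp_neq[symmetric])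
      finally show ?thesis .
    qed
    \<comment> \<open>Outside \<open>space M\<close> the sign of \<open>b\<close> is unknown, hence
      the maximum with 0.\<close>
    define b' where "b' t = max 0 (b t) + d" for t
    show "lp_bound p M' (\<lambda>z. \<integral>t. H t z \<partial>M) (B + e)"
    proof (rule *)
      show "b' \<in> borel_measurable M" unfolding b'_def by measurable
      show "b' t > 0" for t using d by (simp add: b'_def add_nonneg_pos)
      show "lp_bound p M' (H t) (b' t)" if "t \<in> space M" for t
        using bH[OF that] p d by (elim lp_bound_mono) (auto simp: b'_def)
      have "(\<integral>\<^sup>+t. ennreal (b' t) \<partial>M) = (\<integral>\<^sup>+t. ennreal (b t) + ennreal d \<partial>M)"
        using d by (intro nn_integral_cong) (auto simp: b'_def max_def ennreal_neg simp flip: ennreal_plus)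
      also have "\<dots> = (\<integral>\<^sup>+t. ennreal (b t) \<partial>M) + ennreal d * emeasure M (space M)"
        by (simp add: nn_integral_add)
      also have "\<dots> \<le> ennreal B + ennreal (d * measure M (space M))"
        using B d by (intro add_mono) (auto simp: M.emeasure_eq_measure ennreal_mult)
      also have "\<dots> \<le> ennreal (B + e)"
        using B d de by (simp add: ennreal_leI flip: ennreal_plus)
      finally show "(\<integral>\<^sup>+t. ennreal (b' t) \<partial>M) \<le> ennreal (B + e)" .
      show "B + e > 0" using B e by simp
    qed
  qed (use p B in auto)
qed

section \<open>Planar measure and the area mean value property\<close>

lemma emeasure_distr_restrict_lborel:
  fixes \<phi> :: "complex \<Rightarrow> complex"
  assumes "open A" "continuous_on A \<phi>" "E \<in> sets borel"
  shows "emeasure (distr (restrict_space lborel A) borel \<phi>) E = emeasure lborel (A \<inter> \<phi> -` E)"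
    and "A \<inter> \<phi> -` E \<in> sets borel"
proof -
  have [measurable]: "\<phi> \<in> borel_measurable (restrict_space lborel A)"
    using borel_measurable_continuous_on_restrict[OF assms(2)]
    by (simp cong: measurable_cong_sets add: sets_restrict_space)
  have eq: "\<phi> -` E \<inter> space (restrict_space lborel A) = A \<inter> \<phi> -` E"
    using assms(1) by (auto simp: space_restrict_space)
  have "\<phi> -` E \<inter> space (restrict_space lborel A) \<in> sets (restrict_space lborel A)"
    using assms(3) by measurable
  then show m: "A \<inter> \<phi> -` E \<in> sets borel"
    unfolding eq using assms(1) by (auto simp: sets_restrict_space_iff)
  show "emeasure (distr (restrict_space lborel A) borel \<phi>) E = emeasure lborel (A \<inter> \<phi> -` E)"
    using assms by (subst emeasure_distr) (simp_all add: eq emeasure_restrict_space Int_commute)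
qed

text \<open>The inverse of \<phi> on the image is L-Lipschitz, so the preimage of a disc of radius r
  lies in a disc of radius L r, whose area is larger by L^2. Vitali's covering theorem carries this
  from discs to open sets without loss in the constant, and outer regularity carries it to Borel
  sets. The sharp factor L^2 is what lets the later operator bound tend to the exact value.\<close>

lemma emeasure_vimage_expanding:
  fixes \<phi> :: "complex \<Rightarrow> complex"
  assumes A: "open A" "continuous_on A \<phi>" and L: "L > 0"
    and ex: "\<And>z z'. z \<in> A \<Longrightarrow> z' \<in> A \<Longrightarrow> dist z z' \<le> L * dist (\<phi> z) (\<phi> z')"
    and E: "E \<in> sets borel"
  shows "emeasure lborel (A \<inter> \<phi> -` E) \<le> ennreal (L\<^sup>2) * emeasure lborel E"
proof -
  define \<nu> where "\<nu> = distr (restrict_space lborel A) borel \<phi>"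
  have sets[simp]: "sets \<nu> = sets borel" by (simp add: \<nu>_def)
  have \<nu>: "emeasure \<nu> E = emeasure lborel (A \<inter> \<phi> -` E)" if "E \<in> sets borel" for E
    unfolding \<nu>_def using A that by (rule emeasure_distr_restrict_lborel)
  have inj: "inj_on \<phi> A"
    by (rule inj_onI) (use ex in force)
  define g where "g = inv_into A \<phi>"
  have g: "g (\<phi> z) = z" if "z \<in> A" for z using inj that by (simp add: g_def)
  have g_lip: "dist (g w) (g w') \<le> L * dist w w'" if "w \<in> \<phi> ` A" "w' \<in> \<phi> ` A" for w w'
    using that g ex by auto
  have open_case: "emeasure \<nu> V \<le> ennreal (L\<^sup>2) * emeasure lborel V" if V: "open V" "V \<subseteq> \<phi> ` A" for V
  proof -
    define K where "K = {(c, r). 0 < r \<and> ball c r \<subseteq> V}"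
    have "\<exists>i. i \<in> K \<and> x \<in> ball (fst i) (snd i) \<and> snd i < d" if x: "x \<in> V" and d: "0 < d" for x d
    proof -
      obtain e where e: "e > 0" "ball x e \<subseteq> V" using V(1) x by (meson openE)
      with d have "(x, min e (d / 2)) \<in> K \<and> x \<in> ball x (min e (d/2)) \<and> min e (d/2) < d"
        by (auto simp: K_def)
      then show ?thesis by (metis fst_conv snd_conv)
    qed
    \<comment> \<open>Disjoint discs inside \<open>V\<close> exhaust it up to a null set, so their
      areas add up to at most the area of \<open>V\<close>.\<close>
    then obtain C where C: "countable C" "C \<subseteq> K"
      and disj: "pairwise (\<lambda>i j. disjnt (ball (fst i) (snd i)) (ball (fst j) (snd j))) C"
      and neg: "negligible (V - (\<Union>i\<in>C. ball (fst i) (snd i)))"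
      by (rule Vitali_covering_theorem_balls[of V K fst snd])
    define U where "U = (\<Union>i\<in>C. ball (fst i) (snd i))"
    have [measurable]: "U \<in> sets borel" "V \<in> sets borel"
      using V by (auto simp: U_def intro!: borel_open)
    have "ball (fst i) (snd i) \<subseteq> V" if "i \<in> C" for i
      using subsetD[OF C(2) that] by (simp add: K_def case_prod_unfold)
    then have UV: "U \<subseteq> V" by (auto simp: U_def)
    have dfam: "disjoint_family_on (\<lambda>i. ball (fst i) (snd i)) C"
      using disj by (auto simp: disjoint_family_on_def pairwise_def disjnt_def)
    have "emeasure \<nu> U = (\<integral>\<^sup>+i. emeasure \<nu> (ball (fst i) (snd i)) \<partial>count_space C)"
      unfolding U_def by (rule emeasure_UN_countable) (use C dfam in auto)
    also have "\<dots> \<le> (\<integral>\<^sup>+i. ennreal (L\<^sup>2) * emeasure lborel (ball (fst i) (snd i)) \<partial>count_space C)"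
    proof (rule nn_integral_mono)
      fix i assume "i \<in> space (count_space C)"
      then have i: "0 < snd i" "ball (fst i) (snd i) \<subseteq> V" using subsetD[OF C(2), of i] by (auto simp: K_def case_prod_unfold)
      then have cV: "fst i \<in> \<phi> ` A" using V by force
      have "A \<inter> \<phi> -` ball (fst i) (snd i) \<subseteq> ball (g (fst i)) (L * snd i)"
      proof
        fix z assume z: "z \<in> A \<inter> \<phi> -` ball (fst i) (snd i)"
        then have "dist (g (fst i)) (g (\<phi> z)) \<le> L * dist (fst i) (\<phi> z)"
          using cV by (intro g_lip) auto
        also have "\<dots> < L * snd i" using z L by auto
        finally show "z \<in> ball (g (fst i)) (L * snd i)" using z g by auto
      qed
      then have "emeasure \<nu> (ball (fst i) (snd i)) \<le> emeasure lborel (ball (g (fst i)) (L * snd i))"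
        by (subst \<nu>) (auto intro!: emeasure_mono)
      also have "\<dots> = ennreal (L\<^sup>2) * emeasure lborel (ball (fst i) (snd i))"
        using L i by (simp add: emeasure_ball power_mult_distrib mult_ac flip: ennreal_mult)
      finally show "emeasure \<nu> (ball (fst i) (snd i)) \<le> ennreal (L\<^sup>2) * emeasure lborel (ball (fst i) (snd i))" .
    qed
    also have "\<dots> = ennreal (L\<^sup>2) * (\<integral>\<^sup>+i. emeasure lborel (ball (fst i) (snd i)) \<partial>count_space C)"
      by (rule nn_integral_cmult) auto
    also have "(\<integral>\<^sup>+i. emeasure lborel (ball (fst i) (snd i)) \<partial>count_space C) = emeasure lborel U"
      unfolding U_def by (rule emeasure_UN_countable[symmetric]) (use C dfam in auto)
    also have "\<dots> \<le> emeasure lborel V" using UV by (intro emeasure_mono) auto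
    finally have 1: "emeasure \<nu> U \<le> ennreal (L\<^sup>2) * emeasure lborel V" by (simp add: mult_left_mono)
    \<comment> \<open>The part of \<open>V\<close> missed by the discs has a null preimage too,
      because that preimage lies in the Lipschitz image under \<open>g\<close> of a null
      set.\<close>
    have "A \<inter> \<phi> -` (V - U) \<subseteq> g ` (V - U)"
      using g by force
    moreover have "negligible (g ` (V - U))"
    proof (rule negligible_locally_Lipschitz_image)
      show "negligible (V - U)" using neg by (simp add: U_def)
      fix x assume x: "x \<in> V - U"
      show "\<exists>T B. open T \<and> x \<in> T \<and> (\<forall>y\<in>(V - U) \<inter> T. norm (g y - g x) \<le> B * norm (y - x))"
      proof (intro exI[of _ UNIV] exI[of _ L] conjI ballI)
        fix y assume "y \<in> (V - U) \<inter> UNIV"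
        with x V(2) have "y \<in> \<phi> ` A" "x \<in> \<phi> ` A" by auto
        then show "norm (g y - g x) \<le> L * norm (y - x)"
          using g_lip[of y x] by (simp add: dist_norm)
      qed auto
    qed simp
    ultimately have "negligible (A \<inter> \<phi> -` (V - U))" by (rule negligible_subset[rotated])
    moreover have "A \<inter> \<phi> -` (V - U) \<in> sets borel"
      by (rule emeasure_distr_restrict_lborel) (use A in auto)
    ultimately have "emeasure \<nu> (V - U) = 0"
      by (subst \<nu>) (auto simp: negligible_iff_null_sets null_sets_def)
    then have "emeasure \<nu> V = emeasure \<nu> U"
      using emeasure_Un_null_set[of U \<nu> "V - U"] UV by (auto simp: null_sets_def Un_absorb1)
    with 1 show ?thesis by simp
  qed
  have O: "emeasure \<nu> V \<le> ennreal (L\<^sup>2) * emeasure lborel V" if V: "open V" for V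
  proof -
    \<comment> \<open>By invariance of domain the image is open, so an arbitrary open set may be
      intersected with it before the previous case is applied.\<close>
    have "open (\<phi> ` A)" using A inj by (intro invariance_of_domain)
    then have "emeasure \<nu> (V \<inter> \<phi> ` A) \<le> ennreal (L\<^sup>2) * emeasure lborel (V \<inter> \<phi> ` A)"
      using V by (intro open_case) auto
    also have "\<dots> \<le> ennreal (L\<^sup>2) * emeasure lborel V"
      using V by (intro mult_left_mono emeasure_mono) auto
    also have "emeasure \<nu> (V \<inter> \<phi> ` A) = emeasure \<nu> V"
    proof -
      have "A \<inter> \<phi> -` (V \<inter> \<phi> ` A) = A \<inter> \<phi> -` V" by auto
      then show ?thesis using V \<open>open (\<phi> ` A)\<close> by (simp add: \<nu>)
    qed
    finally show ?thesis .
  qed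
  have "emeasure \<nu> E \<le> ennreal (L\<^sup>2) * emeasure lborel E"
  proof (rule ennreal_le_epsilon)
    fix e :: real assume e: "e > 0"
    then have "e / L\<^sup>2 > 0" using L by simp
    then obtain V where V: "open V" "E \<subseteq> V" "emeasure lborel (V - E) < e / L\<^sup>2"
      using outer_regular_lborel[OF E] by blast
    have "emeasure \<nu> E \<le> emeasure \<nu> V" using V by (intro emeasure_mono) auto
    also have "\<dots> \<le> ennreal (L\<^sup>2) * emeasure lborel V" by (rule O) fact
    also have "emeasure lborel V = emeasure lborel E + emeasure lborel (V - E)"
      using V E by (subst plus_emeasure) (auto simp: Un_absorb1)
    also have "\<dots> \<le> emeasure lborel E + ennreal (e / L\<^sup>2)"
      using V by (intro add_left_mono) auto
    also have "ennreal (L\<^sup>2) * (emeasure lborel E + ennreal (e / L\<^sup>2)) = ennreal (L\<^sup>2) * emeasure lborel E + ennreal e"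
      using L e by (simp add: distrib_left flip: ennreal_mult)
    finally show "emeasure \<nu> E \<le> ennreal (L\<^sup>2) * emeasure lborel E + ennreal e"
      by (simp add: mult_left_mono)
  qed
  then show ?thesis using E by (simp add: \<nu>)
qed

text \<open>The inequality for sets says that the push-forward measure is at most L^2 times Lebesgue
  measure, and integrals are monotone in the measure.\<close>

lemma nn_integral_vimage_expanding:
  fixes \<phi> :: "complex \<Rightarrow> complex"
  assumes A: "open A" "continuous_on A \<phi>" and L: "L > 0"
    and ex: "\<And>z z'. z \<in> A \<Longrightarrow> z' \<in> A \<Longrightarrow> dist z z' \<le> L * dist (\<phi> z) (\<phi> z')"
    and F[measurable]: "F \<in> borel_measurable borel"
  shows "(\<integral>\<^sup>+z\<in>A. F (\<phi> z) \<partial>lborel) \<le> ennreal (L\<^sup>2) * (\<integral>\<^sup>+w. F w \<partial>lborel)"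
proof -
  define \<nu> where "\<nu> = distr (restrict_space lborel A) borel \<phi>"
  have [measurable]: "\<phi> \<in> borel_measurable (restrict_space lborel A)"
    using borel_measurable_continuous_on_restrict[OF A(2)]
    by (simp cong: measurable_cong_sets add: sets_restrict_space)
  have "(\<integral>\<^sup>+z\<in>A. F (\<phi> z) \<partial>lborel) = (\<integral>\<^sup>+z. F (\<phi> z) \<partial>restrict_space lborel A)"
    using A by (simp add: nn_integral_restrict_space)
  also have "\<dots> = (\<integral>\<^sup>+w. F w \<partial>\<nu>)"
    unfolding \<nu>_def by (subst nn_integral_distr) auto
  also have "\<dots> \<le> (\<integral>\<^sup>+w. F w \<partial>scale_measure (ennreal (L\<^sup>2)) lborel)"
  proof (rule nn_integral_mono_measure)
    have "emeasure \<nu> E \<le> emeasure (scale_measure (ennreal (L\<^sup>2)) lborel) E" if "E \<in> sets borel" for E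
      using emeasure_vimage_expanding[OF A L ex that] emeasure_distr_restrict_lborel(1)[OF A that]
      by (simp add: \<nu>_def)
    then show "\<nu> \<le> scale_measure (ennreal (L\<^sup>2)) lborel"
      by (subst le_measure) (auto simp: \<nu>_def)
  qed (simp add: \<nu>_def)
  also have "\<dots> = ennreal (L\<^sup>2) * (\<integral>\<^sup>+w. F w \<partial>lborel)"
    by (rule nn_integral_scale_measure) simp
  finally show ?thesis .
qed

section \<open>Rotations, the area mean value and sub-mean values of p-th powers\<close>

lemma lborel_distr_rotation:
  assumes "cmod \<omega> = 1"
  shows "distr lborel borel (\<lambda>z. \<omega> * z) = (lborel :: complex measure)"
proof -
  \<comment> \<open>A rotation preserves distances, so the expanding-map estimate holds with L = 1;
    used for the inverse rotation as well, it gives equality.\<close>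
  have *: "emeasure lborel ((\<lambda>z. \<omega> * z) -` E) \<le> emeasure lborel E" if "cmod \<omega> = 1" "E \<in> sets borel" for \<omega> E
    using emeasure_vimage_expanding[of UNIV "\<lambda>z. \<omega> * z" 1 E] that
    by (auto simp: dist_norm norm_mult continuous_intros simp flip: right_diff_distrib)
  show ?thesis
  proof (rule measure_eqI)
    fix E assume "E \<in> sets (distr lborel borel (\<lambda>z. \<omega> * z))"
    then have E[measurable]: "E \<in> sets borel" by simp
    have [simp]: "\<omega> \<noteq> 0" using assms by auto
    have "(\<lambda>z. inverse \<omega> * z) -` ((\<lambda>z. \<omega> * z) -` E) = E"
      by (auto simp: field_simps)
    moreover have "(\<lambda>z. \<omega> * z) -` E \<in> sets borel"
      using measurable_sets_borel[OF _ E, of "\<lambda>z. \<omega> * z"] by measurable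
    ultimately have "emeasure lborel E \<le> emeasure lborel ((\<lambda>z. \<omega> * z) -` E)"
      using *[of "inverse \<omega>" "(\<lambda>z. \<omega> * z) -` E"] assms by (simp add: norm_inverse)
    then show "emeasure (distr lborel borel (\<lambda>z. \<omega> * z)) E = emeasure lborel E"
      using *[OF assms E] by (simp add: emeasure_distr)
  qed simp
qed

text \<open>Rotation by a k-th root of -1 preserves the disc and changes the sign of the
  integrand.\<close>

lemma integral_monomial_ball:
  assumes "k > 0"
  shows "(\<integral>z. indicat_real (ball 0 r) z *\<^sub>R z ^ k \<partial>lborel) = (0 :: complex)"
proof -
  define \<omega> where "\<omega> = cis (pi / real k)"
  have \<omega>: "cmod \<omega> = 1" "\<omega> ^ k = -1"
    using assms by (auto simp: \<omega>_def Complex.DeMoivre simp del: cis_divide)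
  have "(\<integral>z. indicat_real (ball 0 r) z *\<^sub>R z ^ k \<partial>lborel) = (\<integral>z. indicat_real (ball 0 r) z *\<^sub>R z ^ k \<partial>distr lborel borel (\<lambda>z. \<omega> * z))"
    using \<omega> by (simp add: lborel_distr_rotation)
  also have "\<dots> = (\<integral>z. indicat_real (ball 0 r) (\<omega> * z) *\<^sub>R (\<omega> * z) ^ k \<partial>lborel)"
    by (rule integral_distr)
       (auto intro!: borel_measurable_scaleR borel_measurable_indicator borel_measurable_power)
  also have "\<dots> = (\<integral>z. - (indicat_real (ball 0 r) z *\<^sub>R z ^ k) \<partial>lborel)"
    using \<omega> by (intro Bochner_Integration.integral_cong) (auto simp: indicator_def norm_mult power_mult_distrib)
  also have "\<dots> = - (\<integral>z. indicat_real (ball 0 r) z *\<^sub>R z ^ k \<partial>lborel)"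
    by simp
  finally show ?thesis by (simp add: eq_neg_iff_add_eq_0)
qed

text \<open>The power series about \<open>a\<close> is integrated term by term: rotation invariance
  kills every monomial of positive degree, and the constant term remains.\<close>

lemma area_mean_value:
  assumes h: "h holomorphic_on ball a R" and r: "0 < r" "r < R"
  shows "(\<integral>z. indicat_real (ball 0 r) z *\<^sub>R h (a + z) \<partial>lborel) = (pi * r\<^sup>2) *\<^sub>R h a"
proof -
  define c where "c k = (deriv ^^ k) h a / fact k" for k
  define f where "f k z = c k * (indicat_real (ball 0 r) z *\<^sub>R z ^ k)" for k and z :: complex
  have sums: "(\<lambda>k. c k * z ^ k) sums h (a + z)" if "cmod z < R" for z
    using holomorphic_power_series[OF h, of "a + z"] that by (auto simp: c_def dist_norm)
  \<comment> \<open>At \<open>s\<close>, strictly between \<open>r\<close> and \<open>R\<close>, the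
    series still converges, hence it converges absolutely at \<open>r\<close>; this justifies
    exchanging sum and integral.\<close>
  define s where "s = (r + R) / 2"
  have s: "0 < s" "r < s" "s < R" using r by (auto simp: s_def)
  then have "cmod (of_real s) < R"
    unfolding norm_of_real by simp
  then have "summable (\<lambda>k. c k * of_real s ^ k)"
    using sums sums_summable by blast
  then have summ: "summable (\<lambda>k. cmod (c k * of_real r ^ k))"
    by (rule powser_insidea) (unfold norm_of_real, use r s in simp)
  have bound: "cmod (f k z) \<le> cmod (c k * of_real r ^ k) * indicat_real (ball 0 r) z" for k z
    by (auto simp: f_def indicator_def norm_mult norm_power intro!: mult_left_mono power_mono)
  have int_ball: "integrable lborel (indicat_real (ball (0::complex) r))"
    by (intro integrable_real_indicator) (auto simp: emeasure_ball r less_imp_le)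
  have [measurable]: "f k \<in> borel_measurable lborel" for k
    unfolding f_def by (intro borel_measurable_times borel_measurable_scaleR borel_measurable_indicator borel_measurable_power) auto
  have int: "integrable lborel (f k)" for k
    by (rule Bochner_Integration.integrable_bound[OF integrable_mult_right[OF int_ball, of "cmod (c k * of_real r ^ k)"]])
       (use bound in auto)
  have summ2: "summable (\<lambda>k. \<integral>z. cmod (f k z) \<partial>lborel)"
  proof (rule summable_comparison_test'[where N = 0])
    show "summable (\<lambda>k. cmod (c k * of_real r ^ k) * measure lborel (ball (0::complex) r))"
      using summ by (rule summable_mult2)
    fix k :: nat
    have "(\<integral>z. cmod (f k z) \<partial>lborel) \<le> (\<integral>z. cmod (c k * of_real r ^ k) * indicat_real (ball (0::complex) r) z \<partial>lborel)"
      by (rule Bochner_Integration.integral_mono) (use bound int int_ball in \<open>auto intro!: integrable_norm\<close>)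
    then show "norm (\<integral>z. cmod (f k z) \<partial>lborel) \<le> cmod (c k * of_real r ^ k) * measure lborel (ball (0::complex) r)"
      using r by simp
  qed
  have summ3: "summable (\<lambda>k. norm (f k z))" for z
  proof (rule summable_comparison_test'[OF summ, where N = 0])
    fix k :: nat
    have "cmod (c k * of_real r ^ k) * indicat_real (ball 0 r) z \<le> cmod (c k * of_real r ^ k)"
      by (simp add: indicator_def)
    then show "norm (norm (f k z)) \<le> cmod (c k * of_real r ^ k)"
      using bound[of k z] unfolding real_norm_def abs_norm_cancel by linarith
  qed
  have "(\<integral>z. indicat_real (ball 0 r) z *\<^sub>R h (a + z) \<partial>lborel) = (\<integral>z. (\<Sum>k. f k z) \<partial>lborel)"
  proof (rule Bochner_Integration.integral_cong)
    fix z :: complex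
    show "indicat_real (ball 0 r) z *\<^sub>R h (a + z) = (\<Sum>k. f k z)"
      using sums[of z] r by (auto simp: f_def indicator_def sums_iff)
  qed simp
  also have "\<dots> = (\<Sum>k. \<integral>z. f k z \<partial>lborel)"
    by (rule integral_suminf) (use int summ2 summ3 in auto)
  also have "\<dots> = (\<Sum>k. if k = 0 then (pi * r\<^sup>2) *\<^sub>R h a else 0)"
  proof (rule suminf_cong)
    fix k
    show "(\<integral>z. f k z \<partial>lborel) = (if k = 0 then (pi * r\<^sup>2) *\<^sub>R h a else 0)"
    proof (cases "k = 0")
      case True
      have "(\<integral>z. f k z \<partial>lborel) = (\<integral>z. indicat_real (ball 0 r) z *\<^sub>R c 0 \<partial>(lborel :: complex measure))"
        using True by (simp add: f_def mult.commute)
      also have "\<dots> = measure lborel (ball (0::complex) r) *\<^sub>R c 0"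
        by (subst integral_scaleR_left) (use int_ball in auto)
      finally show ?thesis using True r by (simp add: c_def content_ball unit_ball_vol_2)
    next
      case False
      have "(\<integral>z. f k z \<partial>lborel) = c k * (\<integral>z. indicat_real (ball 0 r) z *\<^sub>R z ^ k \<partial>lborel)"
        unfolding f_def by (rule integral_mult_right_zero)
      then show ?thesis using False by (simp only: integral_monomial_ball) simp
    qed
  qed
  also have "\<dots> = (pi * r\<^sup>2) *\<^sub>R h a"
    using suminf_finite[of "{0}" "\<lambda>k. if k = 0 then (pi * r\<^sup>2) *\<^sub>R h a else 0"] by auto
  finally show ?thesis .
qed

text \<open>Jensen's inequality for the area mean: the tangent inequality at
  \<open>y = cmod (h a)\<close> is integrated over the disc, where the mean of
  \<open>cmod (h z)\<close> is at least \<open>y\<close>.\<close>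

lemma powr_sub_mean_value:
  assumes h: "h holomorphic_on ball a R" and r: "0 < r" "r < R" and p: "p > 1"
  shows "ennreal (cmod (h a) powr p * (pi * r\<^sup>2)) \<le> (\<integral>\<^sup>+z\<in>ball a r. ennreal (cmod (h z) powr p) \<partial>lborel)"
proof -
  let ?I = "\<integral>\<^sup>+z\<in>ball a r. ennreal (cmod (h z) powr p) \<partial>lborel"
  define y where "y = cmod (h a)"
  have cont: "continuous_on (ball a r) h"
    using h r by (intro holomorphic_on_imp_continuous_on holomorphic_on_subset[OF h]) auto
  \<comment> \<open>\<open>h\<close> is arbitrary off \<open>ball a R\<close>, so measurability is
    only available after multiplication with the indicator of the smaller disc.\<close>
  have m: "(\<lambda>z. ennreal (cmod (h z) powr q) * indicator (ball a r) z) \<in> borel_measurable lborel" for q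
  proof -
    have "(\<lambda>z. indicator (ball a r) z *\<^sub>R h z) \<in> borel_measurable lborel"
      using borel_measurable_continuous_on_indicator[OF _ cont] by simp
    moreover have "ball a r \<in> sets lborel" by simp
    ultimately have "(\<lambda>z. ennreal (cmod (indicator (ball a r) z *\<^sub>R h z) powr q) * indicator (ball a r) z) \<in> borel_measurable lborel"
      by measurable
    moreover have "(\<lambda>z. ennreal (cmod (indicator (ball a r) z *\<^sub>R h z) powr q) * indicator (ball a r) z) = (\<lambda>z. ennreal (cmod (h z) powr q) * indicator (ball a r) z)"
      by (auto simp: indicator_def)
    ultimately show ?thesis by simp
  qed
  have "ennreal (pi * r\<^sup>2 * y) = ennreal (cmod ((pi * r\<^sup>2) *\<^sub>R h a))" by (simp add: y_def)
  also have "\<dots> = ennreal (cmod (\<integral>z. indicat_real (ball 0 r) z *\<^sub>R h (a + z) \<partial>lborel))"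
    by (simp add: area_mean_value[OF h r])
  also have "\<dots> \<le> (\<integral>\<^sup>+z. ennreal (cmod (indicat_real (ball 0 r) z *\<^sub>R h (a + z))) \<partial>lborel)"
  proof (cases "integrable lborel (\<lambda>z. indicat_real (ball 0 r) z *\<^sub>R h (a + z))")
    case True
    then show ?thesis by (rule integral_norm_bound_ennreal)
  qed (simp add: not_integrable_integral_eq)
  also have "\<dots> = (\<integral>\<^sup>+z. ennreal (cmod (h (a + z)) powr 1) * indicator (ball a r) (a + z) \<partial>lborel)"
    by (intro nn_integral_cong) (auto simp: indicator_def dist_norm)
  also have "\<dots> = (\<integral>\<^sup>+z. ennreal (cmod (h z) powr 1) * indicator (ball a r) z \<partial>distr lborel borel ((+) a))"
    by (rule nn_integral_distr[symmetric]) (use m[of 1] in simp_all)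
  also have "\<dots> = (\<integral>\<^sup>+z\<in>ball a r. ennreal (cmod (h z)) \<partial>lborel)"
    by (simp add: lborel_distr_plus)
  finally have 1: "ennreal (pi * r\<^sup>2 * y) \<le> (\<integral>\<^sup>+z\<in>ball a r. ennreal (cmod (h z)) \<partial>lborel)" .
  have "ennreal (p * y powr (p - 1)) * ennreal (pi * r\<^sup>2 * y) \<le> ennreal (p * y powr (p - 1)) * (\<integral>\<^sup>+z\<in>ball a r. ennreal (cmod (h z)) \<partial>lborel)"
    by (intro mult_left_mono 1) auto
  also have "\<dots> = (\<integral>\<^sup>+z. ennreal (p * y powr (p - 1)) * (ennreal (cmod (h z)) * indicator (ball a r) z) \<partial>lborel)"
    using m[of 1] by (subst nn_integral_cmult) auto
  also have "\<dots> \<le> (\<integral>\<^sup>+z. ennreal (cmod (h z) powr p) * indicator (ball a r) z + ennreal ((p - 1) * y powr p) * indicator (ball a r) z \<partial>lborel)"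
  proof (intro nn_integral_mono)
    fix z
    show "ennreal (p * y powr (p - 1)) * (ennreal (cmod (h z)) * indicator (ball a r) z)
      \<le> ennreal (cmod (h z) powr p) * indicator (ball a r) z + ennreal ((p - 1) * y powr p) * indicator (ball a r) z"
      using powr_tangent[OF p, of "cmod (h z)" y] p
      by (auto simp: indicator_def y_def simp flip: ennreal_mult ennreal_plus)
  qed
  also have "\<dots> = ?I + ennreal ((p - 1) * y powr p) * emeasure lborel (ball a r)"
  proof -
    have "(\<integral>\<^sup>+z. ennreal ((p - 1) * y powr p) * indicator (ball a r) z \<partial>lborel) = ennreal ((p - 1) * y powr p) * emeasure lborel (ball a r)"
      by (rule nn_integral_cmult_indicator) simp
    moreover have "ball a r \<in> sets lborel" by simp
    then have "(\<lambda>z. ennreal ((p - 1) * y powr p) * indicator (ball a r) z) \<in> borel_measurable lborel"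
      by measurable
    ultimately show ?thesis
      using nn_integral_add[OF m[of p], of "\<lambda>z. ennreal ((p - 1) * y powr p) * indicator (ball a r) z"]
      by (simp only:)
  qed
  also have "emeasure lborel (ball a r) = ennreal (pi * r\<^sup>2)"
    using r by (simp add: emeasure_ball unit_ball_vol_2)
  finally have le: "ennreal (p * y powr (p - 1) * (pi * r\<^sup>2 * y)) \<le> ?I + ennreal ((p - 1) * y powr p * (pi * r\<^sup>2))"
    using p by (simp add: y_def ennreal_mult)
  have yy: "y powr (p - 1) * y = y powr p"
    using p by (cases "y = 0") (auto simp: powr_diff y_def)
  have "p * y powr (p - 1) * (pi * r\<^sup>2 * y) = p * (pi * r\<^sup>2) * (y powr (p - 1) * y)" by simp
  also have "\<dots> = y powr p * (pi * r\<^sup>2) + (p - 1) * y powr p * (pi * r\<^sup>2)"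
    unfolding yy by (simp add: algebra_simps)
  finally have "ennreal ((p - 1) * y powr p * (pi * r\<^sup>2) + y powr p * (pi * r\<^sup>2)) \<le> ?I + ennreal ((p - 1) * y powr p * (pi * r\<^sup>2))"
    using le by (simp only: add.commute)
  moreover have "ennreal ((p - 1) * y powr p * (pi * r\<^sup>2) + y powr p * (pi * r\<^sup>2)) = ennreal ((p - 1) * y powr p * (pi * r\<^sup>2)) + ennreal (y powr p * (pi * r\<^sup>2))"
    using p by (intro ennreal_plus) auto
  ultimately have "ennreal ((p - 1) * y powr p * (pi * r\<^sup>2)) + ennreal (y powr p * (pi * r\<^sup>2)) \<le> ennreal ((p - 1) * y powr p * (pi * r\<^sup>2)) + ?I"
    by (simp only: add.commute)
  then show ?thesis
    unfolding ennreal_add_left_cancel_le by (simp add: y_def)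
qed

section \<open>Weighted Bergman spaces\<close>

locale weighted_bergman =
  fixes p \<alpha> :: real
  assumes p: "p > 1" and \<alpha>: "\<alpha> \<ge> 0"
begin

abbreviation "X \<equiv> bergman p \<alpha>"
abbreviation "N \<equiv> bergman_norm p \<alpha>"
abbreviation "\<mu> \<equiv> dA \<alpha>"
abbreviation "bounded_by \<equiv> lp_bound p (dA \<alpha>)"

definition weight :: "complex \<Rightarrow> real" where
  "weight z = indicator (ball 0 1) z * ((1 + \<alpha>) * (1 - (cmod z)\<^sup>2) powr \<alpha> / pi)"

lemma sets_dA[simp, measurable_cong]: "sets \<mu> = sets borel"
  by (simp add: dA_def)

lemma space_dA[simp]: "space \<mu> = UNIV"
  by (simp add: dA_def)

lemma measurable_dA[simp]: "measurable \<mu> M = measurable borel M"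
  by (intro measurable_cong_sets) simp_all

lemma weight_measurable[measurable]: "weight \<in> borel_measurable borel"
proof -
  have [measurable]: "ball (0::complex) 1 \<in> sets borel" by simp
  show ?thesis unfolding weight_def by measurable
qed

lemma nn_integral_dA:
  assumes "f \<in> borel_measurable borel"
  shows "(\<integral>\<^sup>+z. f z \<partial>\<mu>) = (\<integral>\<^sup>+z. ennreal (weight z) * f z \<partial>lborel)"
  unfolding dA_def weight_def[symmetric] by (rule nn_integral_density) (use assms in auto)

lemma weight_nonneg: "weight z \<ge> 0"
  using \<alpha> by (simp add: weight_def)

lemma weight_le: "weight z \<le> indicator (ball 0 1) z * ((1 + \<alpha>) / pi)"
proof -
  have "(1 - (cmod z)\<^sup>2) powr \<alpha> \<le> 1 powr \<alpha>" if "z \<in> ball 0 1"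
    using that \<alpha> by (intro powr_mono2) (auto simp: power_le_one)
  then show ?thesis
    using \<alpha> by (auto simp: weight_def indicator_def intro!: divide_right_mono mult_left_le)
qed

lemma finite_measure_dA: "finite_measure \<mu>"
proof (rule finite_measureI)
  have "emeasure \<mu> (space \<mu>) = (\<integral>\<^sup>+z. 1 \<partial>\<mu>)" by simp
  also have "\<dots> = (\<integral>\<^sup>+z. ennreal (weight z) * 1 \<partial>lborel)" by (rule nn_integral_dA) simp
  also have "\<dots> \<le> (\<integral>\<^sup>+z. ennreal ((1 + \<alpha>) / pi) * indicator (ball (0::complex) 1) z \<partial>lborel)"
  proof (rule nn_integral_mono)
    fix z :: complex
    show "ennreal (weight z) * 1 \<le> ennreal ((1 + \<alpha>) / pi) * indicator (ball 0 1) z"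
      using ennreal_leI[OF weight_le[of z]] weight_nonneg[of z] weight_le[of z]
      by (cases "z \<in> ball 0 1") auto
  qed
  also have "\<dots> = ennreal ((1 + \<alpha>) / pi) * emeasure lborel (ball (0::complex) 1)"
    by (rule nn_integral_cmult_indicator) simp
  also have "\<dots> < \<infinity>"
    by (simp add: emeasure_ball ennreal_mult_less_top)
  finally show "emeasure \<mu> (space \<mu>) \<noteq> \<infinity>" by simp
qed

sublocale M: finite_measure \<mu> by (rule finite_measure_dA)

lemma AE_dA: "AE z in \<mu>. z \<in> ball 0 1"
  unfolding dA_def by (subst AE_density) (auto simp: indicator_def split: if_splits)

lemma measurable_disk:
  assumes "continuous_on (ball 0 1) f" "\<And>z. z \<notin> ball 0 1 \<Longrightarrow> f z = (0::complex)"
  shows "f \<in> borel_measurable borel"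
proof -
  have "(\<lambda>z. indicator (ball 0 1) z *\<^sub>R f z) \<in> borel_measurable borel"
    using assms(1) by (intro borel_measurable_continuous_on_indicator) auto
  moreover have "(\<lambda>z. indicator (ball 0 1) z *\<^sub>R f z) = f"
    using assms(2) by (auto simp: indicator_def fun_eq_iff)
  ultimately show ?thesis by simp
qed

lemma bergman_holo: "f \<in> X \<Longrightarrow> f holomorphic_on ball 0 1"
  and bergman_zero: "f \<in> X \<Longrightarrow> z \<notin> ball 0 1 \<Longrightarrow> f z = 0"
  by (auto simp: bergman_def)

lemma bergman_measurable: "f \<in> X \<Longrightarrow> f \<in> borel_measurable borel"
  by (rule measurable_disk) (auto intro: holomorphic_on_imp_continuous_on bergman_holo bergman_zero)

lemma N_nonneg[simp]: "N f \<ge> 0"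
  by (simp add: bergman_norm_def)

lemma nn_integral_eq_N:
  assumes "f \<in> X"
  shows "(\<integral>\<^sup>+z. ennreal (cmod (f z) powr p) \<partial>\<mu>) = ennreal (N f powr p)"
proof -
  have [measurable]: "f \<in> borel_measurable borel" by (rule bergman_measurable) fact
  have fin: "(\<integral>\<^sup>+z. ennreal (cmod (f z) powr p) \<partial>\<mu>) < \<infinity>"
    using assms by (auto simp: bergman_def)
  then have "integrable \<mu> (\<lambda>z. cmod (f z) powr p)"
    by (intro integrableI_nonneg) auto
  then have "(\<integral>\<^sup>+z. ennreal (cmod (f z) powr p) \<partial>\<mu>) = ennreal (\<integral>z. cmod (f z) powr p \<partial>\<mu>)"
    by (intro nn_integral_eq_integral) auto
  also have "(\<integral>z. cmod (f z) powr p \<partial>\<mu>) = N f powr p"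
    using p by (simp add: bergman_norm_def powr_powr)
  finally show ?thesis .
qed

lemma bergman_lp: "f \<in> X \<Longrightarrow> bounded_by f (N f)"
  using nn_integral_eq_N bergman_measurable by (simp add: lp_bound_def)

lemma bergmanI:
  assumes "f holomorphic_on ball 0 1" "\<And>z. z \<notin> ball 0 1 \<Longrightarrow> f z = 0" "bounded_by f b"
  shows "f \<in> X" "N f \<le> b"
proof -
  have "(\<integral>\<^sup>+z. ennreal (cmod (f z) powr p) \<partial>\<mu>) \<le> ennreal (b powr p)" and b: "b \<ge> 0"
    using assms(3) by (auto simp: lp_bound_def)
  moreover from this have "(\<integral>\<^sup>+z. ennreal (cmod (f z) powr p) \<partial>\<mu>) < \<infinity>"
    by (auto intro: le_less_trans)
  ultimately show f: "f \<in> X" using assms by (auto simp: bergman_def)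
  have "N f powr p \<le> b powr p"
    using nn_integral_eq_N[OF f] \<open>_ \<le> ennreal (b powr p)\<close> by simp
  then show "N f \<le> b" using p b by (simp add: powr_le_cancel_iff powr_mono_both not_less flip: not_less)
       (metis N_nonneg linorder_not_le powr_less_mono2 less_trans zero_less_one)
qed

lemma N_le_iff:
  assumes "f \<in> X" "b \<ge> 0"
  shows "N f \<le> b \<longleftrightarrow> bounded_by f b"
  using assms bergmanI(2)[of f b] lp_bound_mono[OF bergman_lp[of f], of b] p
  by (auto simp: bergman_holo bergman_zero)

lemma bergman_add:
  assumes "f \<in> X" "g \<in> X"
  shows "(\<lambda>z. f z + g z) \<in> X" "N (\<lambda>z. f z + g z) \<le> N f + N g"
proof -
  have *: "bounded_by (\<lambda>z. f z + g z) (N f + N g)"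
    using assms p by (intro lp_bound_add bergman_lp) auto
  show "(\<lambda>z. f z + g z) \<in> X" "N (\<lambda>z. f z + g z) \<le> N f + N g"
    by (rule bergmanI[OF _ _ *]; use assms in \<open>auto intro!: holomorphic_intros simp: bergman_holo bergman_zero\<close>)+
qed

lemma bergman_cmult:
  assumes "f \<in> X"
  shows "(\<lambda>z. c * f z) \<in> X" "N (\<lambda>z. c * f z) = cmod c * N f"
proof -
  have *: "(\<lambda>z. c * f z) \<in> X \<and> N (\<lambda>z. c * f z) \<le> cmod c * N f" if "f \<in> X" for f c
  proof -
    have "bounded_by (\<lambda>z. c * f z) (cmod c * N f)"
      using that p by (intro lp_bound_cmult bergman_lp) auto
    then show ?thesis
      using that by (auto intro!: bergmanI holomorphic_intros simp: bergman_holo bergman_zero)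
  qed
  show cf: "(\<lambda>z. c * f z) \<in> X" using *[OF assms] by auto
  show "N (\<lambda>z. c * f z) = cmod c * N f"
  proof (cases "c = 0")
    case True
    then show ?thesis using *[OF assms, of 0] N_nonneg[of "\<lambda>z. 0"] by simp
  next
    case False
    have "N (\<lambda>z. inverse c * (c * f z)) \<le> cmod (inverse c) * N (\<lambda>z. c * f z)"
      using *[OF cf] by auto
    then have "cmod c * N f \<le> N (\<lambda>z. c * f z)"
      using False by (simp add: norm_inverse norm_divide field_simps flip: mult.assoc)
    with *[OF assms, of c] show ?thesis by auto
  qed
qed

lemma bergman_zero_fun: "(\<lambda>z. 0) \<in> X" "N (\<lambda>z. 0) = 0"
proof -
  have "bounded_by (\<lambda>z. 0) 0" by (simp add: lp_bound_def)
  then show *: "(\<lambda>z. 0) \<in> X" by (rule bergmanI[rotated 2]) auto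
  show "N (\<lambda>z. 0) = 0" using bergman_cmult(2)[OF *, of 0] by simp
qed

lemma bergman_diff:
  assumes "f \<in> X" "g \<in> X"
  shows "(\<lambda>z. f z - g z) \<in> X" "N (\<lambda>z. f z - g z) \<le> N f + N g"
  using bergman_add[OF assms(1) bergman_cmult(1)[OF assms(2), of "-1"]] bergman_cmult(2)[OF assms(2), of "-1"]
  by auto

lemma N_diff_abs:
  assumes "a \<in> X" "b \<in> X"
  shows "\<bar>N a - N b\<bar> \<le> N (\<lambda>z. a z - b z)"
proof -
  note ab = bergman_diff(1)[OF assms]
  have "N (\<lambda>z. (a z - b z) + b z) \<le> N (\<lambda>z. a z - b z) + N b"
    by (intro bergman_add ab assms)
  moreover have "N (\<lambda>z. - 1 * (a z - b z) + a z) \<le> N (\<lambda>z. - 1 * (a z - b z)) + N a"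
    by (intro bergman_add bergman_cmult ab assms)
  moreover have "N (\<lambda>z. - 1 * (a z - b z)) = N (\<lambda>z. a z - b z)"
    using bergman_cmult(2)[OF ab, of "- 1"] by simp
  ultimately show ?thesis by (simp add: abs_if)
qed

lemma bergman_lincomb:
  assumes "f \<in> X" "g \<in> X"
  shows "(\<lambda>z. a * f z + b * g z) \<in> X"
  using assms by (intro bergman_add bergman_cmult)

lemma bergman_mult:
  assumes f: "f \<in> X" and w: "w holomorphic_on ball 0 1" "\<And>z. z \<in> ball 0 1 \<Longrightarrow> cmod (w z) \<le> B"
  shows "(\<lambda>z. w z * f z) \<in> X" "N (\<lambda>z. w z * f z) \<le> B * N f"
proof -
  have "cmod (w 0) \<le> B" by (rule w) simp
  then have B: "B \<ge> 0" using norm_ge_zero order_trans by blast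
  have h: "(\<lambda>z. w z * f z) holomorphic_on ball 0 1"
    using w bergman_holo[OF f] by (intro holomorphic_intros)
  have z: "w z * f z = 0" if "z \<notin> ball 0 1" for z using bergman_zero[OF f that] by simp
  have "bounded_by (\<lambda>z. of_real B * f z) (cmod (of_real B) * N f)"
    using p by (intro lp_bound_cmult bergman_lp f) auto
  then have *: "bounded_by (\<lambda>z. of_real B * f z) (B * N f)"
    using B by simp
  have *: "bounded_by (\<lambda>z. w z * f z) (B * N f)"
  proof (rule lp_bound_le[OF *])
    show "(\<lambda>z. w z * f z) \<in> borel_measurable \<mu>"
      using measurable_disk[OF holomorphic_on_imp_continuous_on[OF h] z] by simp
    show "AE z in \<mu>. cmod (w z * f z) \<le> cmod (of_real B * f z)"
      using AE_dA by eventually_elim (use w(2) B in \<open>auto simp: norm_mult intro!: mult_right_mono\<close>)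
  qed (use p in auto)
  show "(\<lambda>z. w z * f z) \<in> X" "N (\<lambda>z. w z * f z) \<le> B * N f"
    by (rule bergmanI[OF h z *]; simp)+
qed

text \<open>The sub-mean-value property on \<open>ball a r\<close>, where the density of
  \<open>dA \<alpha>\<close> is at least its value at radius \<rho>. The factor pi cancels against
  the area of the disc, and 1 + \<alpha> is estimated below by 1. Only the integral over the small
  disc enters, so the estimate can be used where convergence is known merely away from
  \<xi>.\<close>

lemma local_evaluation:
  assumes h: "h holomorphic_on ball 0 1" and r: "0 < r" "cmod a + r \<le> \<rho>" "\<rho> < 1"
  shows "ennreal (cmod (h a) powr p * (r\<^sup>2 * (1 - \<rho>\<^sup>2) powr \<alpha>)) \<le> (\<integral>\<^sup>+z\<in>ball a r. ennreal (cmod (h z) powr p) \<partial>\<mu>)"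
proof -
  define C where "C = (1 + \<alpha>) * (1 - \<rho>\<^sup>2) powr \<alpha> / pi"
  have sub: "ball a r \<subseteq> ball 0 \<rho>" "ball a (1 - cmod a) \<subseteq> ball 0 1"
    using r by (simp_all add: ball_subset_ball_iff dist_norm)
  have C: "C \<le> weight z" if "z \<in> ball a r" for z
  proof -
    have "cmod z < \<rho>" using sub(1) that by auto
    moreover have "0 \<le> \<rho>" using r norm_ge_zero[of a] by linarith
    ultimately have "(cmod z)\<^sup>2 \<le> \<rho>\<^sup>2" "\<rho>\<^sup>2 \<le> 1" using r by (auto intro!: power_mono power_le_one)
    then have "(1 - \<rho>\<^sup>2) powr \<alpha> \<le> (1 - (cmod z)\<^sup>2) powr \<alpha>"
      using \<alpha> by (intro powr_mono2) auto
    then show ?thesis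
      using \<alpha> \<open>cmod z < \<rho>\<close> r by (auto simp: C_def weight_def intro!: divide_right_mono mult_left_mono)
  qed
  have bm: "ball a r \<in> sets borel" "ball (0::complex) 1 \<in> sets borel" by simp_all
  \<comment> \<open>\<open>h\<close> is controlled only inside the unit disc; the cut-off version is
    Borel measurable and agrees with it on \<open>ball a r\<close>.\<close>
  define h' where "h' z = indicator (ball 0 1) z *\<^sub>R h z" for z
  have h'[measurable]: "h' \<in> borel_measurable borel"
    unfolding h'_def using h by (intro borel_measurable_continuous_on_indicator holomorphic_on_imp_continuous_on) auto
  have hh': "h z = h' z" if "z \<in> ball a r" for z using sub r that by (auto simp: h'_def)
  have m: "(\<lambda>z. ennreal (cmod (h' z) powr p) * indicator (ball a r) z) \<in> borel_measurable borel"
    using bm by measurable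
  have "ennreal (cmod (h a) powr p * (r\<^sup>2 * (1 - \<rho>\<^sup>2) powr \<alpha>)) \<le> ennreal (C * (cmod (h a) powr p * (pi * r\<^sup>2)))"
    using \<alpha> mult_right_mono[of 1 "1 + \<alpha>" "cmod (h a) powr p * (r\<^sup>2 * (1 - \<rho>\<^sup>2) powr \<alpha>)"]
    by (intro ennreal_leI) (auto simp: C_def mult_ac)
  also have "\<dots> = ennreal C * ennreal (cmod (h a) powr p * (pi * r\<^sup>2))"
    using \<alpha> by (intro ennreal_mult) (auto simp: C_def)
  also have "\<dots> \<le> ennreal C * (\<integral>\<^sup>+z\<in>ball a r. ennreal (cmod (h z) powr p) \<partial>lborel)"
    by (intro mult_left_mono powr_sub_mean_value[of h a "1 - cmod a"] holomorphic_on_subset[OF h sub(2)] p) (use r in auto)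
  also have "\<dots> = ennreal C * (\<integral>\<^sup>+z\<in>ball a r. ennreal (cmod (h' z) powr p) \<partial>lborel)"
    by (intro arg_cong[where f = "times (ennreal C)"] nn_integral_cong) (simp add: indicator_def hh' del: mem_ball)
  also have "\<dots> = (\<integral>\<^sup>+z. ennreal C * (ennreal (cmod (h' z) powr p) * indicator (ball a r) z) \<partial>lborel)"
    using m by (intro nn_integral_cmult[symmetric]) simp
  also have "\<dots> \<le> (\<integral>\<^sup>+z. ennreal (weight z) * (ennreal (cmod (h' z) powr p) * indicator (ball a r) z) \<partial>lborel)"
    using C by (intro nn_integral_mono) (auto simp: indicator_def intro!: mult_right_mono ennreal_leI)
  also have "\<dots> = (\<integral>\<^sup>+z\<in>ball a r. ennreal (cmod (h' z) powr p) \<partial>\<mu>)"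
    using m by (intro nn_integral_dA[symmetric])
  also have "\<dots> = (\<integral>\<^sup>+z\<in>ball a r. ennreal (cmod (h z) powr p) \<partial>\<mu>)"
    by (intro nn_integral_cong) (simp add: indicator_def hh' del: mem_ball)
  finally show ?thesis .
qed

text \<open>The norm controls values on compact subsets of the disc: the local estimate is applied
  on a disc whose radius is half the remaining distance to the unit circle.\<close>

lemma evaluation_bound:
  assumes "\<rho> < 1"
  obtains C where "C > 0" "\<And>f z. f \<in> X \<Longrightarrow> cmod z \<le> \<rho> \<Longrightarrow> cmod (f z) \<le> C * N f"
proof -
  \<comment> \<open>\<rho> may be negative, whereas the radii below are computed from a nonnegative
    value.\<close>
  define \<rho>' where "\<rho>' = max \<rho> 0"
  have \<rho>: "0 \<le> \<rho>'" "\<rho> \<le> \<rho>'" "\<rho>' < 1" using assms by (auto simp: \<rho>'_def)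
  define r where "r = (1 - \<rho>') / 2"
  define D where "D = r\<^sup>2 * (1 - (\<rho>' + r)\<^sup>2) powr \<alpha>"
  have r: "r > 0" "\<rho>' + r < 1" using \<rho> by (auto simp: r_def field_simps)
  have "(\<rho>' + r)\<^sup>2 < 1" using r \<rho> by (simp add: abs_square_less_1)
  then have D: "D > 0" using r by (simp add: D_def)
  show ?thesis
  proof
    show "(1 / D) powr (1 / p) > 0" using D by simp
    fix f z assume f: "f \<in> X" and z: "cmod z \<le> \<rho>"
    have "ennreal (cmod (f z) powr p * D) \<le> (\<integral>\<^sup>+w\<in>ball z r. ennreal (cmod (f w) powr p) \<partial>\<mu>)"
      unfolding D_def by (rule local_evaluation[OF bergman_holo[OF f]]) (use r z \<rho> in auto)
    also have "\<dots> \<le> (\<integral>\<^sup>+w. ennreal (cmod (f w) powr p) \<partial>\<mu>)"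
      by (intro nn_integral_mono) (auto simp: indicator_def)
    also have "\<dots> = ennreal (N f powr p)" by (rule nn_integral_eq_N[OF f])
    finally have "cmod (f z) powr p * D \<le> N f powr p" by simp
    then have "cmod (f z) powr p \<le> (1 / D) * N f powr p" using D by (simp add: field_simps)
    then have "(cmod (f z) powr p) powr (1 / p) \<le> ((1 / D) * N f powr p) powr (1 / p)"
      using p by (intro powr_mono2) auto
    then show "cmod (f z) \<le> (1 / D) powr (1 / p) * N f"
      using p D by (subst (asm) powr_mult) (auto simp: powr_powr)
  qed
qed

lemma evaluation_bound_at:
  obtains C where "\<And>f. f \<in> X \<Longrightarrow> cmod (f z) \<le> C * N f"
proof (cases "z \<in> ball 0 1")
  case True
  then have "cmod z < 1" by simp
  from evaluation_bound[OF this] show ?thesis using that by (metis order_refl)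
next
  case False
  then show ?thesis using that[of 0] bergman_zero by simp
qed

lemma N_eq_0D:
  assumes "f \<in> X" "N f = 0" shows "f = (\<lambda>z. 0)"
proof
  fix z
  obtain C where "\<And>f. f \<in> X \<Longrightarrow> cmod (f z) \<le> C * N f" using evaluation_bound_at[of z] by blast
  from this[OF assms(1)] assms(2) show "f z = 0" by simp
qed

lemma norm_conv_imp_pointwise:
  assumes "\<And>n. f n \<in> X" "g \<in> X" "(\<lambda>n. N (\<lambda>z. f n z - g z)) \<longlonglongrightarrow> 0"
  shows "(\<lambda>n. f n z) \<longlonglongrightarrow> g z"
proof -
  obtain C where C: "\<And>f. f \<in> X \<Longrightarrow> cmod (f z) \<le> C * N f" using evaluation_bound_at[of z] by blast
  have "(\<lambda>n. C * N (\<lambda>z. f n z - g z)) \<longlonglongrightarrow> 0" using tendsto_mult_left[OF assms(3), of C] by simp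
  then have "(\<lambda>n. f n z - g z) \<longlonglongrightarrow> 0"
    by (rule Lim_null_comparison[rotated]) (use C[OF bergman_diff(1)[OF assms(1,2)]] in auto)
  then show ?thesis by (simp add: LIM_zero_iff)
qed

lemma evaluation_dual: "(\<lambda>f. f z) \<in> dual_space X N"
proof -
  obtain C where "\<And>f. f \<in> X \<Longrightarrow> cmod (f z) \<le> C * N f" using evaluation_bound_at[of z] by blast
  then show ?thesis by (auto simp: dual_space_def)
qed

section \<open>Convergence and compactness in the Bergman norm\<close>

lemma lp_dominated:
  assumes g: "\<And>k. g k \<in> borel_measurable \<mu>" and G: "G \<in> borel_measurable \<mu>" "(\<integral>\<^sup>+z. ennreal (G z powr p) \<partial>\<mu>) < \<infinity>"
    and dom: "\<And>k. AE z in \<mu>. cmod (g k z) \<le> G z" and lim: "AE z in \<mu>. (\<lambda>k. g k z) \<longlonglongrightarrow> 0" and e: "e > 0"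
  shows "eventually (\<lambda>k. bounded_by (g k) e) sequentially"
proof -
  note [measurable] = g G(1)
  have "(\<lambda>k. \<integral>\<^sup>+z. ennreal (cmod (g k z) powr p) \<partial>\<mu>) \<longlonglongrightarrow> (\<integral>\<^sup>+z. 0 \<partial>\<mu>)"
  proof (rule nn_integral_dominated_convergence[where w = "\<lambda>z. ennreal (G z powr p)"])
    show "AE z in \<mu>. ennreal (cmod (g j z) powr p) \<le> ennreal (G z powr p)" for j
      using dom[of j] by eventually_elim (use p in \<open>auto intro!: ennreal_leI powr_mono2\<close>)
    show "AE z in \<mu>. (\<lambda>i. ennreal (cmod (g i z) powr p)) \<longlonglongrightarrow> 0"
      using lim
    proof eventually_elim
      fix z assume "(\<lambda>k. g k z) \<longlonglongrightarrow> 0"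
      then have "(\<lambda>k. ennreal (cmod (g k z) powr p)) \<longlonglongrightarrow> ennreal (0 powr p)"
        using p by (intro tendsto_ennrealI tendsto_powr2 tendsto_norm_zero) auto
      then show "(\<lambda>k. ennreal (cmod (g k z) powr p)) \<longlonglongrightarrow> 0" by simp
    qed
  qed (use G in auto)
  then have "eventually (\<lambda>k. (\<integral>\<^sup>+z. ennreal (cmod (g k z) powr p) \<partial>\<mu>) < ennreal (e powr p)) sequentially"
    by (rule order_tendstoD(2)) (use e in auto)
  then show ?thesis
    by eventually_elim (use e in \<open>auto simp: lp_bound_def\<close>)
qed

lemma bergman_fatou:
  assumes f: "\<And>k. f k \<in> X" "\<And>k. N (f k) \<le> B" and lim: "\<And>z. (\<lambda>k. f k z) \<longlonglongrightarrow> g z"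
    and g: "g holomorphic_on ball 0 1"
  shows "g \<in> X" "N g \<le> B"
proof -
  have B: "B \<ge> 0" using f(2)[of 0] N_nonneg order_trans by blast
  have z: "g z = 0" if "z \<notin> ball 0 1" for z
    using lim[of z] bergman_zero[OF f(1) that] by (simp add: LIMSEQ_const_iff)
  have [measurable]: "f k \<in> borel_measurable \<mu>" for k using bergman_measurable[OF f(1)] by simp
  have [measurable]: "g \<in> borel_measurable \<mu>"
    using measurable_disk[OF holomorphic_on_imp_continuous_on[OF g] z] by simp
  have "(\<integral>\<^sup>+z. ennreal (cmod (g z) powr p) \<partial>\<mu>) = (\<integral>\<^sup>+z. liminf (\<lambda>k. ennreal (cmod (f k z) powr p)) \<partial>\<mu>)"
  proof (rule nn_integral_cong)
    fix z
    have "(\<lambda>k. ennreal (cmod (f k z) powr p)) \<longlonglongrightarrow> ennreal (cmod (g z) powr p)"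
      using p by (intro tendsto_ennrealI tendsto_powr2 tendsto_norm lim) auto
    then show "ennreal (cmod (g z) powr p) = liminf (\<lambda>k. ennreal (cmod (f k z) powr p))"
      by (intro lim_imp_Liminf[symmetric]) auto
  qed
  also have "\<dots> \<le> liminf (\<lambda>k. \<integral>\<^sup>+z. ennreal (cmod (f k z) powr p) \<partial>\<mu>)"
    by (rule nn_integral_liminf) measurable
  also have "\<dots> \<le> limsup (\<lambda>k. \<integral>\<^sup>+z. ennreal (cmod (f k z) powr p) \<partial>\<mu>)"
    by (rule Liminf_le_Limsup) simp
  also have "\<dots> \<le> ennreal (B powr p)"
    using f p by (intro Limsup_bounded) (auto simp: nn_integral_eq_N intro!: always_eventually ennreal_leI powr_mono2)
  finally have *: "bounded_by g B" using B by (simp add: lp_bound_def)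
  show "g \<in> X" "N g \<le> B" by (rule bergmanI[OF g z *]; simp)+
qed

text \<open>The evaluation bounds make a norm bounded set locally bounded, so Montel's theorem
  applies, and Fatou's lemma keeps the limit in the same ball.\<close>

lemma bergman_montel:
  assumes f: "\<And>k. f k \<in> X" "\<And>k. N (f k) \<le> B"
  obtains g r where "strict_mono (r :: nat \<Rightarrow> nat)" "g \<in> X" "N g \<le> B" "\<And>z. (\<lambda>k. f (r k) z) \<longlonglongrightarrow> g z"
proof -
  define H where "H = {f \<in> X. N f \<le> B}"
  have bd: "\<exists>C. \<forall>h\<in>H. \<forall>z\<in>K. norm (h z) \<le> C" if K: "compact K" "K \<subseteq> ball 0 1" for K
  proof -
    have "\<exists>\<rho><1. K \<subseteq> cball 0 \<rho>"
    proof (cases "K = {}")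
      case False
      then obtain z where z: "z \<in> K" "\<And>w. w \<in> K \<Longrightarrow> cmod w \<le> cmod z"
        using continuous_attains_sup[of K cmod] K(1) by (auto intro: continuous_intros)
      then show ?thesis using K(2) by (intro exI[of _ "cmod z"]) auto
    qed (auto intro: exI[of _ 0])
    then obtain \<rho> where \<rho>: "\<rho> < 1" "K \<subseteq> cball 0 \<rho>" by blast
    obtain C where C: "C > 0" "\<And>f z. f \<in> X \<Longrightarrow> cmod z \<le> \<rho> \<Longrightarrow> cmod (f z) \<le> C * N f"
      using evaluation_bound[OF \<rho>(1)] by blast
    have "norm (h z) \<le> C * B" if "h \<in> H" "z \<in> K" for h z
    proof -
      have "cmod (h z) \<le> C * N h" using C that \<rho> by (auto simp: H_def)
      also have "\<dots> \<le> C * B" using that C(1) by (auto simp: H_def)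
      finally show ?thesis .
    qed
    then show ?thesis by blast
  qed
  obtain g r where g: "g holomorphic_on ball 0 1" "strict_mono (r :: nat \<Rightarrow> nat)"
    "\<And>x. x \<in> ball 0 1 \<Longrightarrow> (\<lambda>n. f (r n) x) \<longlonglongrightarrow> g x"
    by (rule Montel[of "ball 0 1" H f]) (use bd f in \<open>auto simp: H_def bergman_holo\<close>)
  \<comment> \<open>Montel's limit is arbitrary outside the disc, but elements of \<open>X\<close>
    vanish there.\<close>
  define g' where "g' z = (if z \<in> ball 0 1 then g z else 0)" for z
  have hol: "g' holomorphic_on ball 0 1"
    using g(1) by (rule holomorphic_transform) (auto simp: g'_def)
  have lim: "(\<lambda>k. f (r k) z) \<longlonglongrightarrow> g' z" for z
    using g(3)[of z] bergman_zero[OF f(1)] by (auto simp: g'_def)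
  show ?thesis
    using that[OF g(2) _ _ lim] bergman_fatou[of "\<lambda>k. f (r k)" B g', OF f(1) f(2) lim hol] by blast
qed

lemma powr_add_le:
  assumes "a \<ge> 0" "b \<ge> 0"
  shows "(a + b) powr p \<le> 2 powr p * (a powr p + b powr p)"
proof -
  have "(a + b) powr p \<le> (2 * max a b) powr p"
    using p assms by (intro powr_mono2) auto
  also have "\<dots> = 2 powr p * max a b powr p" using assms by (intro powr_mult)
  also have "\<dots> \<le> 2 powr p * (a powr p + b powr p)"
    by (intro mult_left_mono) (auto simp: max_def)
  finally show ?thesis .
qed

text \<open>The Radon-Riesz property of L^p spaces by Riesz's argument: Fatou's lemma is applied to
  the nonnegative functions \<open>F k\<close>, and convergence of the norms then leaves no mass for
  the difference. Later this turns pointwise continuity in t into norm continuity along sequences on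
  which the norms converge.\<close>

lemma bergman_riesz:
  assumes f: "\<And>k. f k \<in> X" and g: "g \<in> X" and lim: "\<And>z. (\<lambda>k. f k z) \<longlonglongrightarrow> g z"
    and N: "(\<lambda>k. N (f k)) \<longlonglongrightarrow> N g"
  shows "(\<lambda>k. N (\<lambda>z. f k z - g z)) \<longlonglongrightarrow> 0"
proof -
  have [measurable]: "f k \<in> borel_measurable \<mu>" "g \<in> borel_measurable \<mu>" for k
    using bergman_measurable[OF f] bergman_measurable[OF g] by simp_all
  define c where "c = (2::real) powr p"
  define A where "A k = N (\<lambda>z. f k z - g z) powr p" for k
  define n where "n k = N (f k) powr p" for k
  define n0 where "n0 = N g powr p"
  have c: "c > 0" by (simp add: c_def)
  have int: "integrable \<mu> (\<lambda>z. cmod (h z) powr p)" "(\<integral>z. cmod (h z) powr p \<partial>\<mu>) = N h powr p" if "h \<in> X" for h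
  proof -
    have [measurable]: "h \<in> borel_measurable \<mu>" using bergman_measurable[OF that] by simp
    show "integrable \<mu> (\<lambda>z. cmod (h z) powr p)"
      using that by (intro integrableI_nonneg) (auto simp: bergman_def)
    show "(\<integral>z. cmod (h z) powr p \<partial>\<mu>) = N h powr p"
      using p by (simp add: bergman_norm_def powr_powr)
  qed
  have n_lim: "n \<longlonglongrightarrow> n0" unfolding n_def n0_def using p by (intro tendsto_powr2 N) auto
  define F where "F k z = c * (cmod (f k z) powr p + cmod (g z) powr p) - cmod (f k z - g z) powr p" for k z
  have F0: "F k z \<ge> 0" for k z
  proof -
    have "cmod (f k z - g z) powr p \<le> (cmod (f k z) + cmod (g z)) powr p"
      using p by (intro powr_mono2 norm_triangle_ineq4) auto
    also have "\<dots> \<le> c * (cmod (f k z) powr p + cmod (g z) powr p)"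
      unfolding c_def by (rule powr_add_le) auto
    finally show ?thesis by (simp add: F_def)
  qed
  have [measurable]: "F k \<in> borel_measurable \<mu>" for k unfolding F_def by measurable
  have Fi: "(\<integral>\<^sup>+z. ennreal (F k z) \<partial>\<mu>) = ennreal (c * (n k + n0) - A k)" for k
  proof -
    have "integrable \<mu> (F k)" unfolding F_def using int f g bergman_diff(1)[OF f g] by auto
    moreover have "(\<integral>z. F k z \<partial>\<mu>) = c * (n k + n0) - A k"
      unfolding F_def using int f g bergman_diff(1)[OF f g] by (simp add: n_def n0_def A_def)
    ultimately show ?thesis using F0 by (subst nn_integral_eq_integral) auto
  qed
  have "ennreal (2 * c * n0) = (\<integral>\<^sup>+z. ennreal (2 * c * cmod (g z) powr p) \<partial>\<mu>)"
    using int[OF g] c by (subst nn_integral_eq_integral) (auto simp: n0_def)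
  also have "\<dots> = (\<integral>\<^sup>+z. liminf (\<lambda>k. ennreal (F k z)) \<partial>\<mu>)"
  proof (rule nn_integral_cong)
    fix z
    have d: "(\<lambda>k. f k z - g z) \<longlonglongrightarrow> 0" using lim[of z] by (rule LIM_zero)
    have 1: "(\<lambda>k. cmod (f k z - g z) powr p) \<longlonglongrightarrow> 0 powr p"
      using p by (intro tendsto_powr2 tendsto_norm_zero d) auto
    have "(\<lambda>k. F k z) \<longlonglongrightarrow> c * (cmod (g z) powr p + cmod (g z) powr p) - 0 powr p"
      unfolding F_def using p
      by (intro tendsto_intros tendsto_powr2 lim 1) auto
    then have "(\<lambda>k. F k z) \<longlonglongrightarrow> 2 * c * cmod (g z) powr p" by (simp add: algebra_simps)
    then show "ennreal (2 * c * cmod (g z) powr p) = liminf (\<lambda>k. ennreal (F k z))"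
      by (intro lim_imp_Liminf[symmetric] tendsto_ennrealI) auto
  qed
  also have "\<dots> \<le> liminf (\<lambda>k. \<integral>\<^sup>+z. ennreal (F k z) \<partial>\<mu>)"
    by (rule nn_integral_liminf) measurable
  finally have le: "ennreal (2 * c * n0) \<le> liminf (\<lambda>k. ennreal (c * (n k + n0) - A k))"
    by (simp add: Fi)
  have "A \<longlonglongrightarrow> 0"
  proof (rule tendstoI)
    fix e :: real assume e: "e > 0"
    have n0: "n0 \<ge> 0" by (simp add: n0_def)
    have A0: "A k \<ge> 0" for k by (simp add: A_def)
    have ev1: "eventually (\<lambda>k. c * (n k + n0) < 2 * c * n0 + e / 2) sequentially"
    proof (rule order_tendstoD(2))
      show "(\<lambda>k. c * (n k + n0)) \<longlonglongrightarrow> c * (n0 + n0)" by (intro tendsto_intros n_lim)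
    qed (use e in \<open>simp add: algebra_simps\<close>)
    show "eventually (\<lambda>k. dist (A k) 0 < e) sequentially"
    \<comment> \<open>Negative reals become 0 in \<open>ennreal\<close>, so a negative threshold
      would carry no information; in that case \<open>A k\<close> is bounded directly by
      \<open>c * (n k + n0)\<close>.\<close>
    proof (cases "2 * c * n0 - e / 2 < 0")
      case True
      have nk: "c * (n k + n0) - A k \<ge> 0" for k
      proof -
        have "(\<integral>z. F k z \<partial>\<mu>) \<ge> 0" using F0 by simp
        moreover have "(\<integral>z. F k z \<partial>\<mu>) = c * (n k + n0) - A k"
          unfolding F_def using int f g bergman_diff(1)[OF f g] by (simp add: n_def n0_def A_def)
        ultimately show ?thesis by simp
      qed
      show ?thesis using ev1
      proof eventually_elim
        case (elim k)
        with nk[of k] A0[of k] True show ?case by (simp add: dist_real_def)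
      qed
    next
      case False
      then have "ennreal (2 * c * n0 - e / 2) < ennreal (2 * c * n0)"
        using e by (intro ennreal_lessI) auto
      with le have "ennreal (2 * c * n0 - e / 2) < liminf (\<lambda>k. ennreal (c * (n k + n0) - A k))" by simp
      then have "eventually (\<lambda>k. ennreal (2 * c * n0 - e / 2) < ennreal (c * (n k + n0) - A k)) sequentially"
        using less_LiminfD by blast
      then show ?thesis using ev1
        by eventually_elim (use A0 False in \<open>auto simp: dist_norm ennreal_less_iff\<close>)
    qed
  qed
  moreover have "A k \<ge> 0" for k by (simp add: A_def)
  ultimately have "(\<lambda>k. A k powr (1 / p)) \<longlonglongrightarrow> 0 powr (1 / p)"
    using p by (intro tendsto_powr2) auto
  moreover have "A k powr (1 / p) = N (\<lambda>z. f k z - g z)" for k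
    using p by (simp add: A_def powr_powr)
  ultimately show ?thesis using p by simp
qed

section \<open>Weakly null sequences\<close>

definition null_seq :: "(nat \<Rightarrow> complex \<Rightarrow> complex) \<Rightarrow> bool" where
  "null_seq f \<longleftrightarrow> (\<forall>k. f k \<in> X) \<and> (\<exists>B. \<forall>k. N (f k) \<le> B) \<and> (\<forall>z. (\<lambda>k. f k z) \<longlonglongrightarrow> 0)"

lemma powr_add_small:
  assumes "a \<ge> 0"
  obtains e where "e > 0" "(a + e) powr p \<le> a powr p + 1 / 2"
proof -
  have "(\<lambda>n. a + inverse (real (Suc n))) \<longlonglongrightarrow> a + 0"
    by (intro tendsto_add tendsto_const LIMSEQ_inverse_real_of_nat)
  then have "(\<lambda>n. (a + inverse (real (Suc n))) powr p) \<longlonglongrightarrow> a powr p"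
    using p assms by (intro tendsto_powr2) auto
  then have "eventually (\<lambda>n. (a + inverse (real (Suc n))) powr p < a powr p + 1 / 2) sequentially"
    by (rule order_tendstoD(2)) simp
  then obtain n where "(a + inverse (real (Suc n))) powr p < a powr p + 1 / 2"
    by (auto simp: eventually_sequentially)
  with that[of "inverse (real (Suc n))"] show ?thesis by simp
qed

text \<open>A compact disc \<open>D n\<close> carries all of \<open>h\<close> except a part of norm
  \<open>s\<close>; on it \<open>g k\<close> tends to 0, and off it \<open>g k\<close> has norm at
  most 1. The p-th powers over the two disjoint regions add: the increase 2 consists of 1 for
  \<open>g k\<close> and of 1/2 for the small error in each region.\<close>

lemma gliding_hump:
  assumes h: "h \<in> X" and g: "\<And>k. g k \<in> X" "\<And>k. N (g k) \<le> 1" "\<And>z. (\<lambda>k. g k z) \<longlonglongrightarrow> 0"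
  shows "eventually (\<lambda>k. N (\<lambda>z. h z + g k z) powr p \<le> N h powr p + 2) sequentially"
proof -
  have [measurable]: "h \<in> borel_measurable borel" "g k \<in> borel_measurable borel" for k
    using h g by (simp_all add: bergman_measurable)
  obtain s where s: "s > 0" "(1 + s) powr p \<le> 1 powr p + 1 / 2" using powr_add_small[of 1] by auto
  obtain e where e: "e > 0" "(N h + e) powr p \<le> N h powr p + 1 / 2" using powr_add_small[of "N h"] by auto
  define D where "D n = cball (0::complex) (1 - 1 / real (Suc n))" for n
  have [measurable]: "D n \<in> sets borel" for n by (simp add: D_def)
  have "eventually (\<lambda>n. bounded_by (\<lambda>z. indicator (- D n) z * h z) s) sequentially"
  proof (rule lp_dominated[where G = "\<lambda>z. cmod (h z)"])
    show "AE z in \<mu>. (\<lambda>n. indicator (- D n) z * h z) \<longlonglongrightarrow> 0"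
      using AE_dA
    proof eventually_elim
      fix z :: complex assume z: "z \<in> ball 0 1"
      have "eventually (\<lambda>n. inverse (real (Suc n)) < 1 - cmod z) sequentially"
        using LIMSEQ_inverse_real_of_nat by (rule order_tendstoD(2)) (use z in auto)
      then have "eventually (\<lambda>n. indicator (- D n) z * h z = 0) sequentially"
        by eventually_elim (auto simp: D_def inverse_eq_divide indicator_def)
      then show "(\<lambda>n. indicator (- D n) z * h z) \<longlonglongrightarrow> 0" by (rule tendsto_eventually)
    qed
    show "(\<integral>\<^sup>+z. ennreal (cmod (h z) powr p) \<partial>\<mu>) < \<infinity>" using nn_integral_eq_N[OF h] by simp
  qed (use s in \<open>auto simp: indicator_def\<close>)
  then obtain n where n: "bounded_by (\<lambda>z. indicator (- D n) z * h z) s"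
    by (auto simp: eventually_sequentially)
  have "1 - 1 / real (Suc n) < 1" by simp
  then obtain C where C: "C > 0" "\<And>f z. f \<in> X \<Longrightarrow> cmod z \<le> 1 - 1 / real (Suc n) \<Longrightarrow> cmod (f z) \<le> C * N f"
    using evaluation_bound by blast
  have tail: "bounded_by (\<lambda>z. indicator (- D n) z * (h z + g k z)) (1 + s)" for k
  proof -
    have "bounded_by (\<lambda>z. indicator (- D n) z * g k z) 1"
      by (rule lp_bound_le[OF lp_bound_mono[OF bergman_lp[OF g(1)[of k]] g(2)]]) (use p in \<open>auto simp: indicator_def\<close>)
    from lp_bound_add[OF p this n] show ?thesis by (simp add: algebra_simps)
  qed
  have "eventually (\<lambda>k. bounded_by (\<lambda>z. indicator (D n) z * g k z) e) sequentially"
  proof (rule lp_dominated[where G = "\<lambda>z. C"])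
    have "C powr p * emeasure \<mu> UNIV < \<infinity>"
      by (simp add: less_top[symmetric] ennreal_mult_eq_top_iff)
    then show "(\<integral>\<^sup>+z. ennreal (C powr p) \<partial>\<mu>) < \<infinity>" by simp
    show "AE z in \<mu>. cmod (indicator (D n) z * g k z) \<le> C" for k
    proof (rule AE_I2)
      fix z
      have "cmod (g k z) \<le> C" if "z \<in> D n"
      proof -
        have "cmod (g k z) \<le> C * N (g k)" using that by (intro C g) (auto simp: D_def)
        also have "\<dots> \<le> C * 1" using C g by (intro mult_left_mono) auto
        finally show ?thesis by simp
      qed
      then show "cmod (indicator (D n) z * g k z) \<le> C" using C by (auto simp: indicator_def)
    qed
    show "AE z in \<mu>. (\<lambda>k. indicator (D n) z * g k z) \<longlonglongrightarrow> 0"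
      using g(3) by (intro AE_I2 tendsto_mult_right_zero)
  qed (use e in auto)
  then show ?thesis
  proof eventually_elim
    case (elim k)
    have "bounded_by (\<lambda>z. indicator (D n) z * h z) (N h)"
      by (rule lp_bound_le[OF bergman_lp[OF h]]) (use p in \<open>auto simp: indicator_def\<close>)
    from lp_bound_add[OF p this elim]
    have core: "bounded_by (\<lambda>z. indicator (D n) z * (h z + g k z)) (N h + e)" by (simp add: algebra_simps)
    have "ennreal (N (\<lambda>z. h z + g k z) powr p) = (\<integral>\<^sup>+z. ennreal (cmod (h z + g k z) powr p) \<partial>\<mu>)"
      by (rule nn_integral_eq_N[OF bergman_add(1)[OF h g(1)], symmetric])
    also have "\<dots> = (\<integral>\<^sup>+z. ennreal (cmod (indicator (D n) z * (h z + g k z)) powr p) + ennreal (cmod (indicator (- D n) z * (h z + g k z)) powr p) \<partial>\<mu>)"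
      using p by (intro nn_integral_cong) (auto simp: indicator_def)
    also have "\<dots> = (\<integral>\<^sup>+z. ennreal (cmod (indicator (D n) z * (h z + g k z)) powr p) \<partial>\<mu>) + (\<integral>\<^sup>+z. ennreal (cmod (indicator (- D n) z * (h z + g k z)) powr p) \<partial>\<mu>)"
      by (rule nn_integral_add) auto
    also have "\<dots> \<le> ennreal ((N h + e) powr p) + ennreal ((1 + s) powr p)"
      using core tail[of k] unfolding lp_bound_def by (intro add_mono) auto
    also have "\<dots> = ennreal ((N h + e) powr p + (1 + s) powr p)" by simp
    finally have "N (\<lambda>z. h z + g k z) powr p \<le> (N h + e) powr p + (1 + s) powr p"
      by (simp del: ennreal_plus)
    with s e show ?case by simp
  qed
qed

lemma dual_cmult: "l \<in> dual_space X N \<Longrightarrow> f \<in> X \<Longrightarrow> l (\<lambda>z. c * f z) = c * l f"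
proof -
  assume l: "l \<in> dual_space X N" and f: "f \<in> X"
  have "\<forall>a b. l (\<lambda>z. a * f z + b * f z) = a * l f + b * l f"
    using l f unfolding dual_space_def by blast
  from this[rule_format, of c 0] show ?thesis by simp
qed

lemma dual_add: "l \<in> dual_space X N \<Longrightarrow> f \<in> X \<Longrightarrow> g \<in> X \<Longrightarrow> l (\<lambda>z. f z + g z) = l f + l g"
proof -
  assume l: "l \<in> dual_space X N" and f: "f \<in> X" "g \<in> X"
  have "\<forall>a b. l (\<lambda>z. a * f z + b * g z) = a * l f + b * l g"
    using l f unfolding dual_space_def by blast
  from this[rule_format, of 1 1] show ?thesis by simp
qed

text \<open>If \<open>l (f k)\<close> stayed away from 0 along a subsequence, rotated multiples
  \<open>g k\<close> in the unit ball with \<open>l (g k) \<ge> \<delta>\<close> infinitely often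
  could be added by the gliding hump. A sum of n of them has norm at most (2 n)^(1/p), while the
  real part of \<open>l\<close> on it is at least n \<delta>. As p > 1, this contradicts the
  boundedness of \<open>l\<close> for large n.\<close>

lemma null_seq_weakly_null:
  assumes f: "null_seq f" and l: "l \<in> dual_space X N"
  shows "(\<lambda>k. l (f k)) \<longlonglongrightarrow> 0"
proof (rule ccontr)
  assume "\<not> (\<lambda>k. l (f k)) \<longlonglongrightarrow> 0"
  then obtain e where e: "e > 0" "\<And>n. \<exists>k\<ge>n. cmod (l (f k)) \<ge> e"
    by (auto simp: LIMSEQ_iff not_less)
  from f obtain B where B: "\<And>k. N (f k) \<le> B" and fX: "\<And>k. f k \<in> X" and f0: "\<And>z. (\<lambda>k. f k z) \<longlonglongrightarrow> 0"
    by (auto simp: null_seq_def)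
  define b where "b = max B 1"
  have b: "b > 0" "N (f k) \<le> b" for k using B[of k] by (auto simp: b_def)
  \<comment> \<open>The phase makes \<open>l (g k)\<close> real and nonnegative; division by
    \<open>b\<close> puts \<open>g k\<close> into the unit ball.\<close>
  define c where "c k = cnj (sgn (l (f k))) / of_real b" for k
  have c: "cmod (c k) \<le> 1 / b" for k
    using b by (simp add: c_def norm_divide norm_sgn divide_right_mono)
  define g where "g k z = c k * f k z" for k z
  have gX: "g k \<in> X" for k unfolding g_def by (intro bergman_cmult fX)
  have g1: "N (g k) \<le> 1" for k
  proof -
    have "N (g k) = cmod (c k) * N (f k)" unfolding g_def by (rule bergman_cmult(2)[OF fX])
    also have "\<dots> \<le> (1 / b) * b" using c b by (intro mult_mono) auto
    finally show ?thesis using b by simp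
  qed
  have g0: "(\<lambda>k. g k z) \<longlonglongrightarrow> 0" for z
  proof (rule Lim_null_comparison)
    show "(\<lambda>k. (1 / b) * cmod (f k z)) \<longlonglongrightarrow> 0"
      by (intro tendsto_mult_right_zero tendsto_norm_zero f0)
    show "eventually (\<lambda>k. norm (g k z) \<le> (1 / b) * cmod (f k z)) sequentially"
    proof (intro always_eventually allI)
      fix k
      show "norm (g k z) \<le> (1 / b) * cmod (f k z)"
        unfolding g_def norm_mult using c by (rule mult_right_mono) simp
    qed
  qed
  have lg: "l (g k) = of_real (cmod (l (f k)) / b)" for k
  proof -
    have "l (g k) = c k * l (f k)" unfolding g_def by (rule dual_cmult[OF l fX])
    also have "cnj (sgn (l (f k))) * l (f k) = of_real (cmod (l (f k)))"
      by (cases "l (f k) = 0") (auto simp: sgn_div_norm scaleR_conv_of_real complex_norm_square[symmetric] power2_eq_square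
          mult.commute[of "cnj _"] field_simps simp flip: of_real_mult)
    then have "c k * l (f k) = of_real (cmod (l (f k)) / b)" by (simp add: c_def)
    finally show ?thesis .
  qed
  define \<delta> where "\<delta> = e / b"
  have \<delta>: "\<delta> > 0" using e b by (simp add: \<delta>_def)
  have sums: "\<exists>h\<in>X. N h powr p \<le> 2 * real n \<and> Re (l h) \<ge> real n * \<delta>" for n
  proof (induction n)
    case 0
    have "l (\<lambda>z. 0) = 0" using dual_cmult[OF l bergman_zero_fun(1), of 0] by simp
    then show ?case using bergman_zero_fun p by (intro bexI[of _ "\<lambda>z. 0"]) auto
  next
    case (Suc n)
    then obtain h where h: "h \<in> X" "N h powr p \<le> 2 * real n" "Re (l h) \<ge> real n * \<delta>" by blast
    obtain K where K: "\<And>k. k \<ge> K \<Longrightarrow> N (\<lambda>z. h z + g k z) powr p \<le> N h powr p + 2"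
      using gliding_hump[OF h(1) gX g1 g0] by (auto simp: eventually_sequentially)
    obtain k where k: "k \<ge> K" "cmod (l (f k)) \<ge> e" using e(2) by blast
    have "Re (l (\<lambda>z. h z + g k z)) = Re (l h) + cmod (l (f k)) / b"
      using dual_add[OF l h(1) gX[of k]] by (simp add: lg)
    also have "\<dots> \<ge> real n * \<delta> + \<delta>"
      unfolding \<delta>_def using h(3) k b by (intro add_mono divide_right_mono) (auto simp: \<delta>_def)
    finally have "Re (l (\<lambda>z. h z + g k z)) \<ge> real (Suc n) * \<delta>" by (simp add: algebra_simps)
    then show ?case using K[OF k(1)] h(2) bergman_add(1)[OF h(1) gX]
      by (intro bexI[of _ "\<lambda>z. h z + g k z"]) auto
  qed
  obtain A0 where A0: "\<And>h. h \<in> X \<Longrightarrow> cmod (l h) \<le> A0 * N h" using l unfolding dual_space_def by blast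
  define A where "A = max A0 1"
  have A: "cmod (l h) \<le> A * N h" if "h \<in> X" for h
    using A0[OF that] mult_right_mono[of A0 A "N h"] by (auto simp: A_def)
  have A1: "A > 0" by (simp add: A_def)
  define K where "K = A * 2 powr (1 / p) / \<delta>"
  have K: "K > 0" using A1 \<delta> by (simp add: K_def)
  \<comment> \<open>As 1 - 1/p = (p - 1)/p, this choice pushes n^(1 - 1/p) above \<open>K\<close>,
    the largest value that the bound for \<open>l\<close> permits.\<close>
  define n where "n = nat \<lceil>K powr (p / (p - 1))\<rceil> + 1"
  have n: "real n > K powr (p / (p - 1))" unfolding n_def by linarith
  obtain h where h: "h \<in> X" "N h powr p \<le> 2 * real n" "Re (l h) \<ge> real n * \<delta>" using sums by blast
  have n0: "real n > 0" using n K by (metis less_trans powr_gt_zero less_irrefl)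
  have "N h = (N h powr p) powr (1 / p)" using p by (simp add: powr_powr)
  also have "\<dots> \<le> (2 * real n) powr (1 / p)" using h(2) p by (intro powr_mono2) auto
  finally have Nh: "N h \<le> 2 powr (1 / p) * real n powr (1 / p)" by (simp add: powr_mult)
  have "real n * \<delta> \<le> cmod (l h)" using h(3) complex_Re_le_cmod order_trans by blast
  also have "\<dots> \<le> A * N h" by (rule A[OF h(1)])
  also have "\<dots> \<le> A * (2 powr (1 / p) * real n powr (1 / p))" using A1 Nh by simp
  finally have "real n \<le> K * real n powr (1 / p)" using \<delta> by (simp add: K_def field_simps)
  then have "real n powr 1 / real n powr (1 / p) \<le> K" using n0 by (simp add: field_simps)
  then have "real n powr (1 - 1 / p) \<le> K" by (simp only: powr_diff)
  moreover have "K < real n powr (1 - 1 / p)"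
  proof -
    have "K = (K powr (p / (p - 1))) powr (1 - 1 / p)" using K p by (simp add: powr_powr field_simps)
    also have "\<dots> < real n powr (1 - 1 / p)" using n p by (intro powr_less_mono2) auto
    finally show ?thesis .
  qed
  ultimately show False by simp
qed

lemma W0_sphere_null_seq: "f \<in> W0_sphere X N \<Longrightarrow> null_seq f"
  using evaluation_dual by (fastforce simp: W0_sphere_def null_seq_def)

lemma null_seq_W0_sphere: "null_seq f \<Longrightarrow> (\<And>n. N (f n) = 1) \<Longrightarrow> f \<in> W0_sphere X N"
  using null_seq_weakly_null by (auto simp: W0_sphere_def null_seq_def)

end

section \<open>Peak functions at a boundary point\<close>

definition peak :: "complex \<Rightarrow> nat \<Rightarrow> complex \<Rightarrow> complex" where
  "peak \<xi> n z = ((1 + cnj \<xi> * z) / 2) ^ n"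

lemma peak_holomorphic: "peak \<xi> n holomorphic_on A"
  unfolding peak_def by (intro holomorphic_intros) auto

lemma norm_peak_le_1:
  assumes "cmod \<xi> = 1" "z \<in> ball 0 1"
  shows "cmod (peak \<xi> n z) \<le> 1"
proof -
  have "cmod (1 + cnj \<xi> * z) \<le> 1 + cmod (cnj \<xi> * z)" by (metis norm_one norm_triangle_ineq)
  also have "\<dots> \<le> 2" using assms by (simp add: norm_mult)
  finally show ?thesis by (simp add: peak_def norm_power norm_divide power_le_one)
qed

lemma peak_near:
  assumes "cmod \<xi> = 1" "\<delta> > 0"
  obtains \<epsilon> where "\<epsilon> > 0" "\<And>z. z \<in> ball \<xi> \<epsilon> \<Longrightarrow> cmod (1 - peak \<xi> n z) \<le> \<delta>"
proof -
  have "isCont (peak \<xi> n) \<xi>" unfolding peak_def by (intro continuous_intros) auto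
  moreover have "peak \<xi> n \<xi> = 1"
    using assms(1) by (simp add: peak_def complex_norm_square[symmetric] mult.commute[of "cnj \<xi>"])
  ultimately obtain \<epsilon> where "\<epsilon> > 0" "\<And>z. dist z \<xi> < \<epsilon> \<Longrightarrow> dist (peak \<xi> n z) 1 < \<delta>"
    using assms(2) unfolding continuous_at_eps_delta by metis
  then show ?thesis
    using that[of \<epsilon>] by (metis dist_commute dist_norm less_imp_le mem_ball)
qed

text \<open>Multiplication with \<open>cnj \<xi>\<close> moves the peak to 1. There the
  parallelogram law |1 + v|^2 + |1 - v|^2 = 2 + 2 |v|^2 gives |1 + v|^2 \<le> 4 - e^2 for points of
  the disc at distance at least e from 1.\<close>

lemma peak_far:
  assumes "cmod \<xi> = 1" "\<epsilon> > 0"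
  obtains q where "0 < q" "q < 1" "\<And>z n. z \<in> ball 0 1 - ball \<xi> \<epsilon> \<Longrightarrow> cmod (peak \<xi> n z) \<le> q ^ n"
proof -
  \<comment> \<open>Capping at 1 keeps 1 - e^2/4 positive, hence \<open>q > 0\<close>.\<close>
  define e where "e = min \<epsilon> 1"
  have e: "0 < e" "e \<le> 1" "e \<le> \<epsilon>" using assms by (auto simp: e_def)
  define q where "q = sqrt (1 - e\<^sup>2 / 4)"
  have e2: "e\<^sup>2 \<le> 1" "0 < e\<^sup>2" using e by (auto simp: power_le_one)
  have "cmod ((1 + cnj \<xi> * z) / 2) \<le> q" if z: "z \<in> ball 0 1 - ball \<xi> \<epsilon>" for z
  proof -
    define v where "v = cnj \<xi> * z"
    have "cmod (1 - v) = cmod (\<xi> - z)"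
    proof -
      have "cnj \<xi> * (\<xi> - z) = 1 - v"
        using assms(1) by (simp add: v_def right_diff_distrib complex_norm_square[symmetric] mult.commute[of "cnj \<xi>"])
      then show ?thesis using assms(1) by (metis complex_mod_cnj mult_1 norm_mult)
    qed
    then have "e \<le> cmod (1 - v)" using z e by (auto simp: dist_norm)
    then have "e\<^sup>2 \<le> (cmod (1 - v))\<^sup>2" using e by (intro power_mono) auto
    moreover have "(cmod v)\<^sup>2 \<le> 1" using z assms(1) by (simp add: v_def norm_mult power_le_one)
    moreover have "(cmod (1 + v))\<^sup>2 + (cmod (1 - v))\<^sup>2 = 2 + 2 * (cmod v)\<^sup>2"
      unfolding cmod_power2 by (simp add: power2_eq_square algebra_simps)
    ultimately have "(cmod (1 + v))\<^sup>2 \<le> 4 - e\<^sup>2" by simp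
    then have "(cmod ((1 + v) / 2))\<^sup>2 \<le> 1 - e\<^sup>2 / 4" by (simp add: norm_divide power_divide)
    then show ?thesis unfolding q_def v_def by (rule real_le_rsqrt)
  qed
  then have "cmod (peak \<xi> n z) \<le> q ^ n" if "z \<in> ball 0 1 - ball \<xi> \<epsilon>" for z n
    using that by (simp add: peak_def norm_power power_mono)
  moreover have "0 < q" "q < 1" using e2 by (auto simp: q_def)
  ultimately show ?thesis using that by blast
qed

section \<open>Essential norm of an operator localized at a boundary point\<close>

context weighted_bergman begin

lemma bergman_peak:
  assumes "cmod \<xi> = 1" "f \<in> X"
  shows "(\<lambda>z. peak \<xi> n z * f z) \<in> X" "N (\<lambda>z. peak \<xi> n z * f z) \<le> N f"
    and "(\<lambda>z. (1 - peak \<xi> n z) * f z) \<in> X" "N (\<lambda>z. (1 - peak \<xi> n z) * f z) \<le> 2 * N f"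
proof -
  show "(\<lambda>z. peak \<xi> n z * f z) \<in> X" "N (\<lambda>z. peak \<xi> n z * f z) \<le> N f"
    using bergman_mult[OF assms(2) peak_holomorphic norm_peak_le_1[OF assms(1)], of n] by auto
  have "(\<lambda>z. 1 - peak \<xi> n z) holomorphic_on ball 0 1"
    by (intro holomorphic_intros peak_holomorphic)
  moreover have "cmod (1 - peak \<xi> n z) \<le> 2" if "z \<in> ball 0 1" for z
    using norm_triangle_ineq4[of 1 "peak \<xi> n z"] norm_peak_le_1[OF assms(1) that, of n] by simp
  ultimately show "(\<lambda>z. (1 - peak \<xi> n z) * f z) \<in> X" "N (\<lambda>z. (1 - peak \<xi> n z) * f z) \<le> 2 * N f"
    using bergman_mult[OF assms(2)] by blast+
qed

lemma bounded_operatorD: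
  assumes "R \<in> bounded_operators X N"
  shows "f \<in> X \<Longrightarrow> R f \<in> X"
    and "f \<in> X \<Longrightarrow> g \<in> X \<Longrightarrow> R (\<lambda>z. a * f z + b * g z) = (\<lambda>z. a * R f z + b * R g z)"
  using assms by (auto simp: bounded_operators_def linear_operator_def)

lemma bounded_operator_bound:
  assumes "R \<in> bounded_operators X N"
  obtains B where "B \<ge> 0" "\<And>f. f \<in> X \<Longrightarrow> N (R f) \<le> B * N f"
proof -
  obtain B where B: "\<And>f. f \<in> X \<Longrightarrow> N (R f) \<le> B * N f"
    using assms by (auto simp: bounded_operators_def)
  have "N (R f) \<le> max B 0 * N f" if "f \<in> X" for f
    using B[OF that] mult_right_mono[of B "max B 0" "N f"] by auto
  then show ?thesis using that[of "max B 0"] by auto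
qed

lemma bounded_operator_diff:
  assumes "R \<in> bounded_operators X N" "f \<in> X" "g \<in> X"
  shows "R (\<lambda>z. f z - g z) = (\<lambda>z. R f z - R g z)"
  using bounded_operatorD(2)[OF assms, of 1 "-1"] by simp

lemma op_norm_upper: "f \<in> X \<Longrightarrow> N f \<le> 1 \<Longrightarrow> ennreal (N (T f)) \<le> op_norm X N T"
  unfolding op_norm_def by (rule SUP_upper) auto

lemma op_norm_bound:
  assumes R: "R \<in> bounded_operators X N" and f: "f \<in> X"
  shows "ennreal (N (R f)) \<le> op_norm X N R * ennreal (N f)"
\<comment> \<open>Normalization fails for norm 0; there boundedness of \<open>R\<close> forces
  \<open>N (R f) = 0\<close>.\<close>
proof (cases "N f = 0")
  case True
  obtain B where "N (R f) \<le> B * N f" using bounded_operator_bound[OF R] f by blast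
  then show ?thesis using True N_nonneg[of "R f"] by simp
next
  case False
  then have pos: "N f > 0" using N_nonneg[of f] by linarith
  define g where "g = (\<lambda>z. of_real (1 / N f) * f z)"
  have c: "cmod (of_real (1 / N f)) = 1 / N f" unfolding norm_of_real using pos by simp
  have g: "g \<in> X" "N g \<le> 1"
    unfolding g_def using bergman_cmult[OF f, of "of_real (1 / N f)"] pos unfolding c by simp_all
  have "R (\<lambda>z. of_real (1 / N f) * f z + 0 * f z) = (\<lambda>z. of_real (1 / N f) * R f z + 0 * R f z)"
    by (rule bounded_operatorD(2)[OF R f f])
  then have "R g = (\<lambda>z. of_real (1 / N f) * R f z)"
    unfolding g_def mult_zero_left add_0_right .
  then have "N (R g) = 1 / N f * N (R f)"
    using bergman_cmult(2)[OF bounded_operatorD(1)[OF R f], of "of_real (1 / N f)"] unfolding c by simp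
  then have "N (R f) = N (R g) * N f" using pos by simp
  then have "ennreal (N (R f)) = ennreal (N (R g)) * ennreal (N f)" by (simp add: ennreal_mult)
  also have "\<dots> \<le> op_norm X N R * ennreal (N f)"
    by (intro mult_right_mono op_norm_upper g) simp
  finally show ?thesis .
qed

text \<open>A bounded sequence has a pointwise convergent subsequence by Montel's theorem; its
  difference from the limit is a null sequence, and the hypothesis turns this into norm convergence
  of the images.\<close>

lemma compact_peak_complement:
  assumes \<xi>: "cmod \<xi> = 1" and R: "R \<in> bounded_operators X N"
    and null: "\<And>f. null_seq f \<Longrightarrow> (\<lambda>k. N (\<lambda>z. (1 - peak \<xi> n z) * R (f k) z)) \<longlonglongrightarrow> 0"
  shows "(\<lambda>f z. (1 - peak \<xi> n z) * R f z) \<in> compact_operators X N"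
proof -
  note RX = bounded_operatorD(1)[OF R]
  obtain B where B: "B \<ge> 0" "\<And>f. f \<in> X \<Longrightarrow> N (R f) \<le> B * N f" using bounded_operator_bound[OF R] by blast
  have bdd: "(\<lambda>f z. (1 - peak \<xi> n z) * R f z) \<in> bounded_operators X N"
    unfolding bounded_operators_def linear_operator_def
  proof (intro CollectI conjI ballI allI exI[of _ "2 * B"])
    fix f assume f: "f \<in> X"
    show "(\<lambda>z. (1 - peak \<xi> n z) * R f z) \<in> X" by (rule bergman_peak(3)[OF \<xi> RX[OF f]])
    show "N (\<lambda>z. (1 - peak \<xi> n z) * R f z) \<le> 2 * B * N f"
      using bergman_peak(4)[OF \<xi> RX[OF f], of n] B(2)[OF f] by simp
    fix g a b assume g: "g \<in> X"
    show "(\<lambda>z. (1 - peak \<xi> n z) * R (\<lambda>z. a * f z + b * g z) z) =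
        (\<lambda>z. a * ((1 - peak \<xi> n z) * R f z) + b * ((1 - peak \<xi> n z) * R g z))"
      unfolding bounded_operatorD(2)[OF R f g] by (simp add: algebra_simps)
  qed
  have "\<exists>r. \<exists>g\<in>X. strict_mono r \<and> (\<lambda>k. N (\<lambda>z. (1 - peak \<xi> n z) * R (f (r k)) z - g z)) \<longlonglongrightarrow> 0"
    if f: "\<And>k. f k \<in> X" "\<And>k. N (f k) \<le> 1" for f :: "nat \<Rightarrow> complex \<Rightarrow> complex"
  proof -
    obtain g r where r: "strict_mono (r :: nat \<Rightarrow> nat)" and g: "g \<in> X" "N g \<le> 1" "\<And>z. (\<lambda>k. f (r k) z) \<longlonglongrightarrow> g z"
      by (rule bergman_montel[of f 1, OF f]) (rule that)
    have "null_seq (\<lambda>k z. f (r k) z - g z)"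
      unfolding null_seq_def
    proof (intro conjI allI exI[of _ 2])
      fix k
      show "(\<lambda>z. f (r k) z - g z) \<in> X" by (intro bergman_diff f g)
      show "N (\<lambda>z. f (r k) z - g z) \<le> 2"
        using bergman_diff(2)[OF f(1)[of "r k"] g(1)] f(2)[of "r k"] g(2) by simp
    next
      fix z show "(\<lambda>k. f (r k) z - g z) \<longlonglongrightarrow> 0" using g(3) by (simp add: LIM_zero)
    qed
    from null[OF this] have "(\<lambda>k. N (\<lambda>z. (1 - peak \<xi> n z) * R (f (r k)) z - (1 - peak \<xi> n z) * R g z)) \<longlonglongrightarrow> 0"
      by (simp add: bounded_operator_diff[OF R f(1) g(1)] right_diff_distrib)
    moreover have "(\<lambda>z. (1 - peak \<xi> n z) * R g z) \<in> X" by (rule bergman_peak(3)[OF \<xi> RX[OF g(1)]])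
    ultimately show ?thesis
      by (intro exI[of _ r] bexI[of _ "\<lambda>z. (1 - peak \<xi> n z) * R g z"] conjI r)
  qed
  with bdd show ?thesis by (auto simp: compact_operators_def)
qed

text \<open>The functional analytic core, stated for an arbitrary operator because it serves both
  each single \<open>S t\<close> and their integral. Upper bounds come from splitting off the
  compact part with factor \<open>1 - peak \<xi> n z\<close>; lower bounds come from one weakly null
  sequence \<open>g\<close> of unit vectors along which the norms tend to \<open>L\<close>.\<close>

lemma localized_operator_norms:
  assumes \<xi>: "cmod \<xi> = 1" and R: "R \<in> bounded_operators X N" and L: "L \<ge> 0"
    and null: "\<And>n f. null_seq f \<Longrightarrow> (\<lambda>k. N (\<lambda>z. (1 - peak \<xi> n z) * R (f k) z)) \<longlonglongrightarrow> 0"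
    and upper: "\<And>e. e > 0 \<Longrightarrow> \<exists>n. \<forall>f\<in>X. N (\<lambda>z. peak \<xi> n z * R f z) \<le> (L + e) * N f"
    and g: "null_seq g" "\<And>k. N (g k) = 1" "(\<lambda>k. N (R (g k))) \<longlonglongrightarrow> L"
  shows "(SUP f\<in>W0_sphere X N. limsup (\<lambda>n. ennreal (N (R (f n))))) = ennreal L"
    and "ess_norm X N R = ennreal L"
proof -
  note RX = bounded_operatorD(1)[OF R]
  have gX: "g k \<in> X" for k using g(1) by (simp add: null_seq_def)
  show "(SUP f\<in>W0_sphere X N. limsup (\<lambda>n. ennreal (N (R (f n))))) = ennreal L"
  proof (rule antisym)
    show "(SUP f\<in>W0_sphere X N. limsup (\<lambda>n. ennreal (N (R (f n))))) \<le> ennreal L"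
    proof (rule SUP_least, rule ennreal_le_epsilon)
      fix f e assume f: "f \<in> W0_sphere X N" and e: "(e::real) > 0"
      obtain n where n: "\<And>h. h \<in> X \<Longrightarrow> N (\<lambda>z. peak \<xi> n z * R h z) \<le> (L + e / 2) * N h"
        using upper[of "e / 2"] e by auto
      have fX: "f k \<in> X" "N (f k) = 1" for k using f by (auto simp: W0_sphere_def)
      have "eventually (\<lambda>k. N (\<lambda>z. (1 - peak \<xi> n z) * R (f k) z) < e / 2) sequentially"
        using null[OF W0_sphere_null_seq[OF f], of n] by (rule order_tendstoD(2)) (use e in auto)
      then have "eventually (\<lambda>k. ennreal (N (R (f k))) \<le> ennreal L + ennreal e) sequentially"
      proof eventually_elim
        case (elim k)
        have "N (R (f k)) = N (\<lambda>z. peak \<xi> n z * R (f k) z + (1 - peak \<xi> n z) * R (f k) z)"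
          by (simp add: algebra_simps)
        also have "\<dots> \<le> N (\<lambda>z. peak \<xi> n z * R (f k) z) + N (\<lambda>z. (1 - peak \<xi> n z) * R (f k) z)"
          by (intro bergman_add bergman_peak \<xi> RX fX)
        also have "\<dots> \<le> (L + e / 2) * 1 + e / 2"
          using n[OF fX(1)] fX(2) elim by (intro add_mono) auto
        finally have "N (R (f k)) \<le> L + e" by simp
        then show ?case using L e by (simp flip: ennreal_plus)
      qed
      then show "limsup (\<lambda>k. ennreal (N (R (f k)))) \<le> ennreal L + ennreal e"
        by (rule Limsup_bounded)
    qed
    have "limsup (\<lambda>k. ennreal (N (R (g k)))) = ennreal L"
      by (intro lim_imp_Limsup tendsto_ennrealI g) auto
    then show "ennreal L \<le> (SUP f\<in>W0_sphere X N. limsup (\<lambda>n. ennreal (N (R (f n)))))"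
      using SUP_upper[OF null_seq_W0_sphere[OF g(1,2)]] by metis
  qed
  show "ess_norm X N R = ennreal L"
  proof (rule antisym)
    show "ess_norm X N R \<le> ennreal L"
    proof (rule ennreal_le_epsilon)
      fix e :: real assume e: "e > 0"
      obtain n where n: "\<And>h. h \<in> X \<Longrightarrow> N (\<lambda>z. peak \<xi> n z * R h z) \<le> (L + e) * N h"
        using upper[of e] e by auto
      have "ess_norm X N R \<le> op_norm X N (\<lambda>f z. R f z - (1 - peak \<xi> n z) * R f z)"
        unfolding ess_norm_def by (rule INF_lower) (rule compact_peak_complement[OF \<xi> R null])
      also have "\<dots> \<le> ennreal (L + e)"
        unfolding op_norm_def
      proof (rule SUP_least)
        fix f assume f: "f \<in> {f \<in> X. N f \<le> 1}"
        have "N (\<lambda>z. R f z - (1 - peak \<xi> n z) * R f z) \<le> (L + e) * N f"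
          using n[of f] f by (simp add: algebra_simps)
        also have "\<dots> \<le> (L + e) * 1" using f L e by (intro mult_left_mono) auto
        finally show "ennreal (N (\<lambda>z. R f z - (1 - peak \<xi> n z) * R f z)) \<le> ennreal (L + e)"
          by (simp add: ennreal_leI)
      qed
      finally show "ess_norm X N R \<le> ennreal L + ennreal e" using L e by simp
    qed
    show "ennreal L \<le> ess_norm X N R"
      unfolding ess_norm_def
    proof (rule INF_greatest)
      fix K assume K: "K \<in> compact_operators X N"
      then have Kb: "K \<in> bounded_operators X N" by (simp add: compact_operators_def)
      note KX = bounded_operatorD(1)[OF Kb]
      obtain B where B: "B \<ge> 0" "\<And>f. f \<in> X \<Longrightarrow> N (K f) \<le> B * N f" using bounded_operator_bound[OF Kb] by blast
      have "\<forall>n. g n \<in> X \<and> N (g n) \<le> 1" using gX g(2) by simp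
      with K have "\<exists>r. \<exists>h\<in>X. strict_mono r \<and> (\<lambda>n. N (\<lambda>z. K (g (r n)) z - h z)) \<longlonglongrightarrow> 0"
        unfolding compact_operators_def by blast
      then obtain r h where r: "strict_mono (r :: nat \<Rightarrow> nat)" and h: "h \<in> X" "(\<lambda>n. N (\<lambda>z. K (g (r n)) z - h z)) \<longlonglongrightarrow> 0"
        by blast
      \<comment> \<open>Compactness gives some norm limit \<open>h\<close> of a subsequence of
        \<open>K (g n)\<close>. Since \<open>K\<close> followed by evaluation at \<open>z\<close> is
        a bounded functional, weak nullity of \<open>g\<close> forces the limit to be 0.\<close>
      have "h z = 0" for z
      proof -
        obtain C where C: "\<And>f. f \<in> X \<Longrightarrow> cmod (f z) \<le> C * N f" using evaluation_bound_at[of z] by blast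
        have "(\<lambda>f. K f z) \<in> dual_space X N"
          unfolding dual_space_def
        proof (intro CollectI conjI ballI allI exI[of _ "\<bar>C\<bar> * B"])
          fix f assume f: "f \<in> X"
          have "cmod (K f z) \<le> C * N (K f)" by (rule C[OF KX[OF f]])
          also have "\<dots> \<le> \<bar>C\<bar> * (B * N f)" using B f by (intro mult_mono) auto
          finally show "cmod (K f z) \<le> \<bar>C\<bar> * B * N f" by (simp add: mult.assoc)
        qed (simp add: bounded_operatorD(2)[OF Kb])
        then have "(\<lambda>k. K (g k) z) \<longlonglongrightarrow> 0" by (rule null_seq_weakly_null[OF g(1)])
        then have "(\<lambda>k. K (g (r k)) z) \<longlonglongrightarrow> 0" using r by (rule LIMSEQ_subseq_LIMSEQ[unfolded o_def])
        moreover have "(\<lambda>k. K (g (r k)) z) \<longlonglongrightarrow> h z"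
          by (rule norm_conv_imp_pointwise[OF KX[OF gX] h])
        ultimately show ?thesis by (rule LIMSEQ_unique[symmetric])
      qed
      with h(2) have K0: "(\<lambda>n. N (K (g (r n)))) \<longlonglongrightarrow> 0" by simp
      have R0: "(\<lambda>n. N (R (g (r n)))) \<longlonglongrightarrow> L" using g(3) r by (rule LIMSEQ_subseq_LIMSEQ[unfolded o_def])
      have lim: "(\<lambda>n. ennreal (N (R (g (r n))) - N (K (g (r n))))) \<longlonglongrightarrow> ennreal (L - 0)"
        by (intro tendsto_ennrealI tendsto_diff R0 K0)
      have "ennreal (N (R (g (r n))) - N (K (g (r n)))) \<le> op_norm X N (\<lambda>f z. R f z - K f z)" for n
      proof -
        have "N (R (g (r n))) = N (\<lambda>z. (R (g (r n)) z - K (g (r n)) z) + K (g (r n)) z)" by simp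
        also have "\<dots> \<le> N (\<lambda>z. R (g (r n)) z - K (g (r n)) z) + N (K (g (r n)))"
          by (intro bergman_add bergman_diff RX KX gX)
        finally have "ennreal (N (R (g (r n))) - N (K (g (r n)))) \<le> ennreal (N (\<lambda>z. R (g (r n)) z - K (g (r n)) z))"
          by (intro ennreal_leI) simp
        also have "\<dots> \<le> op_norm X N (\<lambda>f z. R f z - K f z)"
          using op_norm_upper[OF gX[of "r n"], of "\<lambda>f z. R f z - K f z"] g(2)[of "r n"] by simp
        finally show ?thesis .
      qed
      then show "ennreal L \<le> op_norm X N (\<lambda>f z. R f z - K f z)"
        using LIMSEQ_le_const2[OF lim] by auto
    qed
  qed
qed

end

section \<open>The test functions\<close>

lemma Re_one_minus_div_pos:
  assumes "cmod \<xi> = 1" "z \<in> ball 0 1"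
  shows "Re (1 - z / \<xi>) > 0"
proof -
  have "Re (z / \<xi>) \<le> cmod (z / \<xi>)" by (rule complex_Re_le_cmod)
  also have "\<dots> < 1" using assms by (simp add: norm_divide)
  finally show ?thesis by simp
qed

lemma f_hat_holomorphic:
  assumes "cmod \<xi> = 1"
  shows "f_hat \<xi> c holomorphic_on ball 0 1"
proof -
  have "(\<lambda>z. exp (- complex_of_real c * (Ln \<xi> + Ln (1 - z / \<xi>)))) holomorphic_on ball 0 1"
    using assms Re_one_minus_div_pos[OF assms]
    by (intro holomorphic_intros) (force simp: complex_nonpos_Reals_iff)+
  then show ?thesis by (rule holomorphic_transform) (simp add: f_hat_def)
qed

lemma f_hat_tendsto:
  assumes "c \<longlonglongrightarrow> c0"
  shows "(\<lambda>n. f_hat \<xi> (c n) z) \<longlonglongrightarrow> f_hat \<xi> c0 z"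
proof (cases "z \<in> ball 0 1")
  case True
  have "(\<lambda>n. exp (- complex_of_real (c n) * (Ln \<xi> + Ln (1 - z / \<xi>)))) \<longlonglongrightarrow> exp (- complex_of_real c0 * (Ln \<xi> + Ln (1 - z / \<xi>)))"
    by (intro tendsto_intros assms)
  with True show ?thesis by (simp only: f_hat_def if_True)
qed (simp add: f_hat_def)

lemma norm_f_hat:
  assumes "cmod \<xi> = 1" "z \<in> ball 0 1"
  shows "cmod (f_hat \<xi> c z) = cmod (\<xi> - z) powr (- c)"
proof -
  have "1 - z / \<xi> \<noteq> 0" using Re_one_minus_div_pos[OF assms] by force
  moreover have "\<xi> \<noteq> 0" using assms by auto
  ultimately have "Re (Ln \<xi> + Ln (1 - z / \<xi>)) = ln (cmod (1 - z / \<xi>))"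
    using assms(1) by (simp add: Re_Ln)
  also have "cmod (1 - z / \<xi>) = cmod (\<xi> - z)"
  proof -
    have "\<xi> * (1 - z / \<xi>) = \<xi> - z" using \<open>\<xi> \<noteq> 0\<close> by (simp add: field_simps)
    then show ?thesis using assms(1) by (metis mult_1 norm_mult)
  qed
  finally show ?thesis
    using assms \<open>1 - z / \<xi> \<noteq> 0\<close> \<open>\<xi> \<noteq> 0\<close> by (auto simp: f_hat_def powr_def field_simps)
qed

text \<open>A dyadic decomposition: where the distance to \<xi> lies between 2/2^(k+1) and 2/2^k the
  integrand is at most \<open>a k\<close>, and \<open>D k\<close> has area 4 pi / 4^k. The terms
  form a geometric series of ratio 2^(s - 2). For an upper bound full discs may replace
  annuli.\<close>

lemma nn_integral_powr_ball_finite: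
  fixes \<xi> :: complex
  assumes "0 \<le> s" "s < 2"
  shows "(\<integral>\<^sup>+z\<in>ball \<xi> 2. ennreal (cmod (\<xi> - z) powr (- s)) \<partial>lborel) < \<infinity>"
proof -
  define D where "D k = ball \<xi> (2 / 2 ^ k)" for k :: nat
  define a where "a k = (2 ^ k :: real) powr s" for k :: nat
  define q where "q = (2::real) powr (s - 2)"
  have q: "0 < q" "q < 1" using powr_less_mono[of "s - 2" 0 2] assms by (auto simp: q_def)
  have [measurable]: "D k \<in> sets borel" for k by (simp add: D_def)
  have le: "ennreal (cmod (\<xi> - z) powr (- s)) * indicator (ball \<xi> 2) z \<le> (\<Sum>k. ennreal (a k) * indicator (D k) z)" for z
  proof (cases "z \<in> ball \<xi> 2 \<and> z \<noteq> \<xi>")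
    case True
    define d where "d = cmod (\<xi> - z)"
    have d: "0 < d" "d < 2" using True by (auto simp: d_def dist_norm)
    have "\<exists>k. (2::real) / 2 ^ Suc k \<le> d"
    proof -
      obtain k where "(1/2::real) ^ k < d" using real_arch_pow_inv[of d "1/2"] d by auto
      then show ?thesis by (intro exI[of _ k]) (simp add: power_divide)
    qed
    define k where "k = (LEAST k. (2::real) / 2 ^ Suc k \<le> d)"
    have k1: "2 / 2 ^ Suc k \<le> d" unfolding k_def by (rule LeastI_ex) fact
    have k2: "d < 2 / 2 ^ k"
    proof (cases k)
      case (Suc j)
      then have "\<not> 2 / 2 ^ Suc j \<le> d" using not_less_Least[of j "\<lambda>k. (2::real) / 2 ^ Suc k \<le> d"] by (simp add: k_def)
      then show ?thesis using Suc by simp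
    qed (use d in simp)
    have "d powr (- s) \<le> (1 / 2 ^ k) powr (- s)"
      using k1 assms d by (intro powr_mono2') auto
    also have "\<dots> = a k" by (simp add: a_def powr_divide powr_minus field_simps)
    finally have "ennreal (cmod (\<xi> - z) powr (- s)) * indicator (ball \<xi> 2) z \<le> ennreal (a k) * indicator (D k) z"
      using k2 True by (simp add: d_def D_def dist_norm ennreal_leI)
    also have "\<dots> \<le> (\<Sum>k. ennreal (a k) * indicator (D k) z)"
      using sum_le_suminf[of "\<lambda>k. ennreal (a k) * indicator (D k) z" "{k}"] by (simp del: sum_mult_indicator)
    finally show ?thesis .
  qed auto
  have "(\<integral>\<^sup>+z\<in>ball \<xi> 2. ennreal (cmod (\<xi> - z) powr (- s)) \<partial>lborel) \<le> (\<integral>\<^sup>+z. (\<Sum>k. ennreal (a k) * indicator (D k) z) \<partial>lborel)"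
    by (intro nn_integral_mono le)
  also have "\<dots> = (\<Sum>k. \<integral>\<^sup>+z. ennreal (a k) * indicator (D k) z \<partial>lborel)"
    by (rule nn_integral_suminf) measurable
  also have "\<dots> = (\<Sum>k. ennreal (4 * pi * q ^ k))"
  proof (rule suminf_cong)
    fix k
    have "(\<integral>\<^sup>+z. ennreal (a k) * indicator (D k) z \<partial>lborel) = ennreal (a k) * emeasure lborel (D k)"
      by (rule nn_integral_cmult_indicator) simp
    also have "emeasure lborel (D k) = ennreal (pi * (2 / 2 ^ k)\<^sup>2)"
      by (simp add: D_def emeasure_ball unit_ball_vol_2)
    also have "ennreal (a k) * \<dots> = ennreal (a k * (pi * (2 / 2 ^ k)\<^sup>2))"
      by (simp add: a_def ennreal_mult)
    also have "a k * (pi * (2 / 2 ^ k)\<^sup>2) = 4 * pi * q ^ k"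
    proof -
      have "a k = (2 powr s) ^ k" by (simp add: a_def powr_powr mult.commute flip: powr_realpow)
      moreover have "q = 2 powr s / 4" by (simp add: q_def powr_diff)
      ultimately show ?thesis by (simp add: power_divide power2_eq_square field_simps flip: power_mult_distrib)
    qed
    finally show "(\<integral>\<^sup>+z. ennreal (a k) * indicator (D k) z \<partial>lborel) = ennreal (4 * pi * q ^ k)" .
  qed
  also have "\<dots> < \<infinity>"
  proof -
    have "summable (\<lambda>k. 4 * pi * q ^ k)" using q by (intro summable_mult summable_geometric) auto
    then show ?thesis using q by (subst suminf_ennreal2) auto
  qed
  finally show ?thesis .
qed

section \<open>Norms of the test functions near the critical exponent\<close>

context weighted_bergman begin

lemma f_hat_measurable: "cmod \<xi> = 1 \<Longrightarrow> f_hat \<xi> c \<in> borel_measurable borel"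
  using f_hat_holomorphic[of \<xi> c]
  by (intro measurable_disk holomorphic_on_imp_continuous_on) (auto simp: f_hat_def)

lemma one_minus_norm_le:
  assumes "cmod \<xi> = 1" "z \<in> ball 0 1"
  shows "1 - (cmod z)\<^sup>2 \<le> 2 * cmod (\<xi> - z)"
proof -
  have "1 - (cmod z)\<^sup>2 = (1 - cmod z) * (1 + cmod z)" by (simp add: power2_eq_square algebra_simps)
  also have "\<dots> \<le> cmod (\<xi> - z) * 2"
    using assms norm_triangle_ineq2[of \<xi> z] by (intro mult_mono) auto
  finally show ?thesis by simp
qed

text \<open>As 1 - |z|^2 \<le> 2 |\<xi> - z|, the weight is at most a multiple of |\<xi> -
  z|^\<alpha>, which leaves the exponent c p - \<alpha> < 2. The lower restriction on c keeps this
  exponent nonnegative; it is satisfied close to the critical value.\<close>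

lemma f_hat_bergman:
  assumes \<xi>: "cmod \<xi> = 1" and c: "\<alpha> \<le> c * p" "c < (2 + \<alpha>) / p"
  shows "f_hat \<xi> c \<in> X"
proof -
  have cp: "c * p - \<alpha> < 2" using c p by (simp add: field_simps)
  note [measurable] = f_hat_measurable[OF \<xi>, of c]
  define K where "K = (1 + \<alpha>) / pi * 2 powr \<alpha>"
  have K: "K \<ge> 0" using \<alpha> by (simp add: K_def)
  have bm: "ball \<xi> 2 \<in> sets borel" by simp
  have "(\<integral>\<^sup>+z. ennreal (cmod (f_hat \<xi> c z) powr p) \<partial>\<mu>) = (\<integral>\<^sup>+z. ennreal (weight z) * ennreal (cmod (f_hat \<xi> c z) powr p) \<partial>lborel)"
    by (rule nn_integral_dA) measurable
  also have "\<dots> \<le> (\<integral>\<^sup>+z. ennreal K * (ennreal (cmod (\<xi> - z) powr (- (c * p - \<alpha>))) * indicator (ball \<xi> 2) z) \<partial>lborel)"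
  proof (rule nn_integral_mono)
    fix z :: complex
    show "ennreal (weight z) * ennreal (cmod (f_hat \<xi> c z) powr p)
      \<le> ennreal K * (ennreal (cmod (\<xi> - z) powr (- (c * p - \<alpha>))) * indicator (ball \<xi> 2) z)"
    proof (cases "z \<in> ball 0 1")
      case True
      have d: "cmod (\<xi> - z) > 0" using True \<xi> by auto
      have z2: "z \<in> ball \<xi> 2"
        using True \<xi> norm_triangle_ineq4[of \<xi> z] by (simp add: dist_norm)
      have "(1 - (cmod z)\<^sup>2) powr \<alpha> \<le> (2 * cmod (\<xi> - z)) powr \<alpha>"
        using one_minus_norm_le[OF \<xi> True] True \<alpha> by (intro powr_mono2) (auto simp: power_le_one)
      also have "\<dots> = 2 powr \<alpha> * cmod (\<xi> - z) powr \<alpha>" by (simp add: powr_mult)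
      finally have "(1 + \<alpha>) / pi * (1 - (cmod z)\<^sup>2) powr \<alpha> \<le> (1 + \<alpha>) / pi * (2 powr \<alpha> * cmod (\<xi> - z) powr \<alpha>)"
        using \<alpha> by (intro mult_left_mono) auto
      then have "weight z \<le> K * cmod (\<xi> - z) powr \<alpha>"
        using True by (simp add: weight_def K_def mult_ac)
      then have "weight z * (cmod (f_hat \<xi> c z) powr p) \<le> K * cmod (\<xi> - z) powr \<alpha> * (cmod (f_hat \<xi> c z) powr p)"
        by (rule mult_right_mono) simp
      also have "\<dots> = K * cmod (\<xi> - z) powr (- (c * p - \<alpha>))"
        using d by (simp add: norm_f_hat[OF \<xi> True] powr_powr powr_add[symmetric] algebra_simps)
      finally show ?thesis using z2 weight_nonneg K
        by (simp add: ennreal_leI flip: ennreal_mult)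
    qed (simp add: weight_def)
  qed
  also have "\<dots> = ennreal K * (\<integral>\<^sup>+z\<in>ball \<xi> 2. ennreal (cmod (\<xi> - z) powr (- (c * p - \<alpha>))) \<partial>lborel)"
    using bm by (intro nn_integral_cmult borel_measurable_times_ennreal borel_measurable_indicator) auto
  also have "\<dots> < \<infinity>"
    using nn_integral_powr_ball_finite[of "c * p - \<alpha>" \<xi>] c cp by (simp add: ennreal_mult_less_top)
  finally show ?thesis
    using f_hat_holomorphic[OF \<xi>] by (auto simp: bergman_def f_hat_def)
qed

text \<open>Each disc \<open>D n\<close>, at distance comparable to \<open>t n\<close> from \<xi>,
  carries mass at least \<kappa>, because area t^2, weight t^\<alpha> and integrand t^(-2-\<alpha>)
  balance exactly. A finite integral would force these masses to 0 by dominated convergence, since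
  every point of the unit disc lies in only finitely many \<open>D n\<close>.\<close>

lemma nn_integral_critical_infinite:
  assumes \<xi>: "cmod \<xi> = 1"
  shows "(\<integral>\<^sup>+z. ennreal (cmod (f_hat \<xi> ((2 + \<alpha>) / p) z) powr p) \<partial>\<mu>) = \<infinity>"
proof (rule ccontr)
  define h where "h z = ennreal (cmod (f_hat \<xi> ((2 + \<alpha>) / p) z) powr p)" for z
  assume "(\<integral>\<^sup>+z. ennreal (cmod (f_hat \<xi> ((2 + \<alpha>) / p) z) powr p) \<partial>\<mu>) \<noteq> \<infinity>"
  then have fin: "(\<integral>\<^sup>+z. h z \<partial>\<mu>) < \<infinity>" by (simp add: h_def less_top)
  note [measurable] = f_hat_measurable[OF \<xi>, of "(2 + \<alpha>) / p"]
  have hm[measurable]: "h \<in> borel_measurable borel" unfolding h_def by measurable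
  define t where "t n = 1 / real (n + 2)" for n :: nat
  have t: "0 < t n" "t n < 1" for n by (auto simp: t_def)
  define a where "a n = of_real (1 - t n) * \<xi>" for n
  define D where "D n = ball (a n) (t n / 2)" for n
  have [measurable]: "D n \<in> sets borel" for n by (simp add: D_def)
  have na: "cmod (a n) = 1 - t n" for n
    using t[of n] \<xi> unfolding a_def norm_mult norm_of_real by simp
  have zD: "cmod z > 1 - 3 * t n / 2" "cmod z < 1 - t n / 2" "cmod (\<xi> - z) < 3 * t n / 2" if "z \<in> D n" for n z
  proof -
    have d: "cmod (a n - z) < t n / 2" using that by (simp add: D_def dist_norm)
    show "cmod z > 1 - 3 * t n / 2" using d na[of n] norm_triangle_ineq2[of "a n" z] by simp
    show "cmod z < 1 - t n / 2" using d na[of n] norm_triangle_ineq2[of z "a n"] by (simp add: norm_minus_commute)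
    have "\<xi> - a n = of_real (t n) * \<xi>" by (simp add: a_def algebra_simps)
    then have "cmod (\<xi> - a n) = t n" using \<xi> t[of n] by (simp add: norm_mult)
    then show "cmod (\<xi> - z) < 3 * t n / 2" using d norm_triangle_ineq[of "\<xi> - a n" "a n - z"] by simp
  qed
  \<comment> \<open>The product of the lower bounds for weight and integrand with the area of
    \<open>D n\<close>; all powers of \<open>t n / 2\<close> cancel in it.\<close>
  define \<kappa> where "\<kappa> = (1 + \<alpha>) * 3 powr (- (2 + \<alpha>))"
  have \<kappa>: "\<kappa> > 0" using \<alpha> by (simp add: \<kappa>_def)
  have low: "ennreal \<kappa> \<le> (\<integral>\<^sup>+z\<in>D n. h z \<partial>\<mu>)" for n
  proof -
    define C where "C = (1 + \<alpha>) / pi * (t n / 2) powr \<alpha> * (3 * t n / 2) powr (- (2 + \<alpha>))"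
    have "\<kappa> = C * (pi * (t n / 2)\<^sup>2)"
    proof -
      define x where "x = t n / 2"
      have x: "x > 0" using t[of n] by (simp add: x_def)
      have "(3 * x) powr (- (2 + \<alpha>)) = 3 powr (- (2 + \<alpha>)) * x powr (- (2 + \<alpha>))"
        using x by (simp add: powr_mult)
      moreover have E: "x powr \<alpha> * x powr (- (2 + \<alpha>)) * x\<^sup>2 = 1"
      proof -
        have "x\<^sup>2 = x powr 2" using x by simp
        then have "x powr \<alpha> * x powr (- (2 + \<alpha>)) * x\<^sup>2 = x powr (\<alpha> + - (2 + \<alpha>) + 2)"
          by (simp only: powr_add)
        then show ?thesis using x by simp
      qed
      ultimately have "C * (pi * x\<^sup>2) = (1 + \<alpha>) * 3 powr (- (2 + \<alpha>)) * (x powr \<alpha> * x powr (- (2 + \<alpha>)) * x\<^sup>2)"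
        by (simp add: C_def x_def)
      then show ?thesis unfolding E by (simp only: \<kappa>_def x_def mult_1_right)
    qed
    then have "ennreal \<kappa> = ennreal C * emeasure lborel (D n)"
    proof -
      have "emeasure lborel (D n) = ennreal (pi * (t n / 2)\<^sup>2)"
        using t[of n] by (simp add: D_def emeasure_ball unit_ball_vol_2)
      moreover have "C \<ge> 0" using \<alpha> by (simp add: C_def)
      ultimately show ?thesis using \<open>\<kappa> = C * (pi * (t n / 2)\<^sup>2)\<close> by (simp only: ennreal_mult zero_le_power2 mult_nonneg_nonneg pi_ge_zero)
    qed
    also have "\<dots> = (\<integral>\<^sup>+z. ennreal C * indicator (D n) z \<partial>lborel)"
      by (rule nn_integral_cmult_indicator[symmetric]) simp
    also have "\<dots> \<le> (\<integral>\<^sup>+z. ennreal (weight z) * (h z * indicator (D n) z) \<partial>lborel)"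
    proof (rule nn_integral_mono)
      fix z :: complex
      show "ennreal C * indicator (D n) z \<le> ennreal (weight z) * (h z * indicator (D n) z)"
      proof (cases "z \<in> D n")
        case True
        note zd = zD[OF True]
        have zb: "z \<in> ball 0 1" using zd(2) t[of n] by simp
        have d: "cmod (\<xi> - z) > 0" using zb \<xi> by auto
        have "(cmod z)\<^sup>2 \<le> cmod z" using zb by (simp add: power2_eq_square mult_left_le)
        then have "t n / 2 \<le> 1 - (cmod z)\<^sup>2" using zd by simp
        then have "(t n / 2) powr \<alpha> \<le> (1 - (cmod z)\<^sup>2) powr \<alpha>" using t[of n] \<alpha> by (intro powr_mono2) auto
        then have w: "(1 + \<alpha>) / pi * (t n / 2) powr \<alpha> \<le> weight z"
          using \<alpha> zb mult_left_mono[of "(t n / 2) powr \<alpha>" "(1 - (cmod z)\<^sup>2) powr \<alpha>" "(1 + \<alpha>) / pi"]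
          by (simp add: weight_def)
        have "(3 * t n / 2) powr (- (2 + \<alpha>)) \<le> cmod (\<xi> - z) powr (- (2 + \<alpha>))"
          using zd(3) d \<alpha> by (intro powr_mono2') auto
        also have "\<dots> = cmod (f_hat \<xi> ((2 + \<alpha>) / p) z) powr p"
          using p by (simp add: norm_f_hat[OF \<xi> zb] powr_powr)
        finally have "C \<le> weight z * cmod (f_hat \<xi> ((2 + \<alpha>) / p) z) powr p"
          unfolding C_def using w weight_nonneg by (intro mult_mono) auto
        then show ?thesis using True weight_nonneg by (simp add: h_def ennreal_leI flip: ennreal_mult)
      qed simp
    qed
    also have "\<dots> = (\<integral>\<^sup>+z\<in>D n. h z \<partial>\<mu>)"
      by (rule nn_integral_dA[symmetric]) measurable
    finally show ?thesis .
  qed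
  have "(\<lambda>n. \<integral>\<^sup>+z\<in>D n. h z \<partial>\<mu>) \<longlonglongrightarrow> (\<integral>\<^sup>+z. 0 \<partial>\<mu>)"
  proof (rule nn_integral_dominated_convergence[where w = h])
    show "AE z in \<mu>. (\<lambda>n. h z * indicator (D n) z) \<longlonglongrightarrow> 0"
      using AE_dA
    proof eventually_elim
      fix z :: complex assume z: "z \<in> ball 0 1"
      have "t \<longlonglongrightarrow> 0" unfolding t_def using LIMSEQ_ignore_initial_segment[OF lim_1_over_n, of 2] by simp
      then have "(\<lambda>n. 1 - 3 * t n / 2) \<longlonglongrightarrow> 1 - 3 * 0 / 2" by (intro tendsto_intros) auto
      then have "eventually (\<lambda>n. cmod z < 1 - 3 * t n / 2) sequentially"
        by (rule order_tendstoD(1)) (use z in auto)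
      then have "eventually (\<lambda>n. h z * indicator (D n) z = 0) sequentially"
        by eventually_elim (use zD(1) in \<open>force simp: indicator_def\<close>)
      then show "(\<lambda>n. h z * indicator (D n) z) \<longlonglongrightarrow> 0" by (rule tendsto_eventually)
    qed
    show "AE z in \<mu>. h z * indicator (D j) z \<le> h z" for j by (auto simp: indicator_def)
  qed (use fin in auto)
  then have "ennreal \<kappa> \<le> 0" using low LIMSEQ_le_const by fastforce
  then show False using \<kappa> by (simp add: ennreal_eq_0_iff)
qed

text \<open>Fatou's lemma transfers divergence of the critical integral to the subcritical
  norms.\<close>

lemma f_hat_norm_at_top:
  assumes \<xi>: "cmod \<xi> = 1" and c: "\<And>n. \<alpha> \<le> c n * p" "\<And>n. c n < (2 + \<alpha>) / p" "c \<longlonglongrightarrow> (2 + \<alpha>) / p"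
  shows "filterlim (\<lambda>n. N (f_hat \<xi> (c n))) at_top sequentially"
proof -
  note [measurable] = f_hat_measurable[OF \<xi>]
  have "\<infinity> = (\<integral>\<^sup>+z. ennreal (cmod (f_hat \<xi> ((2 + \<alpha>) / p) z) powr p) \<partial>\<mu>)"
    by (rule nn_integral_critical_infinite[OF \<xi>, symmetric])
  also have "\<dots> = (\<integral>\<^sup>+z. liminf (\<lambda>n. ennreal (cmod (f_hat \<xi> (c n) z) powr p)) \<partial>\<mu>)"
  proof (rule nn_integral_cong)
    fix z
    have "(\<lambda>n. f_hat \<xi> (c n) z) \<longlonglongrightarrow> f_hat \<xi> ((2 + \<alpha>) / p) z"
      using c(3) by (rule f_hat_tendsto)
    then have "(\<lambda>n. ennreal (cmod (f_hat \<xi> (c n) z) powr p)) \<longlonglongrightarrow> ennreal (cmod (f_hat \<xi> ((2 + \<alpha>) / p) z) powr p)"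
      using p by (intro tendsto_ennrealI tendsto_powr2 tendsto_norm) auto
    then show "ennreal (cmod (f_hat \<xi> ((2 + \<alpha>) / p) z) powr p) = liminf (\<lambda>n. ennreal (cmod (f_hat \<xi> (c n) z) powr p))"
      by (intro lim_imp_Liminf[symmetric]) auto
  qed
  also have "\<dots> \<le> liminf (\<lambda>n. \<integral>\<^sup>+z. ennreal (cmod (f_hat \<xi> (c n) z) powr p) \<partial>\<mu>)"
    by (rule nn_integral_liminf) simp
  also have "\<dots> = liminf (\<lambda>n. ennreal (N (f_hat \<xi> (c n)) powr p))"
    by (simp add: nn_integral_eq_N[OF f_hat_bergman[OF \<xi> c(1,2)]])
  finally have inf: "liminf (\<lambda>n. ennreal (N (f_hat \<xi> (c n)) powr p)) = \<infinity>" by (simp add: top.extremum_unique)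
  show ?thesis
    unfolding filterlim_at_top_gt[where c = 0]
  proof (intro allI impI)
    fix Z :: real assume Z: "0 < Z"
    have "ennreal (Z powr p) < liminf (\<lambda>n. ennreal (N (f_hat \<xi> (c n)) powr p))" by (simp add: inf)
    then have "eventually (\<lambda>n. ennreal (Z powr p) < ennreal (N (f_hat \<xi> (c n)) powr p)) sequentially"
      by (rule less_LiminfD)
    then show "eventually (\<lambda>n. Z \<le> N (f_hat \<xi> (c n))) sequentially"
    proof eventually_elim
      case (elim n)
      then have "Z powr p < N (f_hat \<xi> (c n)) powr p" by (simp add: ennreal_less_iff)
      then have "\<not> N (f_hat \<xi> (c n)) < Z" using powr_mono2[of p "N (f_hat \<xi> (c n))" Z] p by force
      then show ?case by simp
    qed
  qed
qed

lemma f_test_bergman: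
  assumes \<xi>: "cmod \<xi> = 1" and c: "\<alpha> \<le> c * p" "c < (2 + \<alpha>) / p"
  shows "f_test p \<alpha> \<xi> c \<in> X" "N (f_test p \<alpha> \<xi> c) = 1"
proof -
  note X = f_hat_bergman[OF \<xi> c]
  have "f_hat \<xi> c 0 \<noteq> 0" using \<xi> by (auto simp: f_hat_def)
  then have "N (f_hat \<xi> c) \<noteq> 0" using N_eq_0D[OF X] by metis
  moreover have eq: "f_test p \<alpha> \<xi> c = (\<lambda>z. inverse (of_real (N (f_hat \<xi> c))) * f_hat \<xi> c z)"
    by (simp add: f_test_def divide_inverse mult.commute)
  ultimately show "f_test p \<alpha> \<xi> c \<in> X" "N (f_test p \<alpha> \<xi> c) = 1"
    using bergman_cmult[OF X, of "inverse (of_real (N (f_hat \<xi> c)))"]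
    by (auto simp: norm_inverse eq)
qed

text \<open>One fixed approach to the critical exponent. Subtracting at most 1/p leaves c p \<ge> 1
  + \<alpha>, so all its test functions lie in the space.\<close>

definition c_seq :: "nat \<Rightarrow> real" where
  "c_seq n = (2 + \<alpha>) / p - 1 / (p * real (Suc n))"

lemma c_seq: "\<alpha> \<le> c_seq n * p" "c_seq n < (2 + \<alpha>) / p" "c_seq \<longlonglongrightarrow> (2 + \<alpha>) / p"
proof -
  have "(\<lambda>n. (2 + \<alpha>) / p - inverse p * inverse (real (Suc n))) \<longlonglongrightarrow> (2 + \<alpha>) / p - inverse p * 0"
    by (intro tendsto_intros LIMSEQ_inverse_real_of_nat)
  then show "c_seq \<longlonglongrightarrow> (2 + \<alpha>) / p" by (simp add: c_seq_def[abs_def] inverse_eq_divide)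
  show "c_seq n < (2 + \<alpha>) / p" using p by (simp add: c_seq_def)
  have "c_seq n * p = 2 + \<alpha> - 1 / real (Suc n)" unfolding c_seq_def left_diff_distrib using p by simp
  moreover have "1 / real (Suc n) \<le> 1" by simp
  ultimately show "\<alpha> \<le> c_seq n * p" by linarith
qed

text \<open>The unnormalized functions converge pointwise to finite values while their norms tend to
  infinity.\<close>

lemma f_test_null_seq:
  assumes \<xi>: "cmod \<xi> = 1" and c: "\<And>n. \<alpha> \<le> c n * p" "\<And>n. c n < (2 + \<alpha>) / p" "c \<longlonglongrightarrow> (2 + \<alpha>) / p"
  shows "null_seq (\<lambda>n. f_test p \<alpha> \<xi> (c n))"
  unfolding null_seq_def
proof (intro conjI allI exI[of _ 1])
  fix n
  show "f_test p \<alpha> \<xi> (c n) \<in> X" "N (f_test p \<alpha> \<xi> (c n)) \<le> 1"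
    using f_test_bergman[OF \<xi> c(1,2)] by auto
next
  fix z
  have "(\<lambda>n. f_hat \<xi> (c n) z) \<longlonglongrightarrow> f_hat \<xi> ((2 + \<alpha>) / p) z"
    using c(3) by (rule f_hat_tendsto)
  moreover have "(\<lambda>n. inverse (complex_of_real (N (f_hat \<xi> (c n))))) \<longlonglongrightarrow> of_real 0"
    unfolding of_real_inverse[symmetric]
    by (intro tendsto_of_real tendsto_inverse_0_at_top f_hat_norm_at_top[OF \<xi> c])
  ultimately have "(\<lambda>n. f_hat \<xi> (c n) z * inverse (complex_of_real (N (f_hat \<xi> (c n))))) \<longlonglongrightarrow> f_hat \<xi> ((2 + \<alpha>) / p) z * of_real 0"
    by (rule tendsto_mult)
  then show "(\<lambda>n. f_test p \<alpha> \<xi> (c n) z) \<longlonglongrightarrow> 0"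
    by (simp add: f_test_def divide_inverse)
qed

end

section \<open>Behaviour of a symbol at the boundary point\<close>

lemma at_boundary_nontrivial:
  fixes \<xi> :: complex
  assumes "cmod \<xi> = 1"
  shows "\<not> trivial_limit (at \<xi> within ball 0 1)"
  using assms by (simp add: trivial_limit_within islimpt_ball)

lemma boundary_nbhd:
  fixes \<xi> :: complex
  assumes "cmod \<xi> = 1" and "eventually P (at \<xi> within ball 0 1)"
  obtains \<epsilon> where "\<epsilon> > 0" "\<And>z. z \<in> ball 0 1 \<inter> ball \<xi> \<epsilon> \<Longrightarrow> P z"
proof -
  obtain d where "d > 0" "\<And>z. z \<in> ball 0 1 \<Longrightarrow> z \<noteq> \<xi> \<Longrightarrow> dist z \<xi> < d \<Longrightarrow> P z"
    using assms(2) unfolding eventually_at by blast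
  then show ?thesis using that[of d] assms(1) by (force simp: dist_commute)
qed

lemma boundary_value_tendsto:
  assumes "cmod \<xi> = 1" "extends_continuously_near \<xi> g"
  shows "(g \<longlongrightarrow> boundary_value g \<xi>) (at \<xi> within ball 0 1)"
proof -
  obtain e h where e: "e > 0" and h: "continuous_on (cball 0 1 \<inter> ball \<xi> e) h"
    and hg: "\<And>z. z \<in> ball 0 1 \<inter> ball \<xi> e \<Longrightarrow> h z = g z"
    using assms(2) by (auto simp: extends_continuously_near_def)
  have "\<xi> \<in> cball 0 1 \<inter> ball \<xi> e" using assms(1) e by simp
  then have "(h \<longlongrightarrow> h \<xi>) (at \<xi> within (cball 0 1 \<inter> ball \<xi> e))" using h by (simp add: continuous_on)
  then have "(h \<longlongrightarrow> h \<xi>) (at \<xi> within (ball 0 1 \<inter> ball \<xi> e))"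
    by (rule tendsto_within_subset) auto
  also have "at \<xi> within (ball 0 1 \<inter> ball \<xi> e) = at \<xi> within ball 0 1"
    by (rule at_within_nhd[of _ "ball \<xi> e"]) (use e in auto)
  finally have "(h \<longlongrightarrow> h \<xi>) (at \<xi> within ball 0 1)" .
  moreover have "eventually (\<lambda>z. h z = g z) (at \<xi> within ball 0 1)"
    unfolding eventually_at using e hg by (intro exI[of _ e]) (auto simp: dist_commute)
  ultimately have "(g \<longlongrightarrow> h \<xi>) (at \<xi> within ball 0 1)"
    by (rule Lim_transform_eventually)
  then show ?thesis
    unfolding boundary_value_def using tendsto_Lim[OF at_boundary_nontrivial[OF assms(1)]] by metis
qed

text \<open>One member of the family at a fixed parameter. The lower bound on the derivative comes
  from the uniform bound in admissibility and excludes a vanishing derivative at \<xi>.\<close>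

locale boundary_symbol = weighted_bergman +
  fixes \<xi> :: complex and u \<phi> :: "complex \<Rightarrow> complex"
  assumes \<xi>: "cmod \<xi> = 1"
    and \<phi>_hol: "\<phi> holomorphic_on ball 0 1" and \<phi>_ball: "\<phi> ` ball 0 1 \<subseteq> ball 0 1"
    and uX: "u \<in> bergman p \<alpha>"
    and S_bounded: "wcomp u \<phi> \<in> bounded_operators (bergman p \<alpha>) (bergman_norm p \<alpha>)"
    and \<phi>'_ext: "extends_continuously_near \<xi> (deriv \<phi>)"
    and \<phi>_lim: "(\<phi> \<longlongrightarrow> \<xi>) (at \<xi> within ball 0 1)"
    and \<phi>_away: "\<And>\<epsilon>. \<epsilon> > 0 \<Longrightarrow> closure (\<phi> ` (ball 0 1 - ball \<xi> \<epsilon>)) \<inter> sphere 0 1 = {}"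
    and u_ext: "extends_continuously_near \<xi> u"
    and \<phi>'_lower: "\<exists>m>0. \<exists>\<epsilon>>0. \<forall>z\<in>ball \<xi> \<epsilon> \<inter> ball 0 1. m \<le> cmod (deriv \<phi> z)"
begin

definition d :: real where "d = Re (boundary_value (deriv \<phi>) \<xi>)"
definition u0 :: complex where "u0 = boundary_value u \<xi>"
definition W :: real where "W = cmod u0 * d powr (- ((2 + \<alpha>) / p))"

abbreviation "S \<equiv> wcomp u \<phi>"

lemma \<xi>_conj: "cnj \<xi> * \<xi> = 1"
  using \<xi> by (simp add: complex_norm_square[symmetric] mult.commute[of "cnj \<xi>"])

lemma \<phi>_in: "z \<in> ball 0 1 \<Longrightarrow> \<phi> z \<in> ball 0 1"
  using \<phi>_ball by blast

lemma u_lim: "(u \<longlongrightarrow> u0) (at \<xi> within ball 0 1)"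
  unfolding u0_def by (rule boundary_value_tendsto[OF \<xi> u_ext])

text \<open>The mean value inequality for \<phi> minus its linear part on a convex set. The
  two-point form is what makes \<phi> expanding near \<xi>; an expansion at \<xi> alone would not
  give this.\<close>

lemma complex_linearization:
  assumes "\<delta> > 0"
  obtains \<epsilon> where "\<epsilon> > 0" "\<And>z z'. z \<in> ball 0 1 \<inter> ball \<xi> \<epsilon> \<Longrightarrow> z' \<in> ball 0 1 \<inter> ball \<xi> \<epsilon> \<Longrightarrow>
    cmod (\<phi> z - \<phi> z' - boundary_value (deriv \<phi>) \<xi> * (z - z')) \<le> \<delta> * cmod (z - z')"
proof -
  define D where "D = boundary_value (deriv \<phi>) \<xi>"
  have "eventually (\<lambda>z. dist (deriv \<phi> z) D < \<delta>) (at \<xi> within ball 0 1)"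
    unfolding D_def by (rule tendstoD[OF boundary_value_tendsto[OF \<xi> \<phi>'_ext] assms])
  then obtain \<epsilon> where \<epsilon>: "\<epsilon> > 0" "\<And>z. z \<in> ball 0 1 \<inter> ball \<xi> \<epsilon> \<Longrightarrow> dist (deriv \<phi> z) D < \<delta>"
    using boundary_nbhd[OF \<xi>] by blast
  have "cmod (\<phi> z - \<phi> z' - D * (z - z')) \<le> \<delta> * cmod (z - z')"
    if z: "z \<in> ball 0 1 \<inter> ball \<xi> \<epsilon>" "z' \<in> ball 0 1 \<inter> ball \<xi> \<epsilon>" for z z'
  proof -
    have "norm ((\<phi> z - D * z) - (\<phi> z' - D * z')) \<le> \<delta> * norm (z - z')"
    proof (rule field_differentiable_bound[where f' = "\<lambda>z. deriv \<phi> z - D" and S = "ball 0 1 \<inter> ball \<xi> \<epsilon>"])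
      show "convex (ball 0 1 \<inter> ball \<xi> \<epsilon>)" by (intro convex_Int convex_ball)
      fix w assume w: "w \<in> ball 0 1 \<inter> ball \<xi> \<epsilon>"
      have "(\<phi> has_field_derivative deriv \<phi> w) (at w)"
        using w by (intro holomorphic_derivI[OF \<phi>_hol]) auto
      then have "((\<lambda>z. \<phi> z - D * z) has_field_derivative deriv \<phi> w - D) (at w)"
        by (auto intro!: derivative_eq_intros)
      then show "((\<lambda>z. \<phi> z - D * z) has_field_derivative deriv \<phi> w - D) (at w within ball 0 1 \<inter> ball \<xi> \<epsilon>)"
        by (rule has_field_derivative_at_within)
      show "cmod (deriv \<phi> w - D) \<le> \<delta>" using \<epsilon>(2)[OF w] by (simp add: dist_norm)
    qed (use z in auto)
    then show ?thesis by (simp add: algebra_simps)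
  qed
  then show ?thesis using that[OF \<epsilon>(1)] unfolding D_def by blast
qed

text \<open>The limit of the two-point estimate as one point tends to \<xi>, where \<phi> tends to
  \<xi> as well.\<close>

lemma complex_angular_derivative:
  assumes "\<delta> > 0"
  obtains \<epsilon> where "\<epsilon> > 0" "\<And>z. z \<in> ball 0 1 \<inter> ball \<xi> \<epsilon> \<Longrightarrow>
    cmod (\<xi> - \<phi> z - boundary_value (deriv \<phi>) \<xi> * (\<xi> - z)) \<le> \<delta> * cmod (\<xi> - z)"
proof -
  obtain \<epsilon> where \<epsilon>: "\<epsilon> > 0" "\<And>z z'. z \<in> ball 0 1 \<inter> ball \<xi> \<epsilon> \<Longrightarrow> z' \<in> ball 0 1 \<inter> ball \<xi> \<epsilon> \<Longrightarrow>
    cmod (\<phi> z - \<phi> z' - boundary_value (deriv \<phi>) \<xi> * (z - z')) \<le> \<delta> * cmod (z - z')"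
    using complex_linearization[OF assms] by blast
  have "cmod (\<xi> - \<phi> z - boundary_value (deriv \<phi>) \<xi> * (\<xi> - z)) \<le> \<delta> * cmod (\<xi> - z)"
    if z: "z \<in> ball 0 1 \<inter> ball \<xi> \<epsilon>" for z
  proof (rule tendsto_le[OF at_boundary_nontrivial[OF \<xi>]])
    show "((\<lambda>z'. cmod (\<phi> z' - \<phi> z - boundary_value (deriv \<phi>) \<xi> * (z' - z))) \<longlongrightarrow>
       cmod (\<xi> - \<phi> z - boundary_value (deriv \<phi>) \<xi> * (\<xi> - z))) (at \<xi> within ball 0 1)"
      by (intro tendsto_intros \<phi>_lim)
    show "((\<lambda>z'. \<delta> * cmod (z' - z)) \<longlongrightarrow> \<delta> * cmod (\<xi> - z)) (at \<xi> within ball 0 1)"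
      by (intro tendsto_intros)
    show "eventually (\<lambda>z'. cmod (\<phi> z' - \<phi> z - boundary_value (deriv \<phi>) \<xi> * (z' - z)) \<le> \<delta> * cmod (z' - z)) (at \<xi> within ball 0 1)"
      unfolding eventually_at using \<epsilon> z by (intro exI[of _ \<epsilon>]) (auto simp: dist_commute)
  qed
  then show ?thesis using that[OF \<epsilon>(1)] by blast
qed

text \<open>\<phi> stays in the half plane supporting the disc at \<xi>. Entering the disc from
  \<xi> in the direction -\<xi> \<tau> with Re \<tau> > 0 moves \<phi> approximately in the
  direction -\<xi> D \<tau>, so Re (D \<tau>) cannot be negative. As this holds for all such \<tau>,
  D is real and nonnegative.\<close>

lemma angular_derivative_real: "boundary_value (deriv \<phi>) \<xi> = of_real d" and d_pos: "d > 0"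
proof -
  define D where "D = boundary_value (deriv \<phi>) \<xi>"
  have Re_nonneg: "Re (D * \<tau>) \<ge> 0" if \<tau>: "Re \<tau> > 0" for \<tau>
  proof (rule ccontr)
    assume "\<not> Re (D * \<tau>) \<ge> 0"
    then have neg: "Re (D * \<tau>) < 0" by simp
    have \<tau>0: "cmod \<tau> > 0" using \<tau> by auto
    \<comment> \<open>With this \<delta> the linearization error is at most half of the negative
      main term and cannot compensate it.\<close>
    define \<delta> where "\<delta> = - Re (D * \<tau>) / (2 * cmod \<tau>)"
    have \<delta>: "\<delta> > 0" using neg \<tau>0 by (simp add: \<delta>_def)
    obtain \<epsilon> where \<epsilon>: "\<epsilon> > 0" "\<And>z. z \<in> ball 0 1 \<inter> ball \<xi> \<epsilon> \<Longrightarrow> cmod (\<xi> - \<phi> z - D * (\<xi> - z)) \<le> \<delta> * cmod (\<xi> - z)"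
      using complex_angular_derivative[OF \<delta>] unfolding D_def by blast
    \<comment> \<open>The first bound keeps \<open>z\<close> in the unit disc, since |1 - s
      \<tau>|^2 = 1 - 2 s Re \<tau> + s^2 |\<tau>|^2; the second keeps it within \<epsilon> of
      \<xi>.\<close>
    define s where "s = min (Re \<tau> / (cmod \<tau>)\<^sup>2) (\<epsilon> / (2 * cmod \<tau>))"
    have s: "s > 0" "s \<le> Re \<tau> / (cmod \<tau>)\<^sup>2" "s \<le> \<epsilon> / (2 * cmod \<tau>)"
      using \<tau> \<tau>0 \<epsilon> by (auto simp: s_def)
    define z where "z = \<xi> * (1 - of_real s * \<tau>)"
    have xz: "\<xi> - z = \<xi> * (of_real s * \<tau>)" by (simp add: z_def algebra_simps)
    have nxz: "cmod (\<xi> - z) = s * cmod \<tau>" unfolding xz using s \<xi> by (simp add: norm_mult)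
    have "s * (cmod \<tau>)\<^sup>2 \<le> Re \<tau>" using s(2) \<tau>0 by (simp add: field_simps)
    then have "s * (s * (cmod \<tau>)\<^sup>2) < 2 * s * Re \<tau>" using s(1) \<tau> by simp
    moreover have "(cmod (1 - of_real s * \<tau>))\<^sup>2 = 1 - 2 * s * Re \<tau> + s * (s * (cmod \<tau>)\<^sup>2)"
      unfolding cmod_power2 by (simp add: power2_eq_square algebra_simps)
    ultimately have "(cmod (1 - of_real s * \<tau>))\<^sup>2 < 1" by simp
    then have "cmod z < 1" using \<xi> by (simp add: z_def norm_mult abs_square_less_1)
    moreover have "s * cmod \<tau> < \<epsilon>"
    proof -
      have "s * cmod \<tau> \<le> \<epsilon> / (2 * cmod \<tau>) * cmod \<tau>" using s \<tau>0 by (intro mult_right_mono) auto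
      then show ?thesis using \<tau>0 \<epsilon> by simp
    qed
    ultimately have z: "z \<in> ball 0 1 \<inter> ball \<xi> \<epsilon>" using nxz by (simp add: dist_norm)
    have "Re (cnj \<xi> * \<phi> z) \<le> cmod (cnj \<xi> * \<phi> z)" by (rule complex_Re_le_cmod)
    also have "\<dots> < 1" using \<phi>_in[of z] z \<xi> by (simp add: norm_mult)
    finally have pos: "Re (cnj \<xi> * (\<xi> - \<phi> z)) > 0" by (simp add: right_diff_distrib \<xi>_conj)
    have eq: "cnj \<xi> * (D * (\<xi> - z)) = of_real s * (D * \<tau>)"
    proof -
      have "cnj \<xi> * (D * (\<xi> - z)) = (cnj \<xi> * \<xi>) * (of_real s * (D * \<tau>))" by (simp add: xz)
      then show ?thesis by (simp add: \<xi>_conj)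
    qed
    have "cnj \<xi> * (\<xi> - \<phi> z - D * (\<xi> - z)) = cnj \<xi> * (\<xi> - \<phi> z) - of_real s * (D * \<tau>)"
      by (simp only: right_diff_distrib[of "cnj \<xi>" _ "D * (\<xi> - z)"] eq)
    then have "Re (cnj \<xi> * (\<xi> - \<phi> z)) - s * Re (D * \<tau>) = Re (cnj \<xi> * (\<xi> - \<phi> z - D * (\<xi> - z)))"
      by simp
    also have "\<dots> \<le> cmod (cnj \<xi> * (\<xi> - \<phi> z - D * (\<xi> - z)))" by (rule complex_Re_le_cmod)
    also have "\<dots> \<le> \<delta> * (s * cmod \<tau>)" using \<epsilon>(2)[OF z] \<xi> nxz by (simp add: norm_mult)
    also have "\<dots> = - s * Re (D * \<tau>) / 2" using \<tau>0 by (simp add: \<delta>_def field_simps)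
    finally have "- s * Re (D * \<tau>) \<le> - s * Re (D * \<tau>) / 2" using pos by simp
    moreover have "- s * Re (D * \<tau>) > 0" using s neg by (simp add: mult_pos_neg)
    ultimately show False by simp
  qed
  have Im0: "Im D = 0"
  proof (rule ccontr)
    assume "Im D \<noteq> 0"
    \<comment> \<open>This direction has real part 1 and yields the real part Re D - |Re D| -
      1.\<close>
    then have "Re (D * Complex 1 ((\<bar>Re D\<bar> + 1) / Im D)) < 0" by (simp add: abs_if)
    with Re_nonneg[of "Complex 1 ((\<bar>Re D\<bar> + 1) / Im D)"] show False by simp
  qed
  then show D: "boundary_value (deriv \<phi>) \<xi> = of_real d"
    by (simp add: d_def D_def complex_eq_iff)
  obtain m \<epsilon> where m: "m > 0" "\<epsilon> > 0" "\<And>z. z \<in> ball \<xi> \<epsilon> \<inter> ball 0 1 \<Longrightarrow> m \<le> cmod (deriv \<phi> z)"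
    using \<phi>'_lower by blast
  have "m \<le> cmod D"
  proof (rule tendsto_lowerbound[OF _ _ at_boundary_nontrivial[OF \<xi>]])
    show "((\<lambda>z. cmod (deriv \<phi> z)) \<longlongrightarrow> cmod D) (at \<xi> within ball 0 1)"
      unfolding D_def by (intro tendsto_norm boundary_value_tendsto \<xi> \<phi>'_ext)
    show "eventually (\<lambda>z. m \<le> cmod (deriv \<phi> z)) (at \<xi> within ball 0 1)"
      unfolding eventually_at using m by (intro exI[of _ \<epsilon>]) (auto simp: dist_commute)
  qed
  then have "d \<noteq> 0" using m D by (auto simp: D_def)
  moreover have "d \<ge> 0" using Re_nonneg[of 1] by (simp add: D_def d_def)
  ultimately show "d > 0" by simp
qed

lemmas linearization = complex_linearization[unfolded angular_derivative_real]
lemmas angular_derivative = complex_angular_derivative[unfolded angular_derivative_real]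

text \<open>
  Julia's lower bound. Comparing \<open>z\<close> with the points \<open>s z / |z|\<close> for \<open>s\<close> close to \<open>1\<close> on the
  same radius, where \<open>|\<phi>| < 1\<close>, avoids the Schwarz--Pick lemma.
\<close>

lemma boundary_distance_ratio:
  assumes "\<delta> > 0" "\<delta> < d"
  obtains \<epsilon> where "\<epsilon> > 0" "\<And>z. z \<in> ball 0 1 \<inter> ball \<xi> \<epsilon> \<Longrightarrow>
    (d - \<delta>) * (1 - (cmod z)\<^sup>2) \<le> 1 - (cmod (\<phi> z))\<^sup>2"
proof -
  \<comment> \<open>The loss \<delta> is shared among several errors; the deviation of the direction
    of \<phi> from \<zeta> costs 2 d \<eta> = \<delta> / 4.\<close>
  define \<eta> where "\<eta> = \<delta> / (8 * d)"
  have \<eta>: "\<eta> > 0" using assms d_pos by (simp add: \<eta>_def)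
  have "\<delta> / 4 > 0" using assms by simp
  then obtain e1 where e1: "e1 > 0" "\<And>z z'. z \<in> ball 0 1 \<inter> ball \<xi> e1 \<Longrightarrow> z' \<in> ball 0 1 \<inter> ball \<xi> e1 \<Longrightarrow>
    cmod (\<phi> z - \<phi> z' - of_real d * (z - z')) \<le> \<delta> / 4 * cmod (z - z')"
    using linearization by blast
  obtain e2 where e2: "e2 > 0" "\<And>z. z \<in> ball 0 1 \<inter> ball \<xi> e2 \<Longrightarrow> dist (\<phi> z) \<xi> < \<eta>"
    using boundary_nbhd[OF \<xi> tendstoD[OF \<phi>_lim \<eta>]] by blast
  \<comment> \<open>The comparison point \<open>y\<close> satisfies |\<xi> - y| < 2 \<epsilon>,
    hence the halves of \<open>e1\<close> and \<open>e2\<close>. The bound \<eta> / 2 controls the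
    direction of \<phi> y, \<delta> / (8 d^2) the quadratic term in the expansion, and 1/2 keeps
    \<open>z\<close> away from 0.\<close>
  define \<epsilon> where "\<epsilon> = min (min (e1 / 2) (e2 / 2)) (min (\<eta> / 2) (min (\<delta> / (8 * d\<^sup>2)) (1 / 2)))"
  have "\<delta> / (8 * d\<^sup>2) > 0" using assms d_pos by simp
  have \<epsilon>: "\<epsilon> > 0" "\<epsilon> \<le> e1 / 2" "\<epsilon> \<le> e2 / 2" "\<epsilon> \<le> \<eta> / 2" "\<epsilon> \<le> \<delta> / (8 * d\<^sup>2)" "\<epsilon> \<le> 1 / 2"
    unfolding \<epsilon>_def using e1(1) e2(1) \<eta> \<open>\<delta> / (8 * d\<^sup>2) > 0\<close> by (simp_all only: min_less_iff_conj min_le_iff_disj) auto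
  have "(d - \<delta>) * (1 - (cmod z)\<^sup>2) \<le> 1 - (cmod (\<phi> z))\<^sup>2" if z: "z \<in> ball 0 1 \<inter> ball \<xi> \<epsilon>" for z
  proof -
    have dz: "cmod (\<xi> - z) < \<epsilon>" "cmod z < 1" using z by (auto simp: dist_norm)
    have z1: "1 - cmod z \<le> cmod (\<xi> - z)" using norm_triangle_ineq2[of \<xi> z] \<xi> by simp
    then have z0: "cmod z > 0" using dz \<epsilon> by linarith
    define \<zeta> where "\<zeta> = z / of_real (cmod z)"
    have \<zeta>: "cmod \<zeta> = 1" "z = of_real (cmod z) * \<zeta>" using z0 by (auto simp: \<zeta>_def norm_divide)
    have \<zeta>z: "of_real s * \<zeta> - z = of_real (s - cmod z) * \<zeta>" for s
      by (metis \<zeta>(2) left_diff_distrib of_real_diff)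
    have \<zeta>\<xi>: "cmod (\<zeta> - \<xi>) \<le> 2 * cmod (\<xi> - z)"
    proof -
      have "\<zeta> - z = of_real (1 - cmod z) * \<zeta>" using \<zeta>z[of 1] by simp
      then have "cmod (\<zeta> - z) = 1 - cmod z" using \<zeta>(1) dz by (simp add: norm_mult del: of_real_diff)
      then show ?thesis using norm_triangle_ineq4[of "\<zeta> - z" "\<xi> - z"] z1 by (simp add: norm_minus_commute)
    qed
    \<comment> \<open>Write \<phi> z = a - b with \<open>a = \<phi> y\<close> of modulus below 1 and
      \<open>b\<close> close to d r \<zeta>. Then |\<phi> z|^2 \<le> 1 - 2 Re (cnj a b) + |b|^2,
      where the middle term is about 2 d r and the last one is of order r^2.\<close>
    have main: "2 * (s - cmod z) * (d - \<delta>) \<le> 1 - (cmod (\<phi> z))\<^sup>2" if s: "cmod z < s" "s < 1" for s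
    proof -
      define y where "y = of_real s * \<zeta>"
      define r where "r = s - cmod z"
      have r: "0 < r" "r < \<epsilon>" using s z1 dz by (auto simp: r_def)
      have yz: "y - z = of_real r * \<zeta>" unfolding y_def r_def by (rule \<zeta>z)
      have nyz: "cmod (y - z) = r" unfolding yz using r \<zeta> by (simp add: norm_mult)
      have "s > 0" using s z0 by linarith
      then have ny: "cmod y = s" using \<zeta>(1) by (simp add: y_def norm_mult)
      have "cmod (\<xi> - y) < 2 * \<epsilon>" using norm_triangle_ineq4[of "\<xi> - z" "y - z"] nyz r dz by simp
      then have y: "y \<in> ball 0 1 \<inter> ball \<xi> e1" "y \<in> ball 0 1 \<inter> ball \<xi> e2" using ny s \<epsilon> by (auto simp: dist_norm)
      have z': "z \<in> ball 0 1 \<inter> ball \<xi> e1" using z \<epsilon> e1 by (auto simp: dist_norm)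
      define a where "a = \<phi> y"
      define b where "b = a - \<phi> z"
      have a1: "cmod a < 1" unfolding a_def using \<phi>_in[of y] y by simp
      have be: "cmod (b - of_real (d * r) * \<zeta>) \<le> \<delta> / 4 * r"
        using e1(2)[OF y(1) z'] nyz unfolding yz b_def a_def by (simp add: mult.assoc)
      have bn: "cmod b \<le> 2 * d * r"
      proof -
        have "cmod b \<le> cmod (b - of_real (d * r) * \<zeta>) + cmod (of_real (d * r) * \<zeta>)"
          using norm_triangle_ineq[of "b - of_real (d * r) * \<zeta>" "of_real (d * r) * \<zeta>"] by simp
        also have "cmod (of_real (d * r) * \<zeta>) = d * r"
          unfolding norm_mult norm_of_real using \<zeta> d_pos r by simp
        also have "cmod (b - of_real (d * r) * \<zeta>) \<le> d * r"
        proof -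
          have "\<delta> / 4 * r \<le> d * r" using r assms by (intro mult_right_mono) auto
          with be show ?thesis by linarith
        qed
        finally show ?thesis by (simp add: mult_ac)
      qed
      have a\<zeta>: "Re (cnj a * \<zeta>) \<ge> 1 - 2 * \<eta>"
      proof -
        have "cmod (\<zeta> - a) \<le> cmod (\<zeta> - \<xi>) + cmod (\<xi> - a)" using norm_triangle_ineq[of "\<zeta> - \<xi>" "\<xi> - a"] by simp
        also have "\<dots> \<le> 2 * \<epsilon> + \<eta>"
          using \<zeta>\<xi> dz e2(2)[OF y(2)] by (simp add: a_def dist_norm norm_minus_commute)
        also have "\<dots> \<le> 2 * \<eta>" using \<epsilon> by simp
        finally have "cmod (cnj (\<zeta> - a) * \<zeta>) \<le> 2 * \<eta>" using \<zeta> unfolding norm_mult complex_mod_cnj by simp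
        then have "Re (cnj (\<zeta> - a) * \<zeta>) \<le> 2 * \<eta>" using complex_Re_le_cmod order_trans by blast
        moreover have "cnj \<zeta> * \<zeta> = 1" using \<zeta>(1) by (simp add: complex_norm_square[symmetric] mult.commute[of "cnj \<zeta>"])
        ultimately show ?thesis by (simp add: left_diff_distrib)
      qed
      have "Re (cnj a * b) = d * r * Re (cnj a * \<zeta>) + Re (cnj a * (b - of_real (d * r) * \<zeta>))"
        by (simp add: algebra_simps)
      moreover have "- (\<delta> / 4 * r) \<le> Re (cnj a * (b - of_real (d * r) * \<zeta>))"
      proof -
        have "cmod (cnj a * (b - of_real (d * r) * \<zeta>)) \<le> 1 * (\<delta> / 4 * r)"
          unfolding norm_mult complex_mod_cnj using a1 be by (intro mult_mono) auto
        then show ?thesis using abs_Re_le_cmod[of "cnj a * (b - of_real (d * r) * \<zeta>)"] by linarith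
      qed
      moreover have "d * r * Re (cnj a * \<zeta>) \<ge> d * r * (1 - 2 * \<eta>)"
        using a\<zeta> d_pos r by (intro mult_left_mono) auto
      moreover have "d * r * (1 - 2 * \<eta>) = d * r - \<delta> / 4 * r"
        using d_pos by (simp add: \<eta>_def field_simps)
      ultimately have ab: "Re (cnj a * b) \<ge> d * r - \<delta> / 2 * r" by simp
      have "(cmod b)\<^sup>2 \<le> (2 * d * r)\<^sup>2" using bn by (intro power_mono) auto
      also have "\<dots> = 4 * d\<^sup>2 * r * r" by (simp add: power2_eq_square)
      also have "\<dots> \<le> 4 * d\<^sup>2 * r * (\<delta> / (8 * d\<^sup>2))" using r \<epsilon> by (intro mult_left_mono) auto
      also have "\<dots> = \<delta> / 2 * r" using d_pos by (simp add: field_simps)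
      finally have bb: "(cmod b)\<^sup>2 \<le> \<delta> / 2 * r" .
      have "(cmod (a - b))\<^sup>2 = (cmod a)\<^sup>2 - 2 * Re (cnj a * b) + (cmod b)\<^sup>2"
        unfolding cmod_power2 by (simp add: power2_eq_square algebra_simps)
      moreover have "a - b = \<phi> z" by (simp add: b_def)
      moreover have "(cmod a)\<^sup>2 \<le> 1" using a1 by (simp add: power_le_one)
      ultimately have "(cmod (\<phi> z))\<^sup>2 \<le> 1 - 2 * (d * r - \<delta> / 2 * r) + \<delta> / 2 * r" using ab bb by simp
      moreover have "2 * r * (d - \<delta>) \<le> 2 * (d * r - \<delta> / 2 * r) - \<delta> / 2 * r"
        using assms r by (simp add: algebra_simps)
      ultimately show ?thesis by (simp add: r_def)
    qed
    \<comment> \<open>The inequality solved for \<open>s\<close>: it says \<open>s \<le> Q\<close>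
      for every s below 1, and letting s tend to 1 gives 1 \<le> Q.\<close>
    define Q where "Q = (1 - (cmod (\<phi> z))\<^sup>2) / (2 * (d - \<delta>)) + cmod z"
    have "1 \<le> Q"
    proof (rule dense_le_bounded[OF dz(2)])
      fix s assume s: "cmod z < s" "s < 1"
      from main[OF s] show "s \<le> Q" using assms by (simp add: Q_def field_simps)
    qed
    then have "2 * (1 - cmod z) * (d - \<delta>) \<le> 1 - (cmod (\<phi> z))\<^sup>2"
      using assms by (simp add: Q_def field_simps)
    moreover have "1 - (cmod z)\<^sup>2 \<le> 2 * (1 - cmod z)"
      using zero_le_power2[of "1 - cmod z"] by (simp add: power2_diff)
    then have "(d - \<delta>) * (1 - (cmod z)\<^sup>2) \<le> (d - \<delta>) * (2 * (1 - cmod z))"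
      using assms by (intro mult_left_mono) auto
    ultimately show ?thesis by (simp add: mult_ac)
  qed
  then show ?thesis using that[OF \<epsilon>(1)] by blast
qed

lemma range_away:
  assumes "\<epsilon> > 0"
  obtains \<rho> where "\<rho> < 1" "\<And>z. z \<in> ball 0 1 - ball \<xi> \<epsilon> \<Longrightarrow> cmod (\<phi> z) \<le> \<rho>"
proof -
  define K where "K = closure (\<phi> ` (ball 0 1 - ball \<xi> \<epsilon>))"
  have K1: "K \<subseteq> cball 0 1"
    unfolding K_def
  proof (intro closure_minimal image_subsetI)
    fix z assume "z \<in> ball 0 1 - ball \<xi> \<epsilon>"
    then have "\<phi> z \<in> ball 0 1" using \<phi>_in[of z] by simp
    then show "\<phi> z \<in> cball 0 1" by simp
  qed simp
  have K: "compact K"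
    using K1 bounded_subset[OF bounded_cball] by (auto simp: compact_eq_bounded_closed K_def)
  have K2: "cmod w < 1" if "w \<in> K" for w
  proof -
    have "K \<inter> sphere 0 1 = {}" using \<phi>_away[OF assms] by (simp only: K_def)
    then have "w \<notin> sphere 0 1" "w \<in> cball 0 1" using that K1 by auto
    then show ?thesis by simp
  qed
  have sub: "\<phi> z \<in> K" if "z \<in> ball 0 1 - ball \<xi> \<epsilon>" for z
    unfolding K_def by (rule subsetD[OF closure_subset]) (rule imageI[OF that])
  show ?thesis
  proof (cases "K = {}")
    case True
    then show ?thesis using that[of 0] sub by auto
  next
    case False
    then obtain w where "w \<in> K" "\<And>v. v \<in> K \<Longrightarrow> cmod v \<le> cmod w"
      using continuous_attains_sup[OF K, of cmod] by (auto intro: continuous_intros)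
    then show ?thesis using that[of "cmod w"] K2 sub by blast
  qed
qed

end

section \<open>Estimates for a single weighted composition operator\<close>

context weighted_bergman begin

text \<open>Pieces cut out by an indicator are in general not holomorphic; they have bounds in the
  sense of \<open>lp_bound\<close> without belonging to \<open>X\<close>. This is how estimates near
  \<xi> and away from \<xi> are reassembled.\<close>

lemma norm_split:
  assumes "f \<in> X" "bounded_by (\<lambda>z. indicator A z * f z) a" "bounded_by (\<lambda>z. indicator (- A) z * f z) b"
  shows "N f \<le> a + b"
proof -
  have "bounded_by (\<lambda>z. indicator A z * f z + indicator (- A) z * f z) (a + b)"
    by (rule lp_bound_add[OF p assms(2,3)])
  also have "(\<lambda>z. indicator A z * f z + indicator (- A) z * f z) = f"
    by (auto simp: indicator_def fun_eq_iff)
  finally show ?thesis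
    using assms(1) N_le_iff[of f "a + b"] by (auto simp: lp_bound_def)
qed

lemma bounded_by_indicator:
  assumes g: "g \<in> X" and A: "A \<in> sets borel" and f: "f \<in> borel_measurable borel"
    and le: "\<And>z. z \<in> A \<Longrightarrow> z \<in> ball 0 1 \<Longrightarrow> cmod (f z) \<le> c * cmod (g z)" and c: "c \<ge> 0"
  shows "bounded_by (\<lambda>z. indicator A z * f z) (c * N g)"
proof -
  note [measurable] = A f
  have cg: "bounded_by (\<lambda>z. of_real c * g z) (c * N g)"
    using lp_bound_cmult[OF bergman_lp[OF g], of "of_real c"] p c by simp
  show ?thesis
  proof (rule lp_bound_le[OF cg])
    show "(\<lambda>z. indicator A z * f z) \<in> borel_measurable \<mu>" by simp measurable
    show "AE z in \<mu>. cmod (indicator A z * f z) \<le> cmod (of_real c * g z)"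
      using AE_dA by eventually_elim (use le c in \<open>auto simp: indicator_def norm_mult\<close>)
  qed (use p in auto)
qed

lemma N_tendsto_0I:
  assumes "\<And>e. e > 0 \<Longrightarrow> eventually (\<lambda>k. N (f k) \<le> e) sequentially"
  shows "(\<lambda>k. N (f k)) \<longlonglongrightarrow> 0"
proof (rule tendstoI)
  fix e :: real assume "e > 0"
  then have "eventually (\<lambda>k. N (f k) \<le> e / 2) sequentially" by (intro assms) simp
  then show "eventually (\<lambda>k. dist (N (f k)) 0 < e) sequentially"
    by eventually_elim (use \<open>e > 0\<close> in \<open>simp add: dist_norm\<close>)
qed

end

context boundary_symbol begin

lemma SX: "f \<in> X \<Longrightarrow> S f \<in> X"
  by (rule bounded_operatorD(1)[OF S_bounded])

lemma u_measurable[measurable]: "u \<in> borel_measurable borel"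
  by (rule bergman_measurable[OF uX])

lemma \<phi>_continuous: "continuous_on (ball 0 1) \<phi>"
  by (rule holomorphic_on_imp_continuous_on[OF \<phi>_hol])

lemma S_measurable: "f \<in> X \<Longrightarrow> (\<lambda>z. u z * f (\<phi> z)) \<in> borel_measurable borel"
  using bergman_measurable[OF SX] by (simp add: wcomp_def)

text \<open>Near \<xi> the symbol enlarges both distances and 1 - |z|^2 by a factor at least d -
  \<delta>. With L = 1 / (d - \<delta>) the change of variables costs L^2 and the weight L^\<alpha>;
  with |u| \<le> K the total factor K^p L^(2 + \<alpha>) is close to
  \<open>W powr p\<close>.\<close>

lemma local_composition_bound:
  assumes "e > 0"
  obtains \<epsilon> where "\<epsilon> > 0" "\<And>f. f \<in> X \<Longrightarrow> bounded_by (\<lambda>z. indicator (ball \<xi> \<epsilon>) z * S f z) ((W + e) * N f)"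
proof -
  define q where "q = (2 + \<alpha>) / p"
  \<comment> \<open>Continuity at \<delta> = 0 determines how precise the linearization must be for
    the final constant to stay below \<open>W + e\<close>.\<close>
  have "((\<lambda>\<delta>. (cmod u0 + \<delta>) * (d - \<delta>) powr (- q)) \<longlongrightarrow> (cmod u0 + 0) * (d - 0) powr (- q)) (at_right 0)"
    using d_pos by (intro tendsto_intros) auto
  then have "((\<lambda>\<delta>. (cmod u0 + \<delta>) * (d - \<delta>) powr (- q)) \<longlongrightarrow> W) (at_right 0)" by (simp add: W_def q_def)
  then have "eventually (\<lambda>\<delta>. (cmod u0 + \<delta>) * (d - \<delta>) powr (- q) < W + e) (at_right 0)"
    by (rule order_tendstoD(2)) (use assms in auto)
  moreover have "eventually (\<lambda>\<delta>. \<delta> \<in> {0<..<d}) (at_right 0)"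
    using d_pos by (rule eventually_at_right_real)
  ultimately have "eventually (\<lambda>\<delta>. (cmod u0 + \<delta>) * (d - \<delta>) powr (- q) < W + e \<and> \<delta> \<in> {0<..<d}) (at_right 0)"
    by (rule eventually_conj)
  then obtain \<delta> where \<delta>: "(cmod u0 + \<delta>) * (d - \<delta>) powr (- q) < W + e" "0 < \<delta>" "\<delta> < d"
    using eventually_happens'[OF trivial_limit_at_right_real] by auto
  define K where "K = cmod u0 + \<delta>"
  define L where "L = 1 / (d - \<delta>)"
  have K: "K > 0" using \<delta> by (simp add: K_def add_nonneg_pos)
  have L: "L > 0" using \<delta> by (simp add: L_def)
  obtain e1 where e1: "e1 > 0" "\<And>z z'. z \<in> ball 0 1 \<inter> ball \<xi> e1 \<Longrightarrow> z' \<in> ball 0 1 \<inter> ball \<xi> e1 \<Longrightarrow>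
    cmod (\<phi> z - \<phi> z' - of_real d * (z - z')) \<le> \<delta> * cmod (z - z')"
    using linearization[OF \<delta>(2)] by blast
  obtain e2 where e2: "e2 > 0" "\<And>z. z \<in> ball 0 1 \<inter> ball \<xi> e2 \<Longrightarrow> (d - \<delta>) * (1 - (cmod z)\<^sup>2) \<le> 1 - (cmod (\<phi> z))\<^sup>2"
    using boundary_distance_ratio[OF \<delta>(2,3)] by blast
  obtain e3 where e3: "e3 > 0" "\<And>z. z \<in> ball 0 1 \<inter> ball \<xi> e3 \<Longrightarrow> dist (u z) u0 < \<delta>"
    using boundary_nbhd[OF \<xi> tendstoD[OF u_lim \<delta>(2)]] by blast
  define \<epsilon> where "\<epsilon> = min e1 (min e2 e3)"
  have \<epsilon>: "\<epsilon> > 0" "\<epsilon> \<le> e1" "\<epsilon> \<le> e2" "\<epsilon> \<le> e3" using e1(1) e2(1) e3(1) by (auto simp: \<epsilon>_def)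
  define A where "A = ball 0 1 \<inter> ball \<xi> \<epsilon>"
  have A: "open A" "continuous_on A \<phi>"
    unfolding A_def by (auto intro: continuous_on_subset[OF \<phi>_continuous])
  have expand: "dist z z' \<le> L * dist (\<phi> z) (\<phi> z')" if z: "z \<in> A" "z' \<in> A" for z z'
  proof -
    have "cmod (of_real d * (z - z')) \<le> cmod (\<phi> z - \<phi> z') + cmod (\<phi> z - \<phi> z' - of_real d * (z - z'))"
      using norm_triangle_ineq4[of "\<phi> z - \<phi> z'" "\<phi> z - \<phi> z' - of_real d * (z - z')"] by simp
    also have "\<dots> \<le> cmod (\<phi> z - \<phi> z') + \<delta> * cmod (z - z')"
      using z \<epsilon> by (intro add_left_mono e1) (auto simp: A_def)
    also have "cmod (of_real d * (z - z')) = d * cmod (z - z')" using d_pos by (simp add: norm_mult)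
    finally show ?thesis using \<delta> by (simp add: dist_norm L_def field_simps)
  qed
  have wt: "weight z \<le> L powr \<alpha> * weight (\<phi> z)" if z: "z \<in> A" for z
  proof -
    have zb: "z \<in> ball 0 1" "\<phi> z \<in> ball 0 1" using z \<phi>_in by (auto simp: A_def)
    have "(d - \<delta>) * (1 - (cmod z)\<^sup>2) \<le> 1 - (cmod (\<phi> z))\<^sup>2" using z \<epsilon> by (intro e2) (auto simp: A_def)
    then have "1 - (cmod z)\<^sup>2 \<le> L * (1 - (cmod (\<phi> z))\<^sup>2)" using \<delta> by (simp add: L_def field_simps)
    then have "(1 - (cmod z)\<^sup>2) powr \<alpha> \<le> (L * (1 - (cmod (\<phi> z))\<^sup>2)) powr \<alpha>"
      using zb \<alpha> by (intro powr_mono2) (auto simp: power_le_one)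
    also have "\<dots> = L powr \<alpha> * (1 - (cmod (\<phi> z))\<^sup>2) powr \<alpha>"
      using L zb by (intro powr_mult)
    finally have "(1 + \<alpha>) / pi * (1 - (cmod z)\<^sup>2) powr \<alpha> \<le> (1 + \<alpha>) / pi * (L powr \<alpha> * (1 - (cmod (\<phi> z))\<^sup>2) powr \<alpha>)"
      using \<alpha> by (intro mult_left_mono) auto
    then show ?thesis using zb by (simp add: weight_def mult_ac)
  qed
  have uK: "cmod (u z) \<le> K" if z: "z \<in> A" for z
  proof -
    have "dist (u z) u0 < \<delta>" using z \<epsilon> by (intro e3) (auto simp: A_def)
    then show ?thesis using norm_triangle_ineq2[of "u z" u0] by (simp add: K_def dist_norm)
  qed
  have Am: "A \<in> sets borel" "ball \<xi> \<epsilon> \<in> sets borel" using A by auto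
  have main: "bounded_by (\<lambda>z. indicator (ball \<xi> \<epsilon>) z * S f z) ((W + e) * N f)" if f: "f \<in> X" for f
  proof -
    note [measurable] = bergman_measurable[OF f] S_measurable[OF f] bergman_measurable[OF SX[OF f]] Am(2)
    have m: "(\<lambda>z. indicator (ball \<xi> \<epsilon>) z * S f z) \<in> borel_measurable borel"
      unfolding wcomp_def using Am(2) by measurable
    define F where "F w = ennreal (weight w) * ennreal (cmod (f w) powr p)" for w
    have [measurable]: "F \<in> borel_measurable borel" unfolding F_def by measurable
    define C where "C = K powr p * L powr \<alpha>"
    have C: "C \<ge> 0" by (simp add: C_def)
    have "(\<integral>\<^sup>+z. ennreal (cmod (indicator (ball \<xi> \<epsilon>) z * S f z) powr p) \<partial>\<mu>)
      = (\<integral>\<^sup>+z. ennreal (weight z) * ennreal (cmod (indicator (ball \<xi> \<epsilon>) z * S f z) powr p) \<partial>lborel)"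
      using m by (intro nn_integral_dA) measurable
    also have "\<dots> \<le> (\<integral>\<^sup>+z. (ennreal C * F (\<phi> z)) * indicator A z \<partial>lborel)"
    proof (rule nn_integral_mono)
      fix z :: complex
      show "ennreal (weight z) * ennreal (cmod (indicator (ball \<xi> \<epsilon>) z * S f z) powr p) \<le> (ennreal C * F (\<phi> z)) * indicator A z"
      proof (cases "z \<in> A")
        case True
        have "cmod (u z) powr p \<le> K powr p" using uK[OF True] p by (intro powr_mono2) auto
        then have "weight z * (cmod (u z) powr p * cmod (f (\<phi> z)) powr p) \<le> (L powr \<alpha> * weight (\<phi> z)) * (K powr p * cmod (f (\<phi> z)) powr p)"
          using wt[OF True] weight_nonneg by (intro mult_mono mult_right_mono) auto
        also have "\<dots> = C * (weight (\<phi> z) * cmod (f (\<phi> z)) powr p)" by (simp add: C_def)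
        finally have "weight z * cmod (S f z) powr p \<le> C * (weight (\<phi> z) * cmod (f (\<phi> z)) powr p)"
          by (simp add: wcomp_def norm_mult powr_mult)
        then show ?thesis
          using True C weight_nonneg by (simp add: F_def A_def ennreal_leI flip: ennreal_mult)
      next
        case False
        then have "z \<notin> ball 0 1 \<or> z \<notin> ball \<xi> \<epsilon>" by (auto simp: A_def)
        then show ?thesis using p by (auto simp: weight_def indicator_def)
      qed
    qed
    also have "\<dots> \<le> ennreal (L\<^sup>2) * (\<integral>\<^sup>+w. ennreal C * F w \<partial>lborel)"
      by (rule nn_integral_vimage_expanding[OF A L expand]) auto
    also have "(\<integral>\<^sup>+w. ennreal C * F w \<partial>lborel) = ennreal C * (\<integral>\<^sup>+w. F w \<partial>lborel)"
      by (rule nn_integral_cmult) auto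
    also have "(\<integral>\<^sup>+w. F w \<partial>lborel) = (\<integral>\<^sup>+w. ennreal (cmod (f w) powr p) \<partial>\<mu>)"
      unfolding F_def by (rule nn_integral_dA[symmetric]) measurable
    also have "\<dots> = ennreal (N f powr p)" by (rule nn_integral_eq_N[OF f])
    also have "ennreal (L\<^sup>2) * (ennreal C * ennreal (N f powr p)) = ennreal (L\<^sup>2 * (C * N f powr p))"
      using C by (simp add: ennreal_mult)
    also have "L\<^sup>2 * (C * N f powr p) = (K * (d - \<delta>) powr (- q) * N f) powr p"
    proof -
      have "L\<^sup>2 * L powr \<alpha> = L powr (2 + \<alpha>)" using L by (simp add: powr_add)
      also have "L powr (2 + \<alpha>) = (d - \<delta>) powr (- (q * p))"
      proof -
        have "L powr (2 + \<alpha>) = 1 / (d - \<delta>) powr (2 + \<alpha>)" using \<delta> by (simp add: L_def powr_divide)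
        also have "\<dots> = (d - \<delta>) powr (- (2 + \<alpha>))" by (rule powr_minus_divide[symmetric])
        finally show ?thesis using p by (simp add: q_def)
      qed
      also have "\<dots> = ((d - \<delta>) powr (- q)) powr p" by (simp add: powr_powr)
      finally show ?thesis using K by (simp add: C_def powr_mult mult_ac)
    qed
    finally have "bounded_by (\<lambda>z. indicator (ball \<xi> \<epsilon>) z * S f z) (K * (d - \<delta>) powr (- q) * N f)"
      using m K by (simp add: lp_bound_def)
    moreover have "K * (d - \<delta>) powr (- q) * N f \<le> (W + e) * N f"
      using \<delta>(1) by (intro mult_right_mono) (auto simp: K_def)
    ultimately show ?thesis using p by (elim lp_bound_mono) auto
  qed
  show ?thesis using that[OF \<epsilon>(1) main] .
qed

text \<open>Away from \<xi> the symbol takes its values in a smaller concentric disc, where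
  evaluations are bounded. The resulting majorant is a multiple of |u|, hence p-integrable and fit
  for dominated convergence.\<close>

lemma composition_away:
  assumes "\<epsilon> > 0"
  obtains C where "C \<ge> 0" "\<And>f z. f \<in> X \<Longrightarrow> z \<in> ball 0 1 - ball \<xi> \<epsilon> \<Longrightarrow> cmod (S f z) \<le> C * N f * cmod (u z)"
proof -
  obtain \<rho> where \<rho>: "\<rho> < 1" "\<And>z. z \<in> ball 0 1 - ball \<xi> \<epsilon> \<Longrightarrow> cmod (\<phi> z) \<le> \<rho>"
    using range_away[OF assms] by blast
  obtain C where C: "C > 0" "\<And>f z. f \<in> X \<Longrightarrow> cmod z \<le> \<rho> \<Longrightarrow> cmod (f z) \<le> C * N f"
    using evaluation_bound[OF \<rho>(1)] by blast
  have "cmod (S f z) \<le> C * N f * cmod (u z)" if "f \<in> X" "z \<in> ball 0 1 - ball \<xi> \<epsilon>" for f z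
  proof -
    have "cmod (u z) * cmod (f (\<phi> z)) \<le> cmod (u z) * (C * N f)"
      using C(2)[OF that(1) \<rho>(2)[OF that(2)]] by (intro mult_left_mono) auto
    then show ?thesis by (simp add: wcomp_def norm_mult mult_ac)
  qed
  then show ?thesis using that[of C] C(1) by auto
qed

text \<open>Near \<xi> the local bound applies because the peak function has modulus at most 1; away
  from \<xi> it contributes q^n times a bound for \<open>S\<close>. The estimate holds for all large
  n, as needed to bound an upper limit in n under the integral over the parameter.\<close>

lemma peak_upper:
  assumes "e > 0"
  obtains n0 where "\<And>n f. n \<ge> n0 \<Longrightarrow> f \<in> X \<Longrightarrow> N (\<lambda>z. peak \<xi> n z * S f z) \<le> (W + e) * N f"
proof -
  obtain \<epsilon> where \<epsilon>: "\<epsilon> > 0" "\<And>f. f \<in> X \<Longrightarrow> bounded_by (\<lambda>z. indicator (ball \<xi> \<epsilon>) z * S f z) ((W + e / 2) * N f)"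
    using local_composition_bound[of "e / 2"] assms by auto
  obtain q where q: "0 < q" "q < 1" "\<And>z n. z \<in> ball 0 1 - ball \<xi> \<epsilon> \<Longrightarrow> cmod (peak \<xi> n z) \<le> q ^ n"
    using peak_far[OF \<xi> \<epsilon>(1)] by blast
  obtain B where B: "B \<ge> 0" "\<And>f. f \<in> X \<Longrightarrow> N (S f) \<le> B * N f" using bounded_operator_bound[OF S_bounded] by blast
  have "(\<lambda>n. q ^ n * B) \<longlonglongrightarrow> 0 * B" using q by (intro tendsto_mult tendsto_const LIMSEQ_realpow_zero) auto
  then have "eventually (\<lambda>n. q ^ n * B < e / 2) sequentially" by (rule order_tendstoD(2)) (use assms in auto)
  then obtain n0 where n0: "\<And>n. n \<ge> n0 \<Longrightarrow> q ^ n * B < e / 2" by (auto simp: eventually_sequentially)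
  have bm: "ball \<xi> \<epsilon> \<in> sets borel" "- ball \<xi> \<epsilon> \<in> sets borel" by auto
  have "N (\<lambda>z. peak \<xi> n z * S f z) \<le> (W + e) * N f" if n: "n \<ge> n0" and f: "f \<in> X" for n f
  proof -
    note pX = bergman_peak(1)[OF \<xi> SX[OF f], of n]
    have "bounded_by (\<lambda>z. indicator (ball \<xi> \<epsilon>) z * (peak \<xi> n z * S f z)) ((W + e / 2) * N f)"
    proof (rule lp_bound_le[OF \<epsilon>(2)[OF f]])
      show "(\<lambda>z. indicator (ball \<xi> \<epsilon>) z * (peak \<xi> n z * S f z)) \<in> borel_measurable \<mu>"
        using borel_measurable_times[OF borel_measurable_indicator[OF bm(1)] bergman_measurable[OF pX]] by simp
      show "AE z in \<mu>. cmod (indicator (ball \<xi> \<epsilon>) z * (peak \<xi> n z * S f z)) \<le> cmod (indicator (ball \<xi> \<epsilon>) z * S f z)"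
        using AE_dA by eventually_elim
          (use norm_peak_le_1[OF \<xi>] in \<open>auto simp: indicator_def norm_mult intro!: mult_left_le_one_le\<close>)
    qed (use p in auto)
    moreover have "bounded_by (\<lambda>z. indicator (- ball \<xi> \<epsilon>) z * (peak \<xi> n z * S f z)) (q ^ n * N (S f))"
    proof (rule bounded_by_indicator[OF SX[OF f] bm(2) bergman_measurable[OF pX]])
      fix z assume "z \<in> - ball \<xi> \<epsilon>" "z \<in> ball 0 1"
      then have "cmod (peak \<xi> n z) \<le> q ^ n" by (intro q) auto
      then show "cmod (peak \<xi> n z * S f z) \<le> q ^ n * cmod (S f z)"
        unfolding norm_mult by (rule mult_right_mono) simp
    qed (use q in auto)
    ultimately have "N (\<lambda>z. peak \<xi> n z * S f z) \<le> (W + e / 2) * N f + q ^ n * N (S f)"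
      by (rule norm_split[OF pX])
    also have "q ^ n * N (S f) \<le> q ^ n * (B * N f)" using B(2)[OF f] q by (intro mult_left_mono) auto
    also have "\<dots> = (q ^ n * B) * N f" by simp
    also have "\<dots> \<le> e / 2 * N f" using n0[OF n] by (intro mult_right_mono) auto
    finally show ?thesis by (simp add: algebra_simps)
  qed
  then show ?thesis using that by blast
qed

text \<open>Near \<xi> the factor \<open>1 - peak \<xi> n z\<close> is small regardless of k; away
  from \<xi> the images tend to 0 pointwise under a fixed majorant.\<close>

lemma peak_complement_null:
  assumes f: "null_seq f"
  shows "(\<lambda>k. N (\<lambda>z. (1 - peak \<xi> n z) * S (f k) z)) \<longlonglongrightarrow> 0"
proof (rule N_tendsto_0I)
  fix e :: real assume e: "e > 0"
  obtain B0 where fX: "\<And>k. f k \<in> X" and B0: "\<And>k. N (f k) \<le> B0" and f0: "\<And>z. (\<lambda>k. f k z) \<longlonglongrightarrow> 0"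
    using f by (auto simp: null_seq_def)
  obtain B where B: "B \<ge> 0" "\<And>f. f \<in> X \<Longrightarrow> N (S f) \<le> B * N f" using bounded_operator_bound[OF S_bounded] by blast
  have B00: "B0 \<ge> 0" using B0[of 0] N_nonneg order_trans by blast
  \<comment> \<open>Chosen so that \<delta> times the bound for \<open>N (S (f k))\<close> is at
    most e / 2; the added 1 covers the case that this bound vanishes.\<close>
  define \<delta> where "\<delta> = e / (2 * (B * B0 + 1))"
  have BB: "B * B0 \<ge> 0" using B(1) B00 by simp
  have \<delta>: "\<delta> > 0" "\<delta> * (B * B0) \<le> e / 2"
  proof -
    show d: "\<delta> > 0" using e BB by (simp add: \<delta>_def)
    have "\<delta> * (B * B0) \<le> \<delta> * (B * B0 + 1)" using d by simp
    also have "\<dots> = e / 2"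
    proof -
      have "B * B0 + 1 \<noteq> 0" using BB by linarith
      then show ?thesis unfolding \<delta>_def by (metis nonzero_eq_divide_eq times_divide_times_eq mult.right_neutral mult.commute divide_divide_eq_left)
    qed
    finally show "\<delta> * (B * B0) \<le> e / 2" .
  qed
  obtain \<epsilon> where \<epsilon>: "\<epsilon> > 0" "\<And>z. z \<in> ball \<xi> \<epsilon> \<Longrightarrow> cmod (1 - peak \<xi> n z) \<le> \<delta>"
    using peak_near[OF \<xi> \<delta>(1)] by blast
  obtain C where C: "C \<ge> 0" "\<And>f z. f \<in> X \<Longrightarrow> z \<in> ball 0 1 - ball \<xi> \<epsilon> \<Longrightarrow> cmod (S f z) \<le> C * N f * cmod (u z)"
    using composition_away[OF \<epsilon>(1)] by blast
  have bm: "ball \<xi> \<epsilon> \<in> sets borel" "- ball \<xi> \<epsilon> \<in> sets borel" by auto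
  note pX = bergman_peak(3)[OF \<xi> SX[OF fX], of n]
  note [measurable] = bergman_measurable[OF pX]
  have "eventually (\<lambda>k. bounded_by (\<lambda>z. indicator (- ball \<xi> \<epsilon>) z * ((1 - peak \<xi> n z) * S (f k) z)) (e / 2)) sequentially"
  proof (rule lp_dominated[where G = "\<lambda>z. cmod (of_real (2 * C * B0) * u z)"])
    show "(\<lambda>z. indicator (- ball \<xi> \<epsilon>) z * ((1 - peak \<xi> n z) * S (f k) z)) \<in> borel_measurable \<mu>" for k
      using bm by simp measurable
    show "(\<lambda>z. cmod (of_real (2 * C * B0) * u z)) \<in> borel_measurable \<mu>" by simp
    have "(\<integral>\<^sup>+z. ennreal (cmod (of_real (2 * C * B0) * u z) powr p) \<partial>\<mu>) = ennreal (N (\<lambda>z. of_real (2 * C * B0) * u z) powr p)"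
      by (rule nn_integral_eq_N[OF bergman_cmult(1)[OF uX]])
    then show "(\<integral>\<^sup>+z. ennreal (cmod (of_real (2 * C * B0) * u z) powr p) \<partial>\<mu>) < \<infinity>" by simp
    show "AE z in \<mu>. cmod (indicator (- ball \<xi> \<epsilon>) z * ((1 - peak \<xi> n z) * S (f k) z)) \<le> cmod (of_real (2 * C * B0) * u z)" for k
      using AE_dA
    proof eventually_elim
      fix z :: complex assume z: "z \<in> ball 0 1"
      show "cmod (indicator (- ball \<xi> \<epsilon>) z * ((1 - peak \<xi> n z) * S (f k) z)) \<le> cmod (of_real (2 * C * B0) * u z)"
      proof (cases "z \<in> ball \<xi> \<epsilon>")
        case False
        have "cmod (1 - peak \<xi> n z) \<le> 2"
          using norm_triangle_ineq4[of 1 "peak \<xi> n z"] norm_peak_le_1[OF \<xi> z, of n] by simp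
        moreover have "cmod (S (f k) z) \<le> C * B0 * cmod (u z)"
        proof -
          have "cmod (S (f k) z) \<le> C * N (f k) * cmod (u z)" using z False by (intro C fX) auto
          also have "\<dots> \<le> C * B0 * cmod (u z)" using C(1) B0[of k] by (intro mult_right_mono mult_left_mono) auto
          finally show ?thesis .
        qed
        ultimately have "cmod (1 - peak \<xi> n z) * cmod (S (f k) z) \<le> 2 * (C * B0 * cmod (u z))"
          by (intro mult_mono) auto
        then show ?thesis using False C(1) B00 unfolding norm_mult norm_of_real by simp
      qed simp
    qed
    show "AE z in \<mu>. (\<lambda>k. indicator (- ball \<xi> \<epsilon>) z * ((1 - peak \<xi> n z) * S (f k) z)) \<longlonglongrightarrow> 0"
      unfolding wcomp_def by (intro AE_I2 tendsto_mult_right_zero f0)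
  qed (use e in auto)
  then show "eventually (\<lambda>k. N (\<lambda>z. (1 - peak \<xi> n z) * S (f k) z) \<le> e) sequentially"
  proof eventually_elim
    case (elim k)
    have "bounded_by (\<lambda>z. indicator (ball \<xi> \<epsilon>) z * ((1 - peak \<xi> n z) * S (f k) z)) (\<delta> * N (S (f k)))"
    proof (rule bounded_by_indicator[OF SX[OF fX] bm(1) bergman_measurable[OF pX]])
      fix z assume "z \<in> ball \<xi> \<epsilon>"
      then show "cmod ((1 - peak \<xi> n z) * S (f k) z) \<le> \<delta> * cmod (S (f k) z)"
        unfolding norm_mult by (intro mult_right_mono \<epsilon>) auto
    qed (use \<delta> in auto)
    from norm_split[OF pX this elim]
    have "N (\<lambda>z. (1 - peak \<xi> n z) * S (f k) z) \<le> \<delta> * N (S (f k)) + e / 2" .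
    also have "\<delta> * N (S (f k)) \<le> \<delta> * (B * B0)"
      using B(2)[OF fX[of k]] mult_left_mono[OF B0[of k] B(1)] \<delta>(1) by (intro mult_left_mono) auto
    finally show ?case using \<delta>(2) by simp
  qed
qed

end

section \<open>The test functions as approximate eigenvectors\<close>

lemma Ln_ratio:
  assumes "cmod \<xi> = 1" "z \<in> ball 0 1" "w \<in> ball 0 1"
  shows "Ln (1 - w / \<xi>) - Ln (1 - z / \<xi>) = Ln ((\<xi> - w) / (\<xi> - z))"
proof -
  have re: "Re (1 - w / \<xi>) > 0" "Re (1 - z / \<xi>) > 0"
    using Re_one_minus_div_pos[OF assms(1)] assms(2,3) by blast+
  then have nz: "1 - w / \<xi> \<noteq> 0" "1 - z / \<xi> \<noteq> 0" by force+
  have \<xi>0: "\<xi> \<noteq> 0" using assms(1) by auto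
  \<comment> \<open>Both imaginary parts are below pi/2 in modulus, so the difference of the
    logarithms stays within the principal branch.\<close>
  have im: "\<bar>Im (Ln (1 - w / \<xi>))\<bar> < pi / 2" "\<bar>Im (Ln (1 - z / \<xi>))\<bar> < pi / 2"
    using Re_Ln_pos_lt_imp[OF re(1)] Re_Ln_pos_lt_imp[OF re(2)] by auto
  have "exp (Ln (1 - w / \<xi>) - Ln (1 - z / \<xi>)) = (1 - w / \<xi>) / (1 - z / \<xi>)"
    using nz by (simp add: exp_diff)
  also have "\<dots> = (\<xi> - w) / (\<xi> - z)"
  proof -
    have "\<xi> - z = \<xi> * (1 - z / \<xi>)" "\<xi> - w = \<xi> * (1 - w / \<xi>)" using \<xi>0 by (simp_all add: field_simps)
    then show ?thesis using \<xi>0 nz by (metis nonzero_mult_divide_mult_cancel_left)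
  qed
  finally show ?thesis
    using im by (intro Ln_unique[symmetric]) (auto simp: abs_if split: if_splits)
qed

context boundary_symbol begin

definition Q :: "complex \<Rightarrow> complex" where "Q z = (\<xi> - \<phi> z) / (\<xi> - z)"

lemma Q_lim: "(Q \<longlongrightarrow> of_real d) (at \<xi> within ball 0 1)"
proof (rule tendstoI)
  fix e :: real assume e: "e > 0"
  then have "e / 2 > 0" by simp
  then obtain \<epsilon> where \<epsilon>: "\<epsilon> > 0" "\<And>z. z \<in> ball 0 1 \<inter> ball \<xi> \<epsilon> \<Longrightarrow> cmod (\<xi> - \<phi> z - of_real d * (\<xi> - z)) \<le> e / 2 * cmod (\<xi> - z)"
    using angular_derivative by blast
  have "dist (Q z) (of_real d) < e" if z: "z \<in> ball 0 1" "z \<noteq> \<xi>" "dist z \<xi> < \<epsilon>" for z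
  proof -
    have nz: "cmod (\<xi> - z) > 0" using z by simp
    have "Q z - of_real d = (\<xi> - \<phi> z - of_real d * (\<xi> - z)) / (\<xi> - z)"
      using z(2) by (simp add: Q_def field_simps)
    then have "cmod (Q z - of_real d) = cmod (\<xi> - \<phi> z - of_real d * (\<xi> - z)) / cmod (\<xi> - z)"
      by (simp add: norm_divide)
    also have "\<dots> \<le> e / 2" using \<epsilon>(2)[of z] z nz by (simp add: divide_le_eq dist_commute)
    finally show ?thesis using e by (simp add: dist_norm)
  qed
  then show "eventually (\<lambda>z. dist (Q z) (of_real d) < e) (at \<xi> within ball 0 1)"
    unfolding eventually_at using \<epsilon>(1) by blast
qed

text \<open>The source of the eigenvector property: composition with \<phi> multiplies the test
  function by the power -c of \<open>Q\<close>, and \<open>Q\<close> tends to \<open>d\<close> at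
  \<xi>.\<close>

lemma f_hat_comp:
  assumes "z \<in> ball 0 1"
  shows "f_hat \<xi> c (\<phi> z) = f_hat \<xi> c z * exp (- of_real c * Ln (Q z))"
proof -
  have "Ln (1 - \<phi> z / \<xi>) = Ln (1 - z / \<xi>) + Ln (Q z)"
    using Ln_ratio[OF \<xi> assms \<phi>_in[OF assms]] by (simp add: Q_def algebra_simps)
  then show ?thesis
    using assms \<phi>_in[OF assms] by (simp add: f_hat_def exp_add[symmetric] algebra_simps)
qed

text \<open>Near \<xi> the error is \<open>E n z\<close> times the test function, and
  \<open>E\<close> is small when n is large and z is close to \<xi>. Off that neighbourhood the two
  terms vanish in norm separately, because the test functions are uniformly bounded there and tend
  to 0.\<close>

lemma test_function_asymptotics:
  assumes c: "\<And>n. \<alpha> \<le> c n * p" "\<And>n. c n < (2 + \<alpha>) / p" "c \<longlonglongrightarrow> (2 + \<alpha>) / p"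
  defines "v \<equiv> u0 * of_real (d powr (- ((2 + \<alpha>) / p)))"
  shows "(\<lambda>n. N (\<lambda>z. S (f_test p \<alpha> \<xi> (c n)) z - v * f_test p \<alpha> \<xi> (c n) z)) \<longlonglongrightarrow> 0"
proof (rule N_tendsto_0I)
  fix e :: real assume e: "e > 0"
  define c0 where "c0 = (2 + \<alpha>) / p"
  define g where "g n = f_test p \<alpha> \<xi> (c n)" for n
  have gX: "g n \<in> X" "N (g n) = 1" for n
    unfolding g_def using f_test_bergman[OF \<xi> c(1,2)] by auto
  have g0: "(\<lambda>n. g n z) \<longlonglongrightarrow> 0" for z
    using f_test_null_seq[OF \<xi> c] by (simp add: null_seq_def g_def)
  define E where "E n z = u z * exp (- of_real (c n) * Ln (Q z)) - v" for n z
  have factor: "S (g n) z - v * g n z = E n z * g n z" if "z \<in> ball 0 1" for n z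
    using f_hat_comp[OF that, of "c n"] by (simp add: wcomp_def g_def f_test_def E_def algebra_simps)
  \<comment> \<open>The neighbourhood of \<xi> must not depend on n, hence a limit along the product
    filter.\<close>
  have "((\<lambda>(n, z). E n z) \<longlongrightarrow> u0 * exp (- of_real c0 * Ln (of_real d)) - v) (sequentially \<times>\<^sub>F (at \<xi> within ball 0 1))"
    unfolding E_def case_prod_unfold using d_pos
    by (intro tendsto_intros filterlim_compose[OF u_lim] filterlim_compose[OF Q_lim] filterlim_snd
        filterlim_compose[OF c(3)[folded c0_def]] filterlim_fst) (auto simp: complex_nonpos_Reals_iff)
  also have "u0 * exp (- of_real c0 * Ln (of_real d)) - v = 0"
    using d_pos by (simp add: v_def c0_def powr_def Ln_of_real exp_of_real[symmetric])
  finally have "eventually (\<lambda>(n, z). dist (E n z) 0 < e / 3) (sequentially \<times>\<^sub>F (at \<xi> within ball 0 1))"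
    using tendstoD[of "\<lambda>(n, z). E n z" 0 _ "e / 3"] e by (simp add: case_prod_unfold)
  then obtain P1 P2 where P: "eventually P1 sequentially" "eventually P2 (at \<xi> within ball 0 1)"
    "\<And>n z. P1 n \<Longrightarrow> P2 z \<Longrightarrow> cmod (E n z) < e / 3"
    by (auto simp: eventually_prod_filter)
  obtain \<epsilon> where \<epsilon>: "\<epsilon> > 0" "\<And>z. z \<in> ball 0 1 \<inter> ball \<xi> \<epsilon> \<Longrightarrow> P2 z"
    using boundary_nbhd[OF \<xi> P(2)] by blast
  obtain C where C: "C \<ge> 0" "\<And>f z. f \<in> X \<Longrightarrow> z \<in> ball 0 1 - ball \<xi> \<epsilon> \<Longrightarrow> cmod (S f z) \<le> C * N f * cmod (u z)"
    using composition_away[OF \<epsilon>(1)] by blast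
  obtain C1 where C1: "\<And>f. f \<in> X \<Longrightarrow> cmod (f 0) \<le> C1 * N f" using evaluation_bound_at[of 0] by blast
  \<comment> \<open>Since 0 \<le> c n < c0, this bounds \<open>\<epsilon> powr (- c n)\<close> for
    all n, whether \<epsilon> lies below or above 1.\<close>
  define M where "M = max 1 (\<epsilon> powr (- c0))"
  have M: "M > 0" by (simp add: M_def)
  have g_away: "cmod (g n z) \<le> M * \<bar>C1\<bar>" if z: "z \<in> ball 0 1 - ball \<xi> \<epsilon>" for n z
  proof -
    have cn: "c n \<ge> 0"
      using order_trans[OF \<alpha> c(1)[of n]] p by (simp add: zero_le_mult_iff)
    note fX = f_hat_bergman[OF \<xi> c(1)[of n] c(2)[of n]]
    have N0: "N (f_hat \<xi> (c n)) \<noteq> 0"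
    proof
      assume "N (f_hat \<xi> (c n)) = 0"
      then have "f_hat \<xi> (c n) 0 = 0" using N_eq_0D[OF fX] by metis
      then show False using \<xi> by (auto simp: f_hat_def)
    qed
    then have Npos: "N (f_hat \<xi> (c n)) > 0" using N_nonneg[of "f_hat \<xi> (c n)"] by linarith
    \<comment> \<open>The value at the origin bounds the norms of \<open>f_hat\<close> from below,
      and with them the normalizing factors from above.\<close>
    have "cmod (f_hat \<xi> (c n) 0) = 1" using norm_f_hat[OF \<xi>, of 0] \<xi> by simp
    then have "1 \<le> \<bar>C1\<bar> * N (f_hat \<xi> (c n))"
      using C1[OF fX] mult_right_mono[OF abs_ge_self[of C1] N_nonneg[of "f_hat \<xi> (c n)"]] by linarith
    then have inv: "1 / N (f_hat \<xi> (c n)) \<le> \<bar>C1\<bar>" using Npos by (simp add: field_simps)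
    have "cmod (f_hat \<xi> (c n) z) = cmod (\<xi> - z) powr (- c n)" using z by (intro norm_f_hat \<xi>) auto
    also have "\<dots> \<le> \<epsilon> powr (- c n)" using z \<epsilon>(1) cn by (intro powr_mono2') (auto simp: dist_norm)
    also have "\<dots> \<le> M"
    proof (cases "\<epsilon> \<ge> 1")
      case True
      then have "\<epsilon> powr (- c n) \<le> 1" using cn by (simp add: powr_minus_divide ge_one_powr_ge_zero divide_le_eq)
      then show ?thesis by (simp add: M_def)
    next
      case False
      then have "\<epsilon> powr (- c n) \<le> \<epsilon> powr (- c0)" using \<epsilon>(1) c(2)[of n] by (intro powr_mono') (auto simp: c0_def)
      then show ?thesis by (simp add: M_def)
    qed
    finally have "cmod (f_hat \<xi> (c n) z) * (1 / N (f_hat \<xi> (c n))) \<le> M * \<bar>C1\<bar>"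
      using inv Npos M by (intro mult_mono) auto
    then show ?thesis by (simp add: g_def f_test_def norm_divide)
  qed
  have bm: "ball \<xi> \<epsilon> \<in> sets borel" "- ball \<xi> \<epsilon> \<in> sets borel" by auto
  note meas = bergman_measurable[OF SX[OF gX(1)]] bergman_measurable[OF gX(1)]
  have off1: "eventually (\<lambda>n. bounded_by (\<lambda>z. indicator (- ball \<xi> \<epsilon>) z * S (g n) z) (e / 3)) sequentially"
  proof (rule lp_dominated[where G = "\<lambda>z. cmod (of_real C * u z)"])
    show "(\<lambda>z. indicator (- ball \<xi> \<epsilon>) z * S (g n) z) \<in> borel_measurable \<mu>" for n
      using borel_measurable_times[OF borel_measurable_indicator[OF bm(2)] meas(1)] by simp
    have "(\<integral>\<^sup>+z. ennreal (cmod (of_real C * u z) powr p) \<partial>\<mu>) = ennreal (N (\<lambda>z. of_real C * u z) powr p)"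
      by (rule nn_integral_eq_N[OF bergman_cmult(1)[OF uX]])
    then show "(\<integral>\<^sup>+z. ennreal (cmod (of_real C * u z) powr p) \<partial>\<mu>) < \<infinity>" by simp
    show "AE z in \<mu>. cmod (indicator (- ball \<xi> \<epsilon>) z * S (g n) z) \<le> cmod (of_real C * u z)" for n
      using AE_dA by eventually_elim
        (use C(2)[OF gX(1)[of n]] gX(2)[of n] C(1) in \<open>auto simp: indicator_def norm_mult\<close>)
    show "AE z in \<mu>. (\<lambda>n. indicator (- ball \<xi> \<epsilon>) z * S (g n) z) \<longlonglongrightarrow> 0"
      unfolding wcomp_def by (intro AE_I2 tendsto_mult_right_zero g0)
  qed (use e in auto)
  have off2: "eventually (\<lambda>n. bounded_by (\<lambda>z. indicator (- ball \<xi> \<epsilon>) z * ((- v) * g n z)) (e / 3)) sequentially"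
  proof (rule lp_dominated[where G = "\<lambda>z. cmod v * (M * \<bar>C1\<bar>)"])
    show "(\<lambda>z. indicator (- ball \<xi> \<epsilon>) z * ((- v) * g n z)) \<in> borel_measurable \<mu>" for n
      using borel_measurable_times[OF borel_measurable_indicator[OF bm(2)] borel_measurable_times[OF borel_measurable_const meas(2)]] by simp
    show "(\<integral>\<^sup>+z. ennreal ((cmod v * (M * \<bar>C1\<bar>)) powr p) \<partial>\<mu>) < \<infinity>"
      using M.emeasure_finite[of UNIV] by (simp add: less_top[symmetric] ennreal_mult_eq_top_iff)
    show "AE z in \<mu>. cmod (indicator (- ball \<xi> \<epsilon>) z * ((- v) * g n z)) \<le> cmod v * (M * \<bar>C1\<bar>)" for n
      using AE_dA
    proof eventually_elim
      fix z :: complex assume z: "z \<in> ball 0 1"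
      show "cmod (indicator (- ball \<xi> \<epsilon>) z * ((- v) * g n z)) \<le> cmod v * (M * \<bar>C1\<bar>)"
        using g_away[of z n] z M
        by (cases "z \<in> ball \<xi> \<epsilon>") (auto simp: norm_mult intro!: mult_left_mono)
    qed
    show "AE z in \<mu>. (\<lambda>n. indicator (- ball \<xi> \<epsilon>) z * ((- v) * g n z)) \<longlonglongrightarrow> 0"
      by (intro AE_I2 tendsto_mult_right_zero g0)
  qed (use e in auto)
  show "eventually (\<lambda>n. N (\<lambda>z. S (f_test p \<alpha> \<xi> (c n)) z - v * f_test p \<alpha> \<xi> (c n) z) \<le> e) sequentially"
    unfolding g_def[symmetric] using P(1) off1 off2
  proof eventually_elim
    case (elim n)
    have dX: "(\<lambda>z. S (g n) z - v * g n z) \<in> X" by (intro bergman_diff SX bergman_cmult gX)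
    have "bounded_by (\<lambda>z. indicator (- ball \<xi> \<epsilon>) z * S (g n) z + indicator (- ball \<xi> \<epsilon>) z * ((- v) * g n z)) (e / 3 + e / 3)"
      by (rule lp_bound_add[OF p elim(2,3)])
    then have off: "bounded_by (\<lambda>z. indicator (- ball \<xi> \<epsilon>) z * (S (g n) z - v * g n z)) (e / 3 + e / 3)"
      by (simp add: algebra_simps)
    have on: "bounded_by (\<lambda>z. indicator (ball \<xi> \<epsilon>) z * (S (g n) z - v * g n z)) (e / 3 * N (g n))"
    proof (rule bounded_by_indicator[OF gX(1) bm(1) bergman_measurable[OF dX]])
      fix z assume z: "z \<in> ball \<xi> \<epsilon>" "z \<in> ball 0 1"
      then have "cmod (E n z) \<le> e / 3" using P(3)[OF elim(1) \<epsilon>(2)[of z]] by simp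
      then show "cmod (S (g n) z - v * g n z) \<le> e / 3 * cmod (g n z)"
        unfolding factor[OF z(2)] norm_mult by (rule mult_right_mono) simp
    qed (use e in auto)
    from norm_split[OF dX on off] show ?case using gX(2) by simp
  qed
qed

lemma test_function_limit:
  assumes c: "\<And>n. \<alpha> \<le> c n * p" "\<And>n. c n < (2 + \<alpha>) / p" "c \<longlonglongrightarrow> (2 + \<alpha>) / p"
  shows "(\<lambda>n. N (S (f_test p \<alpha> \<xi> (c n)))) \<longlonglongrightarrow> W"
proof -
  define v where "v = u0 * of_real (d powr (- ((2 + \<alpha>) / p)))"
  have vW: "cmod v = W" by (simp add: v_def W_def norm_mult)
  have lim: "(\<lambda>n. N (\<lambda>z. S (f_test p \<alpha> \<xi> (c n)) z - v * f_test p \<alpha> \<xi> (c n) z)) \<longlonglongrightarrow> 0"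
    unfolding v_def by (rule test_function_asymptotics[OF c])
  have "(\<lambda>n. N (S (f_test p \<alpha> \<xi> (c n))) - W) \<longlonglongrightarrow> 0"
  proof (rule Lim_null_comparison[OF _ lim], intro always_eventually allI)
    fix n
    note g = f_test_bergman[OF \<xi> c(1)[of n] c(2)[of n]]
    define a where "a = S (f_test p \<alpha> \<xi> (c n))"
    define b where "b = (\<lambda>z. v * f_test p \<alpha> \<xi> (c n) z)"
    have aX: "a \<in> X" and bX: "b \<in> X" and Nb: "N b = W"
      using bergman_cmult[OF g(1), of v] g SX vW by (auto simp: a_def b_def)
    from N_diff_abs[OF aX bX] show "norm (N (S (f_test p \<alpha> \<xi> (c n))) - W) \<le> N (\<lambda>z. S (f_test p \<alpha> \<xi> (c n)) z - v * f_test p \<alpha> \<xi> (c n) z)"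
      unfolding Nb by (simp add: a_def b_def)
  qed
  then show ?thesis by (simp add: LIM_zero_iff)
qed

text \<open>The operator norms are assumed to have a finite integral over the parameter, so this
  domination will make \<open>W\<close> integrable.\<close>

lemma W_le_op_norm: "ennreal W \<le> op_norm X N S"
proof -
  have lim: "(\<lambda>n. ennreal (N (S (f_test p \<alpha> \<xi> (c_seq n))))) \<longlonglongrightarrow> ennreal W"
    by (intro tendsto_ennrealI test_function_limit c_seq)
  show ?thesis
    by (rule LIMSEQ_le_const2[OF lim]) (use f_test_bergman[OF \<xi> c_seq(1,2)] op_norm_upper in auto)
qed

end

section \<open>The integral of an admissible family\<close>

locale admissible_family = weighted_bergman +
  fixes \<xi> :: complex and u \<phi> :: "real \<Rightarrow> complex \<Rightarrow> complex"
  assumes \<xi>: "cmod \<xi> = 1" and adm: "admissible p \<alpha> \<xi> u \<phi>"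
begin

abbreviation "I \<equiv> {0<..<1::real}"
abbreviation "M \<equiv> restrict_space lborel I"
abbreviation "S t \<equiv> wcomp (u t) (\<phi> t)"

lemma space_M: "space M = I"
  by (simp add: space_restrict_space)

lemma finite_measure_M: "finite_measure M"
  by (rule finite_measureI) (simp add: space_restrict_space emeasure_restrict_space)

sublocale T: finite_measure M by (rule finite_measure_M)

lemma symbol:
  assumes t: "t \<in> I"
  shows "boundary_symbol p \<alpha> \<xi> (u t) (\<phi> t)"
proof -
  have w: "weighted_composition_family p \<alpha> u \<phi>" and h: "has_direction \<xi> u \<phi>"
    and lower: "\<exists>\<epsilon>>0. (INF t'\<in>I \<inter> ball t \<epsilon>. INF z\<in>ball \<xi> \<epsilon> \<inter> ball 0 1. ennreal (cmod (deriv (\<phi> t') z))) > 0"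
    using adm t by (auto simp: admissible_def)
  obtain \<epsilon> where \<epsilon>: "\<epsilon> > 0" "(INF t'\<in>I \<inter> ball t \<epsilon>. INF z\<in>ball \<xi> \<epsilon> \<inter> ball 0 1. ennreal (cmod (deriv (\<phi> t') z))) > 0"
    using lower by blast
  have "(INF t'\<in>I \<inter> ball t \<epsilon>. INF z\<in>ball \<xi> \<epsilon> \<inter> ball 0 1. ennreal (cmod (deriv (\<phi> t') z)))
      \<le> (INF z\<in>ball \<xi> \<epsilon> \<inter> ball 0 1. ennreal (cmod (deriv (\<phi> t) z)))"
    using t \<epsilon>(1) by (intro INF_lower) auto
  with \<epsilon>(2) have pos: "(INF z\<in>ball \<xi> \<epsilon> \<inter> ball 0 1. ennreal (cmod (deriv (\<phi> t) z))) > 0" by simp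
  \<comment> \<open>The infimum is taken in \<open>ennreal\<close>; the cap at 1 makes it finite, so
    that it can be read as a real number.\<close>
  define m where "m = min 1 (INF z\<in>ball \<xi> \<epsilon> \<inter> ball 0 1. ennreal (cmod (deriv (\<phi> t) z)))"
  have "m \<le> 1" by (simp add: m_def)
  then have m: "0 < m" "m < top" using pos le_less_trans[OF _ ennreal_one_less_top] by (auto simp: m_def)
  have "enn2real m \<le> cmod (deriv (\<phi> t) z)" if "z \<in> ball \<xi> \<epsilon> \<inter> ball 0 1" for z
  proof -
    have "m \<le> ennreal (cmod (deriv (\<phi> t) z))"
      unfolding m_def using that by (intro min.coboundedI2 INF_lower)
    then have "enn2real m \<le> enn2real (ennreal (cmod (deriv (\<phi> t) z)))" by (rule enn2real_mono) simp
    then show ?thesis by simp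
  qed
  moreover have "enn2real m > 0" using m by (simp add: enn2real_positive_iff)
  ultimately have "\<exists>m>0. \<exists>\<epsilon>>0. \<forall>z\<in>ball \<xi> \<epsilon> \<inter> ball 0 1. m \<le> cmod (deriv (\<phi> t) z)"
    using \<epsilon>(1) by blast
  then show ?thesis
    using w h t \<xi> p \<alpha>
    by unfold_locales (simp_all add: weighted_composition_family_def has_direction_def)
qed

lemma SX: "t \<in> I \<Longrightarrow> f \<in> X \<Longrightarrow> S t f \<in> X"
  by (rule boundary_symbol.SX[OF symbol])

lemma uX: "t \<in> I \<Longrightarrow> u t \<in> X"
  using symbol by (auto simp: boundary_symbol_def boundary_symbol_axioms_def)

lemma \<phi>_hol: "t \<in> I \<Longrightarrow> \<phi> t holomorphic_on ball 0 1"
  using symbol by (auto simp: boundary_symbol_def boundary_symbol_axioms_def)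

section \<open>Continuity in the parameter and joint measurability\<close>

lemma \<phi>_tendsto:
  assumes t: "\<And>k. t k \<in> I" "t0 \<in> I" "t \<longlonglongrightarrow> t0" and z: "\<And>k. z k \<in> ball 0 1" "z0 \<in> ball 0 1" "z \<longlonglongrightarrow> z0"
  shows "(\<lambda>k. \<phi> (t k) (z k)) \<longlonglongrightarrow> \<phi> t0 z0"
proof -
  define G where "G s = (SUP w\<in>ball 0 1. cmod (\<phi> s w - \<phi> t0 w))" for s
  have "(G \<longlongrightarrow> 0) (at t0)" using adm t(2) unfolding admissible_def G_def by blast
  \<comment> \<open>The limit at t0 concerns punctured neighbourhoods, whereas \<open>t k\<close>
    may equal t0; the value 0 at t0 turns it into continuity.\<close>
  moreover have "G t0 = 0" by (simp add: G_def)
  ultimately have "isCont G t0" by (simp add: isCont_def)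
  then have "(\<lambda>k. G (t k)) \<longlonglongrightarrow> G t0" by (rule isCont_tendsto_compose[OF _ t(3)])
  then have G0: "(\<lambda>k. G (t k)) \<longlonglongrightarrow> 0" using \<open>G t0 = 0\<close> by simp
  have le: "cmod (\<phi> (t k) (z k) - \<phi> t0 (z k)) \<le> G (t k)" for k
    unfolding G_def
  proof (rule cSUP_upper[OF z(1)], rule bdd_aboveI2[where M = 2])
    fix w :: complex assume w: "w \<in> ball 0 1"
    have "cmod (\<phi> (t k) w) < 1" "cmod (\<phi> t0 w) < 1"
      using boundary_symbol.\<phi>_in[OF symbol[OF t(1)] w] boundary_symbol.\<phi>_in[OF symbol[OF t(2)] w] by auto
    then show "cmod (\<phi> (t k) w - \<phi> t0 w) \<le> 2" using norm_triangle_ineq4[of "\<phi> (t k) w" "\<phi> t0 w"] by simp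
  qed
  have "(\<lambda>k. \<phi> (t k) (z k) - \<phi> t0 (z k)) \<longlonglongrightarrow> 0"
    by (rule Lim_null_comparison[OF _ G0]) (use le in auto)
  moreover have "(\<lambda>k. \<phi> t0 (z k)) \<longlonglongrightarrow> \<phi> t0 z0"
    using holomorphic_on_imp_continuous_on[OF \<phi>_hol[OF t(2)]] z
    by (intro continuous_on_tendsto_compose[OF _ z(3)]) auto
  ultimately show ?thesis using tendsto_add by fastforce
qed

text \<open>Admissibility gives convergence of \<open>u\<close> in L^p away from \<xi>. The local
  evaluation estimate, on discs about \<open>z k\<close> that stay away from \<xi>, turns this into
  convergence of values.\<close>

lemma u_tendsto:
  assumes t: "\<And>k. t k \<in> I" "t0 \<in> I" "t \<longlonglongrightarrow> t0" and z: "\<And>k. z k \<in> ball 0 1" "z0 \<in> ball 0 1" "z \<longlonglongrightarrow> z0"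
  shows "(\<lambda>k. u (t k) (z k)) \<longlonglongrightarrow> u t0 z0"
proof -
  \<comment> \<open>For large k the disc of radius R / 4 about \<open>z k\<close> lies in |w| < 1 -
    R / 2, hence at distance at least R / 2 from \<xi>.\<close>
  define R where "R = 1 - cmod z0"
  have R: "R > 0" using z(2) by (simp add: R_def)
  define c where "c = (R / 4)\<^sup>2 * (1 - (1 - R / 2)\<^sup>2) powr \<alpha>"
  have "R \<le> 1" by (simp add: R_def)
  then have "(1 - R / 2)\<^sup>2 < 1" using R by (simp add: abs_square_less_1 abs_if)
  then have c: "c > 0" using R by (simp add: c_def)
  define A where "A = ball 0 1 - ball \<xi> (R / 2)"
  have A: "A \<in> sets borel" by (simp add: A_def)
  define J where "J s = (\<integral>z\<in>A. cmod (u s z - u t0 z) powr p \<partial>\<mu>)" for s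
  have "(J \<longlongrightarrow> 0) (at t0)" using adm t(2) half_gt_zero[OF R] unfolding admissible_def J_def A_def by blast
  moreover have "J t0 = 0" using p by (simp add: J_def)
  ultimately have "isCont J t0" by (simp add: isCont_def)
  then have "(\<lambda>k. J (t k)) \<longlonglongrightarrow> J t0" by (rule isCont_tendsto_compose[OF _ t(3)])
  then have J0: "(\<lambda>k. J (t k) / c) \<longlonglongrightarrow> 0" using \<open>J t0 = 0\<close> by (simp add: tendsto_divide_zero)
  have dX: "(\<lambda>z. u (t k) z - u t0 z) \<in> X" for k by (intro bergman_diff uX t)
  have ev: "eventually (\<lambda>k. cmod (z k - z0) < R / 4) sequentially"
    using tendstoD[OF z(3), of "R / 4"] R by (simp add: dist_norm)
  have "eventually (\<lambda>k. cmod (u (t k) (z k) - u t0 (z k)) powr p \<le> J (t k) / c) sequentially"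
    using ev
  proof eventually_elim
    case (elim k)
    define h where "h w = u (t k) w - u t0 w" for w
    have hX: "h \<in> X" unfolding h_def by (rule dX)
    note [measurable] = bergman_measurable[OF hX] A
    have zk: "cmod (z k) + R / 4 \<le> 1 - R / 2"
    proof -
      have "cmod (z k) < (1 - R) + R / 4"
        using elim norm_triangle_ineq2[of "z k" z0] R_def by linarith
      then show ?thesis by (simp add: field_simps)
    qed
    have sub: "ball (z k) (R / 4) \<subseteq> A"
    proof
      fix w assume "w \<in> ball (z k) (R / 4)"
      then have "cmod w < 1 - R / 2" using zk norm_triangle_ineq2[of w "z k"] by (simp add: dist_norm norm_minus_commute)
      moreover have "1 - cmod w \<le> cmod (\<xi> - w)" using norm_triangle_ineq2[of \<xi> w] \<xi> by simp
      ultimately show "w \<in> A" using R by (simp add: A_def dist_norm)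
    qed
    have int: "integrable \<mu> (\<lambda>w. indicator A w *\<^sub>R cmod (h w) powr p)"
    proof (rule integrableI_bounded)
      have "(\<integral>\<^sup>+w. ennreal (norm (indicator A w *\<^sub>R cmod (h w) powr p)) \<partial>\<mu>) \<le> (\<integral>\<^sup>+w. ennreal (cmod (h w) powr p) \<partial>\<mu>)"
        by (intro nn_integral_mono) (auto simp: indicator_def)
      also have "\<dots> < \<infinity>" using nn_integral_eq_N[OF hX] by simp
      finally show "(\<integral>\<^sup>+w. ennreal (norm (indicator A w *\<^sub>R cmod (h w) powr p)) \<partial>\<mu>) < \<infinity>" .
    qed simp
    have "ennreal (cmod (h (z k)) powr p * c) \<le> (\<integral>\<^sup>+w\<in>ball (z k) (R / 4). ennreal (cmod (h w) powr p) \<partial>\<mu>)"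
      unfolding c_def by (rule local_evaluation[OF bergman_holo[OF hX]]) (use zk R in auto)
    also have "\<dots> \<le> (\<integral>\<^sup>+w. ennreal (indicator A w *\<^sub>R cmod (h w) powr p) \<partial>\<mu>)"
      using sub by (intro nn_integral_mono) (auto simp: indicator_def)
    also have "\<dots> = ennreal (J (t k))"
      unfolding J_def h_def[symmetric] set_lebesgue_integral_def
      by (rule nn_integral_eq_integral[OF int]) (auto simp: indicator_def)
    finally have "cmod (h (z k)) powr p * c \<le> J (t k)"
      by (subst (asm) ennreal_le_iff) (auto simp: J_def set_lebesgue_integral_def indicator_def)
    then show ?case using c by (simp add: h_def field_simps)
  qed
  then have "(\<lambda>k. cmod (u (t k) (z k) - u t0 (z k)) powr p) \<longlonglongrightarrow> 0"
    by (intro Lim_null_comparison[OF _ J0]) (auto elim: eventually_mono)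
  then have "(\<lambda>k. (cmod (u (t k) (z k) - u t0 (z k)) powr p) powr (1 / p)) \<longlonglongrightarrow> 0 powr (1 / p)"
    using p by (intro tendsto_powr2) auto
  then have "(\<lambda>k. cmod (u (t k) (z k) - u t0 (z k))) \<longlonglongrightarrow> 0" using p by (simp add: powr_powr)
  then have "(\<lambda>k. u (t k) (z k) - u t0 (z k)) \<longlonglongrightarrow> 0" by (rule tendsto_norm_zero_cancel)
  moreover have "(\<lambda>k. u t0 (z k)) \<longlonglongrightarrow> u t0 z0"
    using holomorphic_on_imp_continuous_on[OF bergman_holo[OF uX[OF t(2)]]] z
    by (intro continuous_on_tendsto_compose[OF _ z(3)]) auto
  ultimately show ?thesis using tendsto_add by fastforce
qed

lemma S_tendsto:
  assumes t: "\<And>k. t k \<in> I" "t0 \<in> I" "t \<longlonglongrightarrow> t0" and z: "\<And>k. z k \<in> ball 0 1" "z0 \<in> ball 0 1" "z \<longlonglongrightarrow> z0"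
    and f: "f \<in> X"
  shows "(\<lambda>k. S (t k) f (z k)) \<longlonglongrightarrow> S t0 f z0"
proof -
  have "(\<lambda>k. f (\<phi> (t k) (z k))) \<longlonglongrightarrow> f (\<phi> t0 z0)"
    using holomorphic_on_imp_continuous_on[OF bergman_holo[OF f]]
      boundary_symbol.\<phi>_in[OF symbol[OF t(1)] z(1)] boundary_symbol.\<phi>_in[OF symbol[OF t(2)] z(2)]
    by (intro continuous_on_tendsto_compose[OF _ \<phi>_tendsto[OF t z]]) auto
  then show ?thesis
    unfolding wcomp_def by (intro tendsto_mult u_tendsto[OF t z])
qed

lemma S_tendsto_pointwise:
  assumes t: "\<And>k. t k \<in> I" "t0 \<in> I" "t \<longlonglongrightarrow> t0" and f: "f \<in> X"
  shows "(\<lambda>k. S (t k) f z) \<longlonglongrightarrow> S t0 f z"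
proof (cases "z \<in> ball 0 1")
  case True
  then show ?thesis using S_tendsto[OF t, of "\<lambda>_. z" z f] f by simp
next
  case False
  then show ?thesis using bergman_zero[OF SX[OF _ f]] t by simp
qed

text \<open>Measurability in both variables at once, as Fubini's theorem demands in Minkowski's
  integral inequality; measurability of the norms and of the sections in t follows from it.\<close>

definition joint :: "(real \<Rightarrow> complex \<Rightarrow> complex) \<Rightarrow> bool" where
  "joint G \<longleftrightarrow> (\<lambda>(t, z). G t z) \<in> borel_measurable (M \<Otimes>\<^sub>M \<mu>)"

lemma joint_diff: "joint F \<Longrightarrow> joint G \<Longrightarrow> joint (\<lambda>t z. F t z - G t z)"
  unfolding joint_def case_prod_unfold by simp

lemma joint_mult:
  assumes "a \<in> borel_measurable M" "w \<in> borel_measurable borel" "joint G"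
  shows "joint (\<lambda>t z. a t * w z * G t z)"
proof -
  have [measurable]: "a \<in> borel_measurable M" "w \<in> borel_measurable \<mu>" using assms by simp_all
  have [measurable]: "(\<lambda>x. G (fst x) (snd x)) \<in> borel_measurable (M \<Otimes>\<^sub>M \<mu>)"
    using assms(3) by (simp add: joint_def case_prod_unfold)
  show ?thesis unfolding joint_def case_prod_unfold by measurable
qed

text \<open>Joint sequential continuity on the open product of interval and disc suffices, since off
  the disc all these functions vanish.\<close>

lemma joint_S:
  assumes f: "f \<in> X"
  shows "joint (\<lambda>t. S t f)"
proof -
  have cont: "continuous_on (I \<times> ball 0 1) (\<lambda>x. S (fst x) f (snd x))"
    unfolding continuous_on_sequentially
  proof (intro allI ballI impI, elim conjE)
    fix x :: "nat \<Rightarrow> real \<times> complex" and a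
    assume "a \<in> I \<times> ball 0 1" "\<forall>n. x n \<in> I \<times> ball 0 1" and lim: "x \<longlonglongrightarrow> a"
    then have m: "fst (x n) \<in> I" "snd (x n) \<in> ball 0 1" "fst a \<in> I" "snd a \<in> ball 0 1" for n
      by (auto simp: mem_Times_iff)
    show "((\<lambda>x. S (fst x) f (snd x)) \<circ> x) \<longlonglongrightarrow> S (fst a) f (snd a)"
      unfolding o_def by (rule S_tendsto[OF m(1,3) tendsto_fst[OF lim] m(2,4) tendsto_snd[OF lim] f])
  qed
  have "open (I \<times> ball (0::complex) 1)" by (intro open_Times) auto
  then have "(\<lambda>x. indicator (I \<times> ball 0 1) x *\<^sub>R S (fst x) f (snd x)) \<in> borel_measurable borel"
    by (intro borel_measurable_continuous_on_indicator cont) auto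
  then have b: "(\<lambda>x. indicator (I \<times> ball 0 1) x *\<^sub>R S (fst x) f (snd x)) \<in> borel_measurable (borel \<Otimes>\<^sub>M borel)"
    by (simp add: borel_prod)
  have "(\<lambda>x. x) \<in> measurable M borel" by (rule measurable_restrict_space1) simp
  moreover have "(\<lambda>x. x) \<in> measurable \<mu> borel" by simp
  ultimately have "(\<lambda>x. (fst x, snd x)) \<in> measurable (M \<Otimes>\<^sub>M \<mu>) (borel \<Otimes>\<^sub>M borel)"
    by (intro measurable_Pair measurable_compose[OF measurable_fst] measurable_compose[OF measurable_snd])
  from measurable_compose[OF this b]
  have c: "(\<lambda>x. indicator (I \<times> ball 0 1) x *\<^sub>R S (fst x) f (snd x)) \<in> borel_measurable (M \<Otimes>\<^sub>M \<mu>)" by simp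
  show ?thesis
    unfolding joint_def case_prod_unfold
  proof (rule measurable_cong[THEN iffD1, OF _ c])
    fix x assume "x \<in> space (M \<Otimes>\<^sub>M \<mu>)"
    then have t: "fst x \<in> I" by (auto simp: space_pair_measure space_M)
    show "indicator (I \<times> ball 0 1) x *\<^sub>R S (fst x) f (snd x) = S (fst x) f (snd x)"
      using t bergman_zero[OF SX[OF t f], of "snd x"] by (cases x) (auto simp: indicator_def)
  qed
qed

lemma joint_N_measurable:
  assumes "joint G"
  shows "(\<lambda>t. N (G t)) \<in> borel_measurable M"
proof -
  have [measurable]: "(\<lambda>x. G (fst x) (snd x)) \<in> borel_measurable (M \<Otimes>\<^sub>M \<mu>)"
    using assms by (simp add: joint_def case_prod_unfold)
  have "(\<lambda>t. \<integral>z. cmod (G t z) powr p \<partial>\<mu>) \<in> borel_measurable M"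
    by (rule M.borel_measurable_lebesgue_integral) (simp add: case_prod_unfold)
  then show ?thesis unfolding bergman_norm_def by measurable
qed

lemma joint_section: "joint G \<Longrightarrow> (\<lambda>t. G t z) \<in> borel_measurable M"
proof -
  assume G: "joint G"
  have "z \<in> space \<mu>" by simp
  from measurable_compose[OF measurable_Pair2'[OF this] G[unfolded joint_def]]
  show "(\<lambda>t. G t z) \<in> borel_measurable M" by simp
qed

lemma integral_bounded_by:
  assumes G: "joint G" "\<And>t. t \<in> I \<Longrightarrow> G t \<in> X" and B: "(\<integral>\<^sup>+t. ennreal (N (G t)) \<partial>M) \<le> ennreal B" "B \<ge> 0"
  shows "bounded_by (\<lambda>z. \<integral>t. G t z \<partial>M) B"
  by (rule lp_bound_integral[OF p finite_measure_M M.sigma_finite_measure_axioms G(1)[unfolded joint_def] joint_N_measurable[OF G(1)] _ B])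
     (use bergman_lp[OF G(2)] in \<open>auto simp: space_M\<close>)

text \<open>Evaluation at z is bounded by the norm, so integrable norms give integrability at every
  point z, not merely almost everywhere.\<close>

lemma section_integrable:
  assumes G: "joint G" "\<And>t. t \<in> I \<Longrightarrow> G t \<in> X" and fin: "(\<integral>\<^sup>+t. ennreal (N (G t)) \<partial>M) < \<infinity>"
  shows "integrable M (\<lambda>t. G t z)"
proof -
  obtain C where C: "\<And>f. f \<in> X \<Longrightarrow> cmod (f z) \<le> C * N f" using evaluation_bound_at[of z] by blast
  have "(\<integral>\<^sup>+t. ennreal (cmod (G t z)) \<partial>M) \<le> (\<integral>\<^sup>+t. ennreal \<bar>C\<bar> * ennreal (N (G t)) \<partial>M)"
  proof (rule nn_integral_mono)
    fix t assume "t \<in> space M"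
    then have "cmod (G t z) \<le> C * N (G t)" using G(2) C by (auto simp: space_M)
    also have "\<dots> \<le> \<bar>C\<bar> * N (G t)" by (intro mult_right_mono) auto
    finally show "ennreal (cmod (G t z)) \<le> ennreal \<bar>C\<bar> * ennreal (N (G t))"
      by (simp add: ennreal_leI flip: ennreal_mult)
  qed
  also have "\<dots> = ennreal \<bar>C\<bar> * (\<integral>\<^sup>+t. ennreal (N (G t)) \<partial>M)"
    using joint_N_measurable[OF G(1)] by (intro nn_integral_cmult) simp
  also have "\<dots> < \<infinity>" using fin by (simp add: ennreal_mult_less_top)
  finally show ?thesis using joint_section[OF G(1)] by (intro integrableI_bounded) auto
qed

end

section \<open>Measurability and approximation by simple functions\<close>

lemma ennreal_tendsto_0_imp_real:
  assumes "(a :: nat \<Rightarrow> ennreal) \<longlonglongrightarrow> 0"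
  obtains k0 where "\<And>i. i \<ge> k0 \<Longrightarrow> a i \<le> ennreal (enn2real (a i))" "\<And>i. i \<ge> k0 \<Longrightarrow> enn2real (a i) \<le> 1" "(\<lambda>i. enn2real (a i)) \<longlonglongrightarrow> 0"
proof -
  have "eventually (\<lambda>i. a i < 1) sequentially" using assms by (rule order_tendstoD(2)) simp
  then obtain k0 where k0: "\<And>i. i \<ge> k0 \<Longrightarrow> a i < 1" by (auto simp: eventually_sequentially)
  have top: "a i < top" if "i \<ge> k0" for i using k0[OF that] ennreal_one_less_top less_trans by blast
  have "(\<lambda>i. enn2real (a i)) \<longlonglongrightarrow> enn2real 0" using assms by (intro tendsto_enn2real) auto
  moreover have "enn2real (a i) \<le> 1" if "i \<ge> k0" for i
    using enn2real_mono[of "a i" 1] k0[OF that] by (simp add: less_imp_le)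
  ultimately show ?thesis using that[of k0] top by simp
qed

text \<open>The graph of \<open>n\<close> is a subset of the plane and hence separable, however
  irregular \<open>n\<close> may be; a dense sequence in the graph approximates parameters and
  values simultaneously.\<close>

lemma countable_graph_dense:
  fixes n :: "real \<Rightarrow> real"
  assumes "A \<noteq> {}"
  obtains \<tau> :: "nat \<Rightarrow> real" where "\<And>k. \<tau> k \<in> A"
    "\<And>t. t \<in> A \<Longrightarrow> \<exists>x. range x \<subseteq> range \<tau> \<and> x \<longlonglongrightarrow> t \<and> (\<lambda>j. n (x j)) \<longlonglongrightarrow> n t"
proof -
  define P where "P = (\<lambda>t. (t, n t)) ` A"
  obtain T where T: "countable T" "T \<subseteq> P" "P \<subseteq> closure T"
    by (rule separable[of P])
  have "T \<noteq> {}" using T(3) assms by (auto simp: P_def)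
  define \<tau> where "\<tau> k = fst (from_nat_into T k)" for k
  have TP: "\<exists>t\<in>A. y = (t, n t)" if "y \<in> T" for y using T(2) that by (auto simp: P_def)
  have \<tau>: "\<tau> k \<in> A" for k
    using TP[OF from_nat_into[OF \<open>T \<noteq> {}\<close>, of k]] by (auto simp: \<tau>_def)
  have "\<exists>x. range x \<subseteq> range \<tau> \<and> x \<longlonglongrightarrow> t \<and> (\<lambda>j. n (x j)) \<longlonglongrightarrow> n t" if t: "t \<in> A" for t
  proof -
    have "(t, n t) \<in> closure T" using T(3) t by (auto simp: P_def)
    then obtain y where y: "\<And>j. y j \<in> T" "y \<longlonglongrightarrow> (t, n t)" by (auto simp: closure_sequential)
    have eq: "y j = (fst (y j), n (fst (y j)))" for j using TP[OF y(1)[of j]] by auto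
    have "fst (y j) \<in> range \<tau>" for j
    proof -
      obtain k where "from_nat_into T k = y j" using from_nat_into_surj[OF T(1) y(1)] by blast
      then have "fst (y j) = \<tau> k" by (simp add: \<tau>_def)
      then show ?thesis by (rule range_eqI)
    qed
    moreover have "(\<lambda>j. fst (y j)) \<longlonglongrightarrow> t" using tendsto_fst[OF y(2)] by simp
    moreover have "(\<lambda>j. n (fst (y j))) \<longlonglongrightarrow> n t"
    proof -
      have "(\<lambda>j. snd (y j)) \<longlonglongrightarrow> n t" using tendsto_snd[OF y(2)] by simp
      moreover have "snd (y j) = n (fst (y j))" for j by (subst eq) simp
      ultimately show ?thesis by simp
    qed
    ultimately show ?thesis by (intro exI[of _ "\<lambda>j. fst (y j)"]) auto
  qed
  then show ?thesis using that \<tau> by blast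
qed

context admissible_family begin

text \<open>The finite sum over the values becomes a pointwise integral over t, to which Minkowski's
  integral inequality applies.\<close>

lemma simple_joint:
  assumes s: "simple_function M s" "s ` space M \<subseteq> X"
  shows "joint s" and "simple_integral_in M s z = (\<integral>t. s t z \<partial>M)" and "integrable M (\<lambda>t. s t z)"
proof -
  define R where "R = s ` space M"
  have fin: "finite R" using s(1) by (simp add: R_def simple_function_def)
  have sets: "s -` {y} \<inter> space M \<in> sets M" for y using s(1) by (rule simple_functionD)
  have sets': "{t \<in> space M. s t = y} \<in> sets M" for y
    using sets[of y] by (simp add: vimage_def Int_def conj_commute)
  have rep: "s t z = (\<Sum>y\<in>R. indicator {t \<in> space M. s t = y} t *\<^sub>R y z)" if "t \<in> space M" for t z
  proof -
    have "(\<Sum>y\<in>R. indicator {t \<in> space M. s t = y} t *\<^sub>R y z) = (\<Sum>y\<in>R. if y = s t then y z else 0)"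
      using that by (intro sum.cong) (auto simp: indicator_def)
    also have "\<dots> = s t z" using fin that by (simp add: R_def)
    finally show ?thesis by simp
  qed
  have "(\<lambda>x. \<Sum>y\<in>R. indicator {t \<in> space M. s t = y} (fst x) *\<^sub>R y (snd x)) \<in> borel_measurable (M \<Otimes>\<^sub>M \<mu>)"
  proof (intro borel_measurable_sum borel_measurable_scaleR)
    fix y assume y: "y \<in> R"
    show "(\<lambda>x. indicator {t \<in> space M. s t = y} (fst x) :: real) \<in> borel_measurable (M \<Otimes>\<^sub>M \<mu>)"
      using measurable_compose[OF measurable_fst borel_measurable_indicator[OF sets']] .
    have "y \<in> borel_measurable \<mu>" using bergman_measurable[of y] y s(2) by (auto simp: R_def)
    then show "(\<lambda>x. y (snd x)) \<in> borel_measurable (M \<Otimes>\<^sub>M \<mu>)"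
      by (rule measurable_compose[OF measurable_snd])
  qed
  then show "joint s"
    unfolding joint_def case_prod_unfold
    by (rule measurable_cong[THEN iffD1, rotated]) (use rep in \<open>auto simp: space_pair_measure\<close>)
  have int: "integrable M (\<lambda>t. indicator {t \<in> space M. s t = y} t *\<^sub>R y z)" for y
    using sets'[of y] T.emeasure_finite by (intro integrable_scaleR_left integrable_real_indicator) (auto simp: less_top[symmetric])
  have "integrable M (\<lambda>t. \<Sum>y\<in>R. indicator {t \<in> space M. s t = y} t *\<^sub>R y z)"
    by (intro Bochner_Integration.integrable_sum int)
  then show "integrable M (\<lambda>t. s t z)"
    by (rule Bochner_Integration.integrable_cong[THEN iffD1, OF refl, rotated]) (use rep in auto)
  have "(\<integral>t. s t z \<partial>M) = (\<integral>t. (\<Sum>y\<in>R. indicator {t \<in> space M. s t = y} t *\<^sub>R y z) \<partial>M)"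
    by (rule Bochner_Integration.integral_cong) (use rep in auto)
  also have "\<dots> = (\<Sum>y\<in>R. \<integral>t. indicator {t \<in> space M. s t = y} t *\<^sub>R y z \<partial>M)"
    by (rule Bochner_Integration.integral_sum) (rule int)
  also have "\<dots> = (\<Sum>y\<in>R. measure M {t \<in> space M. s t = y} *\<^sub>R y z)"
  proof (intro sum.cong refl)
    fix y
    have "integrable M (indicat_real {t \<in> space M. s t = y})"
      using sets'[of y] T.emeasure_finite by (intro integrable_real_indicator) (auto simp: less_top[symmetric])
    then have "(\<integral>t. indicat_real {t \<in> space M. s t = y} t *\<^sub>R y z \<partial>M) = (\<integral>t. indicat_real {t \<in> space M. s t = y} t \<partial>M) *\<^sub>R y z"
      by (intro integral_scaleR_left)
    also have "(\<integral>t. indicat_real {t \<in> space M. s t = y} t \<partial>M) = measure M ({t \<in> space M. s t = y} \<inter> space M)"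
      by (rule Bochner_Integration.integral_indicator)
    also have "{t \<in> space M. s t = y} \<inter> space M = {t \<in> space M. s t = y}" by auto
    finally show "(\<integral>t. indicat_real {t \<in> space M. s t = y} t *\<^sub>R y z \<partial>M) = measure M {t \<in> space M. s t = y} *\<^sub>R y z" .
  qed
  finally show "simple_integral_in M s z = (\<integral>t. s t z \<partial>M)"
    by (simp add: simple_integral_in_def R_def scaleR_conv_of_real)
qed

lemma simple_integral_bergman:
  assumes s: "simple_function M s" "s ` space M \<subseteq> X"
  shows "simple_integral_in M s \<in> X"
proof -
  have "(\<lambda>z. \<Sum>y\<in>R. complex_of_real (measure M {t \<in> space M. s t = y}) * y z) \<in> X"
    if "finite R" "R \<subseteq> X" for R
    using that by (induction R) (auto intro: bergman_zero_fun bergman_add bergman_cmult)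
  then show ?thesis
    using s unfolding simple_integral_in_def by (simp add: simple_function_def)
qed

lemma nn_integral_M: "(\<integral>\<^sup>+t. f t \<partial>M) = (\<integral>\<^sup>+t\<in>I. f t \<partial>lborel)"
  by (rule nn_integral_restrict_space) simp

lemma op_norm_integral_finite: "(\<integral>\<^sup>+t. op_norm X N (S t) \<partial>M) < \<infinity>"
  using adm unfolding nn_integral_M admissible_def by blast

lemma S_bounded: "t \<in> I \<Longrightarrow> S t \<in> bounded_operators X N"
  by (rule boundary_symbol.S_bounded[OF symbol])

text \<open>Lower semicontinuity in t: for each f, pointwise convergence along a sequence of
  parameters together with Fatou's lemma preserves the bound. This provides measurability for a
  supremum over uncountably many f.\<close>

lemma peak_op_closed:
  assumes "l \<in> I" "l \<in> closure {t \<in> I. op_norm X N (\<lambda>f z. peak \<xi> n z * S t f z) \<le> a}"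
  shows "op_norm X N (\<lambda>f z. peak \<xi> n z * S l f z) \<le> a"
proof -
  obtain x where "\<And>k. x k \<in> {t \<in> I. op_norm X N (\<lambda>f z. peak \<xi> n z * S t f z) \<le> a}" "x \<longlonglongrightarrow> l"
    using assms(2) unfolding closure_sequential by blast
  then have x: "\<And>k. x k \<in> I" "\<And>k. op_norm X N (\<lambda>f z. peak \<xi> n z * S (x k) f z) \<le> a" and l: "l \<in> I" "x \<longlonglongrightarrow> l"
    using assms(1) by auto
  have "ennreal (N (\<lambda>z. peak \<xi> n z * S l f z)) \<le> a" if f: "f \<in> X" "N f \<le> 1" for f
  proof (cases "a = \<infinity>")
    case False
    then obtain b where b: "a = ennreal b" "b \<ge> 0" by (cases a) auto
    have "N (\<lambda>z. peak \<xi> n z * S l f z) \<le> b"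
    proof (rule bergman_fatou(2)[where f = "\<lambda>k z. peak \<xi> n z * S (x k) f z"])
      show "(\<lambda>z. peak \<xi> n z * S (x k) f z) \<in> X" for k by (intro bergman_peak \<xi> SX x f)
      show "N (\<lambda>z. peak \<xi> n z * S (x k) f z) \<le> b" for k
      proof -
        have "ennreal (N (\<lambda>z. peak \<xi> n z * S (x k) f z)) \<le> ennreal b"
          using order_trans[OF op_norm_upper[OF f, of "\<lambda>f z. peak \<xi> n z * S (x k) f z"] x(2)[of k]] b by simp
        then show ?thesis using b by simp
      qed
      show "(\<lambda>k. peak \<xi> n z * S (x k) f z) \<longlonglongrightarrow> peak \<xi> n z * S l f z" for z
        by (intro tendsto_mult_left S_tendsto_pointwise x l f)
      show "(\<lambda>z. peak \<xi> n z * S l f z) holomorphic_on ball 0 1"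
        by (intro bergman_holo bergman_peak \<xi> SX l f)
    qed
    then show ?thesis using b by (simp add: ennreal_leI)
  qed simp
  then show ?thesis
    unfolding op_norm_def by (intro SUP_least) auto
qed

lemma peak_op_measurable: "(\<lambda>t. op_norm X N (\<lambda>f z. peak \<xi> n z * S t f z)) \<in> borel_measurable M"
proof (rule borel_measurableI_le)
  fix a
  define U where "U = closure {t \<in> I. op_norm X N (\<lambda>f z. peak \<xi> n z * S t f z) \<le> a}"
  have U: "{t \<in> I. op_norm X N (\<lambda>f z. peak \<xi> n z * S t f z) \<le> a} = I \<inter> U"
  proof (intro set_eqI iffI)
    fix l assume l: "l \<in> {t \<in> I. op_norm X N (\<lambda>f z. peak \<xi> n z * S t f z) \<le> a}"
    then have "l \<in> U" unfolding U_def by (rule subsetD[OF closure_subset])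
    with l show "l \<in> I \<inter> U" by simp
  next
    fix l assume "l \<in> I \<inter> U"
    then have "l \<in> I" "l \<in> U" by simp_all
    then show "l \<in> {t \<in> I. op_norm X N (\<lambda>f z. peak \<xi> n z * S t f z) \<le> a}"
      using peak_op_closed[of l n a] unfolding U_def by simp
  qed
  have "I \<inter> U \<in> sets lborel" unfolding U_def by auto
  then show "{t \<in> space M. op_norm X N (\<lambda>f z. peak \<xi> n z * S t f z) \<le> a} \<in> sets M"
    unfolding space_M U by (subst sets_restrict_space_iff) auto
qed

lemma op_norm_measurable: "(\<lambda>t. op_norm X N (S t)) \<in> borel_measurable M"
  \<comment> \<open>The peak function with exponent 0 is constantly 1.\<close>
  using peak_op_measurable[of 0] by (simp add: peak_def)

lemma N_S_integral:
  assumes f: "f \<in> X"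
  shows "(\<integral>\<^sup>+t. ennreal (N (S t f)) \<partial>M) \<le> (\<integral>\<^sup>+t. op_norm X N (S t) \<partial>M) * ennreal (N f)"
proof -
  have "(\<integral>\<^sup>+t. ennreal (N (S t f)) \<partial>M) \<le> (\<integral>\<^sup>+t. op_norm X N (S t) * ennreal (N f) \<partial>M)"
    by (intro nn_integral_mono op_norm_bound S_bounded f) (simp add: space_M)
  also have "\<dots> = (\<integral>\<^sup>+t. op_norm X N (S t) \<partial>M) * ennreal (N f)"
    by (rule nn_integral_multc[OF op_norm_measurable])
  finally show ?thesis .
qed

lemma N_S_integral_finite:
  assumes f: "f \<in> X" shows "(\<integral>\<^sup>+t. ennreal (N (S t f)) \<partial>M) < \<infinity>"
  by (rule le_less_trans[OF N_S_integral[OF f]])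
     (use op_norm_integral_finite in \<open>simp add: ennreal_mult_less_top\<close>)

text \<open>
  As \<open>S t f\<close> depends continuously on \<open>t\<close> pointwise, it is norm continuous along those sequences
  along which its norm converges. Its range is therefore separable because the graph of
  \<open>t \<mapsto> \<parallel>S t f\<parallel>\<close>, a subset of the plane, is.
\<close>

lemma range_separable:
  assumes f: "f \<in> X"
  obtains \<tau> :: "nat \<Rightarrow> real" where "\<And>k. \<tau> k \<in> I"
    "\<And>t e. t \<in> I \<Longrightarrow> e > 0 \<Longrightarrow> \<exists>k. N (\<lambda>z. S t f z - S (\<tau> k) f z) < e"
proof -
  obtain \<tau> :: "nat \<Rightarrow> real" where \<tau>: "\<And>k. \<tau> k \<in> I"
    "\<And>t. t \<in> I \<Longrightarrow> \<exists>x. range x \<subseteq> range \<tau> \<and> x \<longlonglongrightarrow> t \<and> (\<lambda>j. N (S (x j) f)) \<longlonglongrightarrow> N (S t f)"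
    by (rule countable_graph_dense[of I "\<lambda>t. N (S t f)"]) auto
  have "\<exists>k. N (\<lambda>z. S t f z - S (\<tau> k) f z) < e" if t: "t \<in> I" and e: "e > 0" for t e
  proof -
    obtain x where x: "range x \<subseteq> range \<tau>" "x \<longlonglongrightarrow> t" "(\<lambda>j. N (S (x j) f)) \<longlonglongrightarrow> N (S t f)"
      using \<tau>(2)[OF t] by blast
    have xI: "x j \<in> I" for j
    proof -
      obtain k where "x j = \<tau> k" using x(1) by blast
      then show ?thesis by (simp only: \<tau>(1))
    qed
    have "(\<lambda>j. N (\<lambda>z. S (x j) f z - S t f z)) \<longlonglongrightarrow> 0"
      by (rule bergman_riesz[OF SX[OF xI f] SX[OF t f] S_tendsto_pointwise[OF xI t x(2) f] x(3)])
    then have "eventually (\<lambda>j. N (\<lambda>z. S (x j) f z - S t f z) < e) sequentially"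
      by (rule order_tendstoD(2)) (use e in auto)
    then obtain j where j: "N (\<lambda>z. S (x j) f z - S t f z) < e" by (auto simp: eventually_sequentially)
    obtain k where "x j = \<tau> k" using x(1) by blast
    moreover have "N (\<lambda>z. S t f z - S (x j) f z) = N (\<lambda>z. S (x j) f z - S t f z)"
      using bergman_cmult(2)[OF bergman_diff(1)[OF SX[OF xI f] SX[OF t f]], of "- 1"] by simp
    ultimately show ?thesis using j by metis
  qed
  then show ?thesis using that \<tau>(1) by blast
qed

lemma joint_const: "g \<in> X \<Longrightarrow> joint (\<lambda>t. g)"
proof -
  assume "g \<in> X"
  then have "g \<in> borel_measurable \<mu>" using bergman_measurable by simp
  then show ?thesis unfolding joint_def case_prod_unfold by (rule measurable_compose[OF measurable_snd])
qed

text \<open>At stage i the value at t is the best approximation of \<open>S t f\<close> among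
  \<open>y 0\<close>, ..., \<open>y i\<close>. The errors tend to 0 by density, and the candidate
  \<open>y 0\<close>, the zero function, keeps them below \<open>N (S t f)\<close>, which is an
  integrable majorant.\<close>

lemma simple_approximation:
  assumes f: "f \<in> X"
  obtains s where "\<And>i. simple_function M (s i)" "\<And>i. s i ` space M \<subseteq> X"
    "(\<lambda>i. \<integral>\<^sup>+t. ennreal (N (\<lambda>z. S t f z - s i t z)) \<partial>M) \<longlonglongrightarrow> 0"
proof -
  obtain \<tau> :: "nat \<Rightarrow> real" where \<tau>: "\<And>k. \<tau> k \<in> I"
    "\<And>t e. t \<in> I \<Longrightarrow> e > 0 \<Longrightarrow> \<exists>k. N (\<lambda>z. S t f z - S (\<tau> k) f z) < e"
    using range_separable[OF f] by blast
  define y where "y j = (case j of 0 \<Rightarrow> (\<lambda>z. 0) | Suc k \<Rightarrow> S (\<tau> k) f)" for j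
  have yX: "y j \<in> X" for j
    by (cases j) (auto simp: y_def bergman_zero_fun SX[OF \<tau>(1) f])
  define D where "D j t = N (\<lambda>z. S t f z - y j z)" for j t
  have [measurable]: "D j \<in> borel_measurable M" for j
    unfolding D_def by (intro joint_N_measurable joint_diff joint_S f joint_const yX)
  define P where "P i t j \<longleftrightarrow> j \<le> i \<and> (\<forall>l\<le>i. D j t \<le> D l t)" for i t j
  \<comment> \<open>Taking the least index among equally good candidates makes the selection
    measurable.\<close>
  define m where "m i t = (LEAST j. P i t j)" for i t
  have ex: "\<exists>j. P i t j" for i t
  proof -
    have "Min ((\<lambda>j. D j t) ` {..i}) \<in> (\<lambda>j. D j t) ` {..i}" by (intro Min_in) auto
    then obtain j where j: "Min ((\<lambda>j. D j t) ` {..i}) = D j t" "j \<in> {..i}" by (rule imageE)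
    have "D j t \<le> D l t" if "l \<le> i" for l
      using Min_le[of "(\<lambda>j. D j t) ` {..i}" "D l t"] that unfolding j(1) by simp
    with j(2) show ?thesis unfolding P_def by blast
  qed
  have m: "m i t \<le> i" "\<And>l. l \<le> i \<Longrightarrow> D (m i t) t \<le> D l t" for i t
  proof -
    have "P i t (m i t)" unfolding m_def by (rule LeastI_ex[OF ex])
    then show "m i t \<le> i" "\<And>l. l \<le> i \<Longrightarrow> D (m i t) t \<le> D l t" unfolding P_def by blast+
  qed
  have m_measurable: "m i \<in> measurable M (count_space UNIV)" for i
    unfolding m_def P_def by measurable
  have "simple_function M (m i)" for i
    unfolding simple_function_def
  proof
    show "finite (m i ` space M)" by (rule finite_subset[of _ "{..i}"]) (use m in auto)
    have "m i -` {x} \<inter> space M \<in> sets M" for x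
      by (rule measurable_sets[OF m_measurable]) simp
    then show "\<forall>x\<in>m i ` space M. m i -` {x} \<inter> space M \<in> sets M" by blast
  qed
  then have simple: "simple_function M (\<lambda>t. y (m i t))" for i
    by (rule simple_function_compose1)
  have sub: "(\<lambda>t. y (m i t)) ` space M \<subseteq> X" for i using yX by auto
  have meas: "(\<lambda>t. N (\<lambda>z. S t f z - y (m i t) z)) \<in> borel_measurable M" for i
    by (intro joint_N_measurable joint_diff joint_S f simple_joint(1)[OF simple sub])
  have lim: "(\<lambda>i. N (\<lambda>z. S t f z - y (m i t) z)) \<longlonglongrightarrow> 0" if t: "t \<in> I" for t
  proof (rule N_tendsto_0I)
    fix e :: real assume "e > 0"
    then obtain k where k: "N (\<lambda>z. S t f z - S (\<tau> k) f z) < e" using \<tau>(2)[OF t] by blast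
    have "N (\<lambda>z. S t f z - y (m i t) z) \<le> e" if "i \<ge> Suc k" for i
      using m(2)[OF that, of t] k by (simp add: D_def y_def)
    then show "eventually (\<lambda>i. N (\<lambda>z. S t f z - y (m i t) z) \<le> e) sequentially"
      unfolding eventually_sequentially by blast
  qed
  have "(\<lambda>i. \<integral>\<^sup>+t. ennreal (N (\<lambda>z. S t f z - y (m i t) z)) \<partial>M) \<longlonglongrightarrow> (\<integral>\<^sup>+t. 0 \<partial>M)"
  proof (rule nn_integral_dominated_convergence[where w = "\<lambda>t. ennreal (N (S t f))"])
    show "(\<lambda>t. ennreal (N (\<lambda>z. S t f z - y (m i t) z))) \<in> borel_measurable M" for i using meas by simp
    show "(\<lambda>t. ennreal (N (S t f))) \<in> borel_measurable M" using joint_N_measurable[OF joint_S[OF f]] by simp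
    show "(\<integral>\<^sup>+t. ennreal (N (S t f)) \<partial>M) < \<infinity>" by (rule N_S_integral_finite[OF f])
    show "AE t in M. ennreal (N (\<lambda>z. S t f z - y (m j t) z)) \<le> ennreal (N (S t f))" for j
      using m(2)[of 0 j] by (intro AE_I2 ennreal_leI) (simp add: D_def y_def)
    show "AE t in M. (\<lambda>i. ennreal (N (\<lambda>z. S t f z - y (m i t) z))) \<longlonglongrightarrow> 0"
      using tendsto_ennrealI[OF lim] by (intro AE_I2) (auto simp: space_M)
  qed simp
  then show ?thesis using that[OF simple sub] by simp
qed

section \<open>The pointwise integral as vector-valued integral\<close>

definition TI :: "(complex \<Rightarrow> complex) \<Rightarrow> complex \<Rightarrow> complex" where
  "TI f z = (\<integral>t. S t f z \<partial>M)"

text \<open>The first bound is in the sense of \<open>lp_bound\<close> because \<open>TI f\<close>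
  is not yet known to be holomorphic; the second, through point evaluations, gives convergence at
  each z and serves to identify a limit.\<close>

lemma simple_integral_diff_bound:
  assumes f: "f \<in> X" and s: "simple_function M s" "s ` space M \<subseteq> X"
    and B: "(\<integral>\<^sup>+t. ennreal (N (\<lambda>z. S t f z - s t z)) \<partial>M) \<le> ennreal B" "B \<ge> 0"
  shows "bounded_by (\<lambda>z. TI f z - simple_integral_in M s z) B"
    and "\<And>z C. (\<And>g. g \<in> X \<Longrightarrow> cmod (g z) \<le> C * N g) \<Longrightarrow> C \<ge> 0 \<Longrightarrow> cmod (TI f z - simple_integral_in M s z) \<le> C * B"
proof -
  have j: "joint (\<lambda>t z. S t f z - s t z)" by (intro joint_diff joint_S f simple_joint(1)[OF s])
  have GX: "(\<lambda>z. S t f z - s t z) \<in> X" if "t \<in> I" for t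
    using s(2) that by (intro bergman_diff SX f) (auto simp: space_M)
  have eq: "(\<integral>t. S t f z - s t z \<partial>M) = TI f z - simple_integral_in M s z" for z
    unfolding TI_def simple_joint(2)[OF s]
    by (intro Bochner_Integration.integral_diff simple_joint(3)[OF s] section_integrable joint_S f SX N_S_integral_finite)
  show "bounded_by (\<lambda>z. TI f z - simple_integral_in M s z) B"
    using integral_bounded_by[OF j GX B] unfolding eq .
  fix z C assume C: "\<And>g. g \<in> X \<Longrightarrow> cmod (g z) \<le> C * N g" and C0: "(C::real) \<ge> 0"
  have fin: "(\<integral>\<^sup>+t. ennreal (N (\<lambda>z. S t f z - s t z)) \<partial>M) < \<infinity>" using B by (auto intro: le_less_trans)
  have "ennreal (cmod (\<integral>t. S t f z - s t z \<partial>M)) \<le> (\<integral>\<^sup>+t. ennreal (cmod (S t f z - s t z)) \<partial>M)"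
    by (rule integral_norm_bound_ennreal[OF section_integrable[OF j GX fin]])
  also have "\<dots> \<le> (\<integral>\<^sup>+t. ennreal C * ennreal (N (\<lambda>z. S t f z - s t z)) \<partial>M)"
    by (intro nn_integral_mono) (use C[OF GX] C0 in \<open>auto simp: space_M ennreal_leI simp flip: ennreal_mult\<close>)
  also have "\<dots> = ennreal C * (\<integral>\<^sup>+t. ennreal (N (\<lambda>z. S t f z - s t z)) \<partial>M)"
    using joint_N_measurable[OF j] by (intro nn_integral_cmult) simp
  also have "\<dots> \<le> ennreal C * ennreal B" by (intro mult_left_mono B) simp
  also have "\<dots> = ennreal (C * B)" using C0 B by (simp add: ennreal_mult)
  finally show "cmod (TI f z - simple_integral_in M s z) \<le> C * B" unfolding eq using C0 B by simp
qed

text \<open>Holomorphy is not visible from the pointwise integral. The simple integrals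
  \<open>J i\<close> are elements of \<open>X\<close> with bounded norms, so Montel's theorem
  provides a limit in \<open>X\<close>, and pointwise convergence identifies it with
  \<open>TI f\<close>.\<close>

lemma TI_bergman:
  assumes f: "f \<in> X"
  shows "TI f \<in> X"
proof -
  obtain s where s: "\<And>i. simple_function M (s i)" "\<And>i. s i ` space M \<subseteq> X"
    and lim: "(\<lambda>i. \<integral>\<^sup>+t. ennreal (N (\<lambda>z. S t f z - s i t z)) \<partial>M) \<longlonglongrightarrow> 0"
    using simple_approximation[OF f] by blast
  define a where "a i = (\<integral>\<^sup>+t. ennreal (N (\<lambda>z. S t f z - s i t z)) \<partial>M)" for i
  obtain k0 where k0: "\<And>i. i \<ge> k0 \<Longrightarrow> a i \<le> ennreal (enn2real (a i))" "\<And>i. i \<ge> k0 \<Longrightarrow> enn2real (a i) \<le> 1" "(\<lambda>i. enn2real (a i)) \<longlonglongrightarrow> 0"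
    by (rule ennreal_tendsto_0_imp_real[OF lim[folded a_def]]) (rule that)
  \<comment> \<open>The shift by \<open>k0\<close> skips the indices at which the approximation
    error may be infinite.\<close>
  define J where "J i = simple_integral_in M (s (i + k0))" for i
  have JX: "J i \<in> X" for i unfolding J_def by (rule simple_integral_bergman[OF s])
  have J_lim: "(\<lambda>i. J i z) \<longlonglongrightarrow> TI f z" for z
  proof -
    obtain C0 where C0: "\<And>g. g \<in> X \<Longrightarrow> cmod (g z) \<le> C0 * N g" using evaluation_bound_at[of z] by blast
    define C where "C = max C0 0"
    have C: "cmod (g z) \<le> C * N g" if "g \<in> X" for g
      using C0[OF that] mult_right_mono[of C0 C "N g"] by (simp add: C_def)
    have le: "cmod (TI f z - J i z) \<le> C * enn2real (a (i + k0))" for i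
      unfolding J_def
      by (rule simple_integral_diff_bound(2)[OF f s]) (simp_all add: a_def[symmetric] k0 C, simp add: C_def)
    have lim0: "(\<lambda>i. C * enn2real (a (i + k0))) \<longlonglongrightarrow> 0"
      using tendsto_mult_left[OF LIMSEQ_ignore_initial_segment[OF k0(3), of k0], of C] by simp
    have "(\<lambda>i. TI f z - J i z) \<longlonglongrightarrow> 0"
      by (rule Lim_null_comparison[OF _ lim0]) (simp add: le)
    then have "(\<lambda>i. TI f z - (TI f z - J i z)) \<longlonglongrightarrow> TI f z - 0" by (intro tendsto_diff tendsto_const)
    then show ?thesis by simp
  qed
  define A where "A = enn2real (\<integral>\<^sup>+t. ennreal (N (S t f)) \<partial>M)"
  have TIb: "bounded_by (TI f) A"
    unfolding TI_def[abs_def] by (rule integral_bounded_by[OF joint_S[OF f] SX[OF _ f]]) (use N_S_integral_finite[OF f] in \<open>auto simp: A_def\<close>)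
  have JN: "N (J i) \<le> 1 + A" for i
  proof -
    have "bounded_by (\<lambda>z. TI f z - J i z) (enn2real (a (i + k0)))"
      unfolding J_def by (rule simple_integral_diff_bound(1)[OF f s]) (auto simp: a_def[symmetric] k0)
    then have "bounded_by (\<lambda>z. - 1 * (TI f z - J i z)) (cmod (- 1) * enn2real (a (i + k0)))"
      using p by (intro lp_bound_cmult) auto
    then have "bounded_by (\<lambda>z. - 1 * (TI f z - J i z) + TI f z) (cmod (- 1) * enn2real (a (i + k0)) + A)"
      by (intro lp_bound_add p TIb)
    then have "bounded_by (J i) (enn2real (a (i + k0)) + A)" by simp
    then have "N (J i) \<le> enn2real (a (i + k0)) + A"
      using bergmanI(2)[OF bergman_holo[OF JX] bergman_zero[OF JX]] by blast
    then show ?thesis using k0(2)[of "i + k0"] by simp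
  qed
  obtain g r where "strict_mono (r :: nat \<Rightarrow> nat)" and g: "g \<in> X" "\<And>z. (\<lambda>k. J (r k) z) \<longlonglongrightarrow> g z"
    by (rule bergman_montel[of J "1 + A", OF JX JN]) (rule that)
  have "TI f z = g z" for z
    using LIMSEQ_subseq_LIMSEQ[OF J_lim \<open>strict_mono r\<close>, of z] g(2)[of z] by (simp add: o_def LIMSEQ_unique)
  then have "TI f = g" by blast
  with g(1) show ?thesis by simp
qed

text \<open>Stated for every simple approximation, not only the constructed one, because uniqueness
  of the vector-valued integral rests on it.\<close>

lemma simple_integral_tendsto_TI:
  assumes f: "f \<in> X" and s: "\<And>i. simple_function M (s i)" "\<And>i. s i ` space M \<subseteq> X"
    and lim: "(\<lambda>i. \<integral>\<^sup>+t. ennreal (N (\<lambda>z. S t f z - s i t z)) \<partial>M) \<longlonglongrightarrow> 0"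
  shows "(\<lambda>i. N (\<lambda>z. simple_integral_in M (s i) z - TI f z)) \<longlonglongrightarrow> 0"
proof -
  define a where "a i = (\<integral>\<^sup>+t. ennreal (N (\<lambda>z. S t f z - s i t z)) \<partial>M)" for i
  obtain k0 where k0: "\<And>i. i \<ge> k0 \<Longrightarrow> a i \<le> ennreal (enn2real (a i))" "\<And>i. i \<ge> k0 \<Longrightarrow> enn2real (a i) \<le> 1" "(\<lambda>i. enn2real (a i)) \<longlonglongrightarrow> 0"
    by (rule ennreal_tendsto_0_imp_real[OF lim[folded a_def]]) (rule that)
  have "eventually (\<lambda>i. norm (N (\<lambda>z. simple_integral_in M (s i) z - TI f z)) \<le> enn2real (a i)) sequentially"
    unfolding eventually_sequentially
  proof (intro exI[of _ k0] allI impI)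
    fix i assume "k0 \<le> i"
    have IX: "simple_integral_in M (s i) \<in> X" by (rule simple_integral_bergman[OF s])
    note dX = bergman_diff(1)[OF TI_bergman[OF f] IX]
    have "bounded_by (\<lambda>z. TI f z - simple_integral_in M (s i) z) (enn2real (a i))"
      by (rule simple_integral_diff_bound(1)[OF f s]) (use k0(1)[OF \<open>k0 \<le> i\<close>] in \<open>auto simp: a_def\<close>)
    then have "N (\<lambda>z. TI f z - simple_integral_in M (s i) z) \<le> enn2real (a i)"
      using bergmanI(2)[OF bergman_holo[OF dX] bergman_zero[OF dX]] by blast
    moreover have "N (\<lambda>z. - 1 * (TI f z - simple_integral_in M (s i) z)) = N (\<lambda>z. TI f z - simple_integral_in M (s i) z)"
      using bergman_cmult(2)[OF dX, of "- 1"] by simp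
    ultimately show "norm (N (\<lambda>z. simple_integral_in M (s i) z - TI f z)) \<le> enn2real (a i)" by simp
  qed
  then show ?thesis by (rule Lim_null_comparison[OF _ k0(3)])
qed

lemma has_integral_TI:
  assumes f: "f \<in> X"
  shows "has_integral_in X N M (\<lambda>t. S t f) (TI f)"
proof -
  obtain s where s: "\<And>i. simple_function M (s i)" "\<And>i. s i ` space M \<subseteq> X"
    and lim: "(\<lambda>i. \<integral>\<^sup>+t. ennreal (N (\<lambda>z. S t f z - s i t z)) \<partial>M) \<longlonglongrightarrow> 0"
    using simple_approximation[OF f] by blast
  have m: "(\<lambda>t. N (\<lambda>z. S t f z - s i t z)) \<in> borel_measurable M" for i
    by (intro joint_N_measurable joint_diff joint_S f simple_joint(1)[OF s])
  have fin: "emeasure M A < \<infinity>" for A using T.emeasure_finite[of A] by (simp add: less_top[symmetric])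
  show ?thesis
    unfolding has_integral_in_def
  proof (intro conjI ballI exI[of _ s] allI)
    fix t assume "t \<in> space M"
    then have "t \<in> I" by (simp only: space_M)
    then show "S t f \<in> X" by (rule SX[OF _ f])
  qed (rule TI_bergman[OF f] s fin m lim simple_integral_tendsto_TI[OF f s lim])+
qed

lemma integral_operator_eq:
  assumes f: "f \<in> X"
  shows "integral_operator X N S f = TI f"
  unfolding integral_operator_def
proof (rule the_equality)
  show "has_integral_in X N M (\<lambda>t. S t f) (TI f)" by (rule has_integral_TI[OF f])
next
  fix g assume "has_integral_in X N M (\<lambda>t. S t f) g"
  then obtain s where gX: "g \<in> X" and s: "\<And>i. simple_function M (s i)" "\<And>i. s i ` space M \<subseteq> X"
    and lim: "(\<lambda>i. \<integral>\<^sup>+t. ennreal (N (\<lambda>z. S t f z - s i t z)) \<partial>M) \<longlonglongrightarrow> 0"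
    and g: "(\<lambda>i. N (\<lambda>z. simple_integral_in M (s i) z - g z)) \<longlonglongrightarrow> 0"
    unfolding has_integral_in_def by blast
  note IX = simple_integral_bergman[OF s]
  have "g z = TI f z" for z
    using norm_conv_imp_pointwise[OF IX gX g, of z]
      norm_conv_imp_pointwise[OF IX TI_bergman[OF f] simple_integral_tendsto_TI[OF f s lim], of z]
    by (rule LIMSEQ_unique)
  then show "g = TI f" by blast
qed

section \<open>From the single operators to their integral\<close>

abbreviation "R \<equiv> integral_operator X N S"

definition W :: "real \<Rightarrow> real" where
  "W t = cmod (boundary_value (u t) \<xi>) * Re (boundary_value (deriv (\<phi> t)) \<xi>) powr (- ((2 + \<alpha>) / p))"

lemma W_eq: "t \<in> I \<Longrightarrow> boundary_symbol.W p \<alpha> \<xi> (u t) (\<phi> t) = W t"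
  using boundary_symbol.W_def[OF symbol] boundary_symbol.u0_def[OF symbol] boundary_symbol.d_def[OF symbol]
  by (simp add: W_def)

lemmas S_peak_null = boundary_symbol.peak_complement_null[OF symbol]

lemma S_peak_upper:
  assumes t: "t \<in> I" and e: "e > 0"
  obtains n0 where "\<And>n f. n \<ge> n0 \<Longrightarrow> f \<in> X \<Longrightarrow> N (\<lambda>z. peak \<xi> n z * S t f z) \<le> (W t + e) * N f"
  using boundary_symbol.peak_upper[OF symbol[OF t] e] that unfolding W_eq[OF t] .

lemma S_test_limit:
  assumes t: "t \<in> I" and c: "\<And>n. \<alpha> \<le> c n * p" "\<And>n. c n < (2 + \<alpha>) / p" "c \<longlonglongrightarrow> (2 + \<alpha>) / p"
  shows "(\<lambda>n. N (S t (f_test p \<alpha> \<xi> (c n)))) \<longlonglongrightarrow> W t"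
  using boundary_symbol.test_function_limit[OF symbol[OF t] c] unfolding W_eq[OF t] .

lemma W_le: "t \<in> I \<Longrightarrow> ennreal (W t) \<le> op_norm X N (S t)"
  using boundary_symbol.W_le_op_norm[OF symbol] W_eq by simp

lemma W_nonneg: "W t \<ge> 0"
  by (simp add: W_def)

lemma W_measurable[measurable]: "W \<in> borel_measurable M"
proof (rule borel_measurable_LIMSEQ_real)
  show "(\<lambda>t. N (S t (f_test p \<alpha> \<xi> (c_seq n)))) \<in> borel_measurable M" for n
    by (intro joint_N_measurable joint_S f_test_bergman \<xi> c_seq)
  show "(\<lambda>n. N (S t (f_test p \<alpha> \<xi> (c_seq n)))) \<longlonglongrightarrow> W t" if "t \<in> space M" for t
    using that unfolding space_M by (intro S_test_limit c_seq)
qed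

lemma W_integral_finite: "(\<integral>\<^sup>+t. ennreal (W t) \<partial>M) < \<infinity>"
proof (rule le_less_trans[OF _ op_norm_integral_finite])
  show "(\<integral>\<^sup>+t. ennreal (W t) \<partial>M) \<le> (\<integral>\<^sup>+t. op_norm X N (S t) \<partial>M)"
    by (intro nn_integral_mono W_le) (simp only: space_M)
qed

lemma W_integrable: "integrable M W"
  using W_integral_finite W_nonneg by (intro integrableI_nonneg) auto

definition L :: real where "L = (\<integral>t. W t \<partial>M)"

lemma L_eq: "(\<integral>\<^sup>+t. ennreal (W t) \<partial>M) = ennreal L"
  unfolding L_def using W_nonneg by (intro nn_integral_eq_integral W_integrable) auto

lemma L_nonneg: "L \<ge> 0"
  unfolding L_def using W_nonneg by simp

text \<open>Minkowski's integral inequality after multiplication with \<open>w\<close>, which does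
  not depend on t and passes through the integral. It is used with the constant 1, the peak function
  and the complement of the peak function.\<close>

lemma weighted_integral_bound:
  assumes f: "f \<in> X" and w: "w \<in> borel_measurable borel"
    and X: "\<And>t. t \<in> I \<Longrightarrow> (\<lambda>z. w z * S t f z) \<in> X" "(\<lambda>z. w z * TI f z) \<in> X"
    and B: "(\<integral>\<^sup>+t. ennreal (N (\<lambda>z. w z * S t f z)) \<partial>M) \<le> ennreal B" "B \<ge> 0"
  shows "N (\<lambda>z. w z * TI f z) \<le> B"
proof -
  have "joint (\<lambda>t z. 1 * w z * S t f z)"
    by (intro joint_mult joint_S f w) simp
  then have "joint (\<lambda>t z. w z * S t f z)" by simp
  from integral_bounded_by[OF this X(1) B] have "bounded_by (\<lambda>z. w z * TI f z) B"
    by (simp add: TI_def)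
  then show ?thesis using bergmanI(2)[OF bergman_holo[OF X(2)] bergman_zero[OF X(2)]] by blast
qed

lemma peak_measurable: "peak \<xi> n \<in> borel_measurable borel" "(\<lambda>z. 1 - peak \<xi> n z) \<in> borel_measurable borel"
  by (auto simp: peak_def intro!: borel_measurable_continuous_onI continuous_intros)

lemma TI_linear:
  assumes "f \<in> X" "g \<in> X"
  shows "TI (\<lambda>z. a * f z + b * g z) = (\<lambda>z. a * TI f z + b * TI g z)"
proof
  fix z
  have int: "integrable M (\<lambda>t. S t f z)" "integrable M (\<lambda>t. S t g z)"
    by (intro section_integrable joint_S SX N_S_integral_finite assms; assumption)+
  have "TI (\<lambda>z. a * f z + b * g z) z = (\<integral>t. a * S t f z + b * S t g z \<partial>M)"
    unfolding TI_def wcomp_def by (intro Bochner_Integration.integral_cong) (auto simp: algebra_simps)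
  also have "\<dots> = a * TI f z + b * TI g z"
    unfolding TI_def using int by simp
  finally show "TI (\<lambda>z. a * f z + b * g z) z = a * TI f z + b * TI g z" .
qed

lemma R_bounded: "R \<in> bounded_operators X N"
proof -
  define A where "A = enn2real (\<integral>\<^sup>+t. op_norm X N (S t) \<partial>M)"
  have A: "ennreal A = (\<integral>\<^sup>+t. op_norm X N (S t) \<partial>M)"
    unfolding A_def using op_norm_integral_finite by simp
  have "N (R f) \<le> A * N f" if f: "f \<in> X" for f
  proof -
    have "N (\<lambda>z. 1 * TI f z) \<le> A * N f"
    proof (rule weighted_integral_bound[OF f])
      show "(\<integral>\<^sup>+t. ennreal (N (\<lambda>z. 1 * S t f z)) \<partial>M) \<le> ennreal (A * N f)"
        using N_S_integral[OF f] by (simp add: A_def ennreal_mult A[unfolded A_def])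
    qed (use SX[OF _ f] TI_bergman[OF f] in \<open>auto simp: A_def\<close>)
    then show ?thesis by (simp add: integral_operator_eq[OF f])
  qed
  then show ?thesis
    unfolding bounded_operators_def linear_operator_def
    using TI_bergman TI_linear bergman_lincomb integral_operator_eq by auto
qed

lemma peak_bounded_operator:
  assumes t: "t \<in> I"
  shows "(\<lambda>f z. peak \<xi> n z * S t f z) \<in> bounded_operators X N"
proof -
  obtain B where B: "B \<ge> 0" "\<And>f. f \<in> X \<Longrightarrow> N (S t f) \<le> B * N f"
    using bounded_operator_bound[OF S_bounded[OF t]] by blast
  show ?thesis
    unfolding bounded_operators_def linear_operator_def
  proof (intro CollectI conjI ballI allI exI[of _ B])
    fix f assume f: "f \<in> X"
    show "(\<lambda>z. peak \<xi> n z * S t f z) \<in> X" by (rule bergman_peak(1)[OF \<xi> SX[OF t f]])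
    show "N (\<lambda>z. peak \<xi> n z * S t f z) \<le> B * N f"
      using bergman_peak(2)[OF \<xi> SX[OF t f], of n] B(2)[OF f] by simp
    fix g a b
    show "(\<lambda>z. peak \<xi> n z * S t (\<lambda>z. a * f z + b * g z) z) = (\<lambda>z. a * (peak \<xi> n z * S t f z) + b * (peak \<xi> n z * S t g z))"
      by (simp add: wcomp_def algebra_simps)
  qed
qed

lemma peak_op_le: "t \<in> I \<Longrightarrow> op_norm X N (\<lambda>f z. peak \<xi> n z * S t f z) \<le> op_norm X N (S t)"
  unfolding op_norm_def by (rule SUP_mono) (auto intro!: ennreal_leI bergman_peak(2) \<xi> SX)

text \<open>One n must serve all f, hence the operator norms \<open>\<omega> n t\<close> in place of
  norms at a single f. Their upper limit in n is at most \<open>W t\<close>, and Fatou's lemma for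
  upper limits, with the integrable majorant \<open>op_norm X N (S t)\<close>, integrates
  this.\<close>

lemma R_peak_upper:
  assumes e: "e > 0"
  shows "\<exists>n. \<forall>f\<in>X. N (\<lambda>z. peak \<xi> n z * R f z) \<le> (L + e) * N f"
proof -
  define \<omega> where "\<omega> n t = op_norm X N (\<lambda>f z. peak \<xi> n z * S t f z)" for n t
  have m: "\<omega> n \<in> borel_measurable M" for n unfolding \<omega>_def by (rule peak_op_measurable)
  have "limsup (\<lambda>n. \<integral>\<^sup>+t. \<omega> n t \<partial>M) \<le> (\<integral>\<^sup>+t. limsup (\<lambda>n. \<omega> n t) \<partial>M)"
    by (rule nn_integral_limsup[OF m op_norm_measurable _ op_norm_integral_finite])
       (use peak_op_le in \<open>auto simp: \<omega>_def space_M\<close>)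
  also have "\<dots> \<le> (\<integral>\<^sup>+t. ennreal (W t) \<partial>M)"
  proof (rule nn_integral_mono, rule ennreal_le_epsilon)
    fix t and e :: real assume t: "t \<in> space M" and e: "e > 0"
    have tI: "t \<in> I" using t by (simp only: space_M)
    obtain n0 where n0: "\<And>n f. n \<ge> n0 \<Longrightarrow> f \<in> X \<Longrightarrow> N (\<lambda>z. peak \<xi> n z * S t f z) \<le> (W t + e) * N f"
      by (rule S_peak_upper[OF tI e]) (rule that)
    have "\<omega> n t \<le> ennreal (W t) + ennreal e" if n: "n \<ge> n0" for n
      unfolding \<omega>_def op_norm_def
    proof (rule SUP_least)
      fix f assume f: "f \<in> {f \<in> X. N f \<le> 1}"
      then have "N (\<lambda>z. peak \<xi> n z * S t f z) \<le> (W t + e) * N f" using n0[OF n] by simp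
      also have "\<dots> \<le> (W t + e) * 1" using f e W_nonneg[of t] by (intro mult_left_mono) auto
      finally have "ennreal (N (\<lambda>z. peak \<xi> n z * S t f z)) \<le> ennreal (W t + e)" by (intro ennreal_leI) simp
      also have "ennreal (W t + e) = ennreal (W t) + ennreal e" using e W_nonneg by (intro ennreal_plus) auto
      finally show "ennreal (N (\<lambda>z. peak \<xi> n z * S t f z)) \<le> ennreal (W t) + ennreal e" .
    qed
    then show "limsup (\<lambda>n. \<omega> n t) \<le> ennreal (W t) + ennreal e"
      by (intro Limsup_bounded) (auto simp: eventually_sequentially)
  qed
  also have "\<dots> < ennreal (L + e)" unfolding L_eq using e L_nonneg by (intro ennreal_lessI) auto
  finally have "eventually (\<lambda>n. (\<integral>\<^sup>+t. \<omega> n t \<partial>M) < ennreal (L + e)) sequentially"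
    by (rule Limsup_lessD)
  then obtain n where n: "(\<integral>\<^sup>+t. \<omega> n t \<partial>M) < ennreal (L + e)" by (auto simp: eventually_sequentially)
  have "N (\<lambda>z. peak \<xi> n z * R f z) \<le> (L + e) * N f" if f: "f \<in> X" for f
    unfolding integral_operator_eq[OF f]
  proof (rule weighted_integral_bound[OF f peak_measurable(1)])
    have "(\<integral>\<^sup>+t. ennreal (N (\<lambda>z. peak \<xi> n z * S t f z)) \<partial>M) \<le> (\<integral>\<^sup>+t. \<omega> n t * ennreal (N f) \<partial>M)"
      unfolding \<omega>_def by (intro nn_integral_mono op_norm_bound[OF peak_bounded_operator f]) (simp only: space_M)
    also have "\<dots> = (\<integral>\<^sup>+t. \<omega> n t \<partial>M) * ennreal (N f)" by (rule nn_integral_multc[OF m])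
    also have "\<dots> \<le> ennreal (L + e) * ennreal (N f)" using n by (intro mult_right_mono) auto
    also have "\<dots> = ennreal ((L + e) * N f)" using e L_nonneg by (simp add: ennreal_mult del: ennreal_plus)
    finally show "(\<integral>\<^sup>+t. ennreal (N (\<lambda>z. peak \<xi> n z * S t f z)) \<partial>M) \<le> ennreal ((L + e) * N f)" .
    show "(L + e) * N f \<ge> 0" using e L_nonneg by simp
  qed (intro bergman_peak \<xi> SX TI_bergman f; assumption)+
  then show ?thesis by blast
qed

text \<open>Dominated convergence in t: the integrand tends to 0 by the result for a single
  operator, and twice the bound of the sequence times the operator norm is an integrable
  majorant.\<close>

lemma R_peak_null:
  assumes f: "null_seq f"
  shows "(\<lambda>k. N (\<lambda>z. (1 - peak \<xi> n z) * R (f k) z)) \<longlonglongrightarrow> 0"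
proof -
  obtain B where fX: "\<And>k. f k \<in> X" and B: "\<And>k. N (f k) \<le> B"
    using f by (auto simp: null_seq_def)
  define b where "b k = (\<integral>\<^sup>+t. ennreal (N (\<lambda>z. (1 - peak \<xi> n z) * S t (f k) z)) \<partial>M)" for k
  have jt: "joint (\<lambda>t z. (1 - peak \<xi> n z) * S t (f k) z)" for k
    using joint_mult[OF _ peak_measurable(2) joint_S[OF fX], of "\<lambda>_. 1"] by simp
  have b0: "b \<longlonglongrightarrow> (\<integral>\<^sup>+t. 0 \<partial>M)"
    unfolding b_def
  proof (rule nn_integral_dominated_convergence[where w = "\<lambda>t. op_norm X N (S t) * ennreal (2 * \<bar>B\<bar>)"])
    show "(\<lambda>t. ennreal (N (\<lambda>z. (1 - peak \<xi> n z) * S t (f k) z))) \<in> borel_measurable M" for k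
      using joint_N_measurable[OF jt] by simp
    show "(\<lambda>t. op_norm X N (S t) * ennreal (2 * \<bar>B\<bar>)) \<in> borel_measurable M"
      using op_norm_measurable by simp
    show "(\<integral>\<^sup>+t. op_norm X N (S t) * ennreal (2 * \<bar>B\<bar>) \<partial>M) < \<infinity>"
      using op_norm_integral_finite by (subst nn_integral_multc[OF op_norm_measurable]) (simp add: ennreal_mult_less_top)
    show "AE t in M. ennreal (N (\<lambda>z. (1 - peak \<xi> n z) * S t (f k) z)) \<le> op_norm X N (S t) * ennreal (2 * \<bar>B\<bar>)" for k
    proof (rule AE_I2)
      fix t assume "t \<in> space M"
      then have t: "t \<in> I" by (simp only: space_M)
      have "ennreal (N (\<lambda>z. (1 - peak \<xi> n z) * S t (f k) z)) \<le> ennreal (2 * N (S t (f k)))"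
        by (intro ennreal_leI bergman_peak(4) \<xi> SX t fX)
      also have "\<dots> = 2 * ennreal (N (S t (f k)))" by (simp add: ennreal_mult)
      also have "\<dots> \<le> 2 * (op_norm X N (S t) * ennreal (N (f k)))"
        by (intro mult_left_mono op_norm_bound S_bounded t fX) simp
      also have "\<dots> \<le> 2 * (op_norm X N (S t) * ennreal \<bar>B\<bar>)"
        using B[of k] by (intro mult_left_mono ennreal_leI) auto
      finally show "ennreal (N (\<lambda>z. (1 - peak \<xi> n z) * S t (f k) z)) \<le> op_norm X N (S t) * ennreal (2 * \<bar>B\<bar>)"
        by (simp add: ennreal_mult mult_ac)
    qed
    show "AE t in M. (\<lambda>k. ennreal (N (\<lambda>z. (1 - peak \<xi> n z) * S t (f k) z))) \<longlonglongrightarrow> 0"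
    proof (rule AE_I2)
      fix t assume "t \<in> space M"
      then have t: "t \<in> I" by (simp only: space_M)
      show "(\<lambda>k. ennreal (N (\<lambda>z. (1 - peak \<xi> n z) * S t (f k) z))) \<longlonglongrightarrow> 0"
        using tendsto_ennrealI[OF S_peak_null[OF t f, of n]] by simp
    qed
  qed simp
  then have "b \<longlonglongrightarrow> 0" by simp
  then obtain k0 where k0: "\<And>i. i \<ge> k0 \<Longrightarrow> b i \<le> ennreal (enn2real (b i))" "\<And>i. i \<ge> k0 \<Longrightarrow> enn2real (b i) \<le> 1" "(\<lambda>i. enn2real (b i)) \<longlonglongrightarrow> 0"
    by (rule ennreal_tendsto_0_imp_real) (rule that)
  have "N (\<lambda>z. (1 - peak \<xi> n z) * R (f k) z) \<le> enn2real (b k)" if k: "k \<ge> k0" for k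
    unfolding integral_operator_eq[OF fX]
  proof (rule weighted_integral_bound[OF fX peak_measurable(2)])
    show "(\<integral>\<^sup>+t. ennreal (N (\<lambda>z. (1 - peak \<xi> n z) * S t (f k) z)) \<partial>M) \<le> ennreal (enn2real (b k))"
      using k0(1)[OF k] by (simp add: b_def)
  qed (intro bergman_peak \<xi> SX TI_bergman fX enn2real_nonneg; assumption)+
  then have "eventually (\<lambda>k. norm (N (\<lambda>z. (1 - peak \<xi> n z) * R (f k) z)) \<le> enn2real (b k)) sequentially"
    unfolding eventually_sequentially by (intro exI[of _ k0]) simp
  then show ?thesis by (rule Lim_null_comparison[OF _ k0(3)])
qed

text \<open>Constancy of the argument enters here. All \<open>S t\<close> act on the test functions
  asymptotically as multiplication by \<sigma> \<open>W t\<close> with one common phase, so the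
  integral acts as multiplication by \<sigma> \<open>L\<close>, of modulus \<open>L\<close>;
  differing phases could cancel.\<close>

lemma R_test_limit:
  assumes arg: "\<And>t. t \<in> I \<Longrightarrow> is_Arg (boundary_value (u t) \<xi>) \<theta>"
    and c: "\<And>n. \<alpha> \<le> c n * p" "\<And>n. c n < (2 + \<alpha>) / p" "c \<longlonglongrightarrow> (2 + \<alpha>) / p"
  shows "(\<lambda>n. N (R (f_test p \<alpha> \<xi> (c n)))) \<longlonglongrightarrow> L"
proof -
  define g where "g n = f_test p \<alpha> \<xi> (c n)" for n
  have gX: "g n \<in> X" "N (g n) = 1" for n
    unfolding g_def using f_test_bergman[OF \<xi> c(1,2)] by auto
  define \<sigma> where "\<sigma> = exp (\<i> * complex_of_real \<theta>)"
  have \<sigma>: "cmod \<sigma> = 1" by (simp add: \<sigma>_def)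
  define G where "G = (\<lambda>n t z. S t (g n) z - (\<sigma> * of_real (W t)) * 1 * g n z)"
  have jG: "joint (G n)" for n
    unfolding G_def by (intro joint_diff joint_mult joint_S joint_const gX borel_measurable_const) measurable
  have GX: "G n t \<in> X" if "t \<in> I" for n t
    unfolding G_def mult_1_right by (intro bergman_diff bergman_cmult SX gX that)
  have GN: "N (G n t) \<le> N (S t (g n)) + W t" if "t \<in> I" for n t
  proof -
    have "N (\<lambda>z. S t (g n) z - (\<sigma> * of_real (W t)) * g n z) \<le> N (S t (g n)) + N (\<lambda>z. (\<sigma> * of_real (W t)) * g n z)"
      by (intro bergman_diff bergman_cmult SX gX that)
    also have "N (\<lambda>z. (\<sigma> * of_real (W t)) * g n z) = W t"
      using bergman_cmult(2)[OF gX(1), of "\<sigma> * of_real (W t)" n] gX(2) \<sigma> W_nonneg by (simp add: norm_mult)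
    finally show ?thesis by (simp add: G_def)
  qed
  have G_lim: "(\<lambda>n. N (G n t)) \<longlonglongrightarrow> 0" if t: "t \<in> I" for t
  proof -
    have "boundary_value (u t) \<xi> = of_real (cmod (boundary_value (u t) \<xi>)) * \<sigma>"
      using arg[OF t] by (simp add: is_Arg_def \<sigma>_def)
    then have "boundary_value (u t) \<xi> * of_real (Re (boundary_value (deriv (\<phi> t)) \<xi>) powr (- ((2 + \<alpha>) / p))) = \<sigma> * of_real (W t)"
      unfolding W_def of_real_mult by (metis mult.assoc mult.commute)
    then show ?thesis
      using boundary_symbol.test_function_asymptotics[OF symbol[OF t] c]
        boundary_symbol.u0_def[OF symbol[OF t]] boundary_symbol.d_def[OF symbol[OF t]]
      by (simp add: G_def g_def)
  qed
  define b where "b n = (\<integral>\<^sup>+t. ennreal (N (G n t)) \<partial>M)" for n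
  have "b \<longlonglongrightarrow> (\<integral>\<^sup>+t. 0 \<partial>M)"
    unfolding b_def
  \<comment> \<open>One summand of the majorant bounds \<open>N (S t (g n))\<close>, the other
    bounds \<open>W t\<close>.\<close>
  proof (rule nn_integral_dominated_convergence[where w = "\<lambda>t. op_norm X N (S t) + op_norm X N (S t)"])
    show "(\<lambda>t. ennreal (N (G n t))) \<in> borel_measurable M" for n using joint_N_measurable[OF jG] by simp
    show "(\<lambda>t. op_norm X N (S t) + op_norm X N (S t)) \<in> borel_measurable M" using op_norm_measurable by simp
    show "(\<integral>\<^sup>+t. op_norm X N (S t) + op_norm X N (S t) \<partial>M) < \<infinity>"
      using op_norm_integral_finite by (subst nn_integral_add[OF op_norm_measurable op_norm_measurable]) simp
    show "AE t in M. ennreal (N (G n t)) \<le> op_norm X N (S t) + op_norm X N (S t)" for n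
    proof (rule AE_I2)
      fix t assume "t \<in> space M"
      then have t: "t \<in> I" by (simp only: space_M)
      have "ennreal (N (G n t)) \<le> ennreal (N (S t (g n)) + W t)" by (intro ennreal_leI GN t)
      also have "\<dots> = ennreal (N (S t (g n))) + ennreal (W t)" using W_nonneg by (intro ennreal_plus) auto
      also have "\<dots> \<le> op_norm X N (S t) + op_norm X N (S t)"
        using gX(2)[of n] by (intro add_mono op_norm_upper W_le gX t) auto
      finally show "ennreal (N (G n t)) \<le> op_norm X N (S t) + op_norm X N (S t)" .
    qed
    show "AE t in M. (\<lambda>n. ennreal (N (G n t))) \<longlonglongrightarrow> 0"
      using tendsto_ennrealI[OF G_lim] by (intro AE_I2) (auto simp: space_M)
  qed simp
  then have "b \<longlonglongrightarrow> 0" by simp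
  then obtain k0 where k0: "\<And>i. i \<ge> k0 \<Longrightarrow> b i \<le> ennreal (enn2real (b i))" "\<And>i. i \<ge> k0 \<Longrightarrow> enn2real (b i) \<le> 1" "(\<lambda>i. enn2real (b i)) \<longlonglongrightarrow> 0"
    by (rule ennreal_tendsto_0_imp_real) (rule that)
  have "\<bar>N (R (g n)) - L\<bar> \<le> enn2real (b n)" if n: "n \<ge> k0" for n
  proof -
    \<comment> \<open>The expected image of \<open>g n\<close> under the integral operator; its norm
      is exactly \<open>L\<close>.\<close>
    define h where "h z = (\<sigma> * of_real L) * g n z" for z
    have hX: "h \<in> X" "N h = L"
      unfolding h_def using bergman_cmult[OF gX(1), of "\<sigma> * of_real L" n] gX(2) \<sigma> L_nonneg by (simp_all add: norm_mult)
    note dX = bergman_diff(1)[OF TI_bergman[OF gX(1)] hX(1), of n]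
    have "(\<integral>t. G n t z \<partial>M) = TI (g n) z - h z" for z
    proof -
      have 1: "integrable M (\<lambda>t. S t (g n) z)"
        by (intro section_integrable joint_S SX N_S_integral_finite gX; assumption)
      have 2: "integrable M (\<lambda>t. (\<sigma> * g n z) * of_real (W t))"
        by (intro integrable_mult_right integrable_of_real W_integrable)
      have "(\<integral>t. G n t z \<partial>M) = (\<integral>t. S t (g n) z - (\<sigma> * g n z) * of_real (W t) \<partial>M)"
        by (intro Bochner_Integration.integral_cong) (auto simp: G_def)
      also have "\<dots> = TI (g n) z - (\<sigma> * g n z) * of_real L"
        unfolding Bochner_Integration.integral_diff[OF 1 2] by (simp add: TI_def L_def)
      finally show ?thesis by (simp add: h_def)
    qed
    then have "bounded_by (\<lambda>z. TI (g n) z - h z) (enn2real (b n))"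
      using integral_bounded_by[OF jG GX, of n "enn2real (b n)"] k0(1)[OF n] by (simp add: b_def)
    then have "N (\<lambda>z. TI (g n) z - h z) \<le> enn2real (b n)"
      using bergmanI(2)[OF bergman_holo[OF dX] bergman_zero[OF dX]] by blast
    then show ?thesis
      using N_diff_abs[OF TI_bergman[OF gX(1)] hX(1), of n] hX(2) by (simp add: integral_operator_eq[OF gX(1)])
  qed
  then have "eventually (\<lambda>n. norm (N (R (g n)) - L) \<le> enn2real (b n)) sequentially"
    unfolding eventually_sequentially by (intro exI[of _ k0]) simp
  then have "(\<lambda>n. N (R (g n)) - L) \<longlonglongrightarrow> 0" by (rule Lim_null_comparison[OF _ k0(3)])
  then show ?thesis by (simp add: LIM_zero_iff g_def)
qed

lemma S_norms:
  assumes t: "t \<in> I"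
  shows "(SUP f\<in>W0_sphere X N. limsup (\<lambda>n. ennreal (N (S t (f n))))) = ennreal (W t)"
    and "ess_norm X N (S t) = ennreal (W t)"
proof -
  have upper: "\<exists>n. \<forall>f\<in>X. N (\<lambda>z. peak \<xi> n z * S t f z) \<le> (W t + e) * N f" if e: "e > 0" for e
  proof -
    obtain n0 where "\<And>n f. n \<ge> n0 \<Longrightarrow> f \<in> X \<Longrightarrow> N (\<lambda>z. peak \<xi> n z * S t f z) \<le> (W t + e) * N f"
      by (rule S_peak_upper[OF t e]) (rule that)
    then show ?thesis by blast
  qed
  note * = localized_operator_norms[where g = "\<lambda>n. f_test p \<alpha> \<xi> (c_seq n)", OF \<xi> S_bounded[OF t] W_nonneg]
  note prems = S_peak_null[OF t] upper f_test_null_seq[OF \<xi> c_seq] f_test_bergman(2)[OF \<xi> c_seq(1,2)] S_test_limit[OF t c_seq]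
  show "(SUP f\<in>W0_sphere X N. limsup (\<lambda>n. ennreal (N (S t (f n))))) = ennreal (W t)"
    "ess_norm X N (S t) = ennreal (W t)"
    by (rule *; (rule prems | assumption)+)+
qed

lemma R_norms:
  assumes arg: "\<And>t. t \<in> I \<Longrightarrow> is_Arg (boundary_value (u t) \<xi>) \<theta>"
  shows "(SUP f\<in>W0_sphere X N. limsup (\<lambda>n. ennreal (N (R (f n))))) = ennreal L"
    and "ess_norm X N R = ennreal L"
proof -
  note * = localized_operator_norms[where g = "\<lambda>n. f_test p \<alpha> \<xi> (c_seq n)", OF \<xi> R_bounded L_nonneg]
  note prems = R_peak_null R_peak_upper f_test_null_seq[OF \<xi> c_seq] f_test_bergman(2)[OF \<xi> c_seq(1,2)] R_test_limit[OF arg c_seq]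
  show "(SUP f\<in>W0_sphere X N. limsup (\<lambda>n. ennreal (N (R (f n))))) = ennreal L"
    "ess_norm X N R = ennreal L"
    by (rule *; (rule prems | assumption)+)+
qed

lemma S_test_integral_limit:
  assumes c: "\<And>n. c n < (2 + \<alpha>) / p" "c \<longlonglongrightarrow> (2 + \<alpha>) / p"
  shows "(\<lambda>n. \<integral>\<^sup>+t. ennreal (N (S t (f_test p \<alpha> \<xi> (c n)))) \<partial>M) \<longlonglongrightarrow> ennreal L"
proof -
  \<comment> \<open>Finitely many \<open>c n\<close> may lie too far below the critical exponent for
    the norm estimates; the maximum raises only these and leaves the limit unchanged.\<close>
  define c' where "c' n = max (c n) ((1 + \<alpha>) / p)" for n
  have less: "(1 + \<alpha>) / p < (2 + \<alpha>) / p" using p by (simp add: divide_strict_right_mono)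
  have c'1: "\<alpha> \<le> c' n * p" for n
  proof -
    have "(1 + \<alpha>) / p * p \<le> c' n * p" using p by (intro mult_right_mono) (auto simp: c'_def)
    then show ?thesis using p by simp
  qed
  have c'2: "c' n < (2 + \<alpha>) / p" for n using c(1)[of n] less by (simp add: c'_def)
  have ev: "eventually (\<lambda>n. c n = c' n) sequentially"
    using order_tendstoD(1)[OF c(2) less] by eventually_elim (simp add: c'_def)
  have c'3: "c' \<longlonglongrightarrow> (2 + \<alpha>) / p" using c(2) ev by (rule Lim_transform_eventually)
  have "(\<lambda>n. \<integral>\<^sup>+t. ennreal (N (S t (f_test p \<alpha> \<xi> (c' n)))) \<partial>M) \<longlonglongrightarrow> (\<integral>\<^sup>+t. ennreal (W t) \<partial>M)"
  proof (rule nn_integral_dominated_convergence[where w = "\<lambda>t. op_norm X N (S t)"])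
    show "(\<lambda>t. ennreal (N (S t (f_test p \<alpha> \<xi> (c' n))))) \<in> borel_measurable M" for n
      using joint_N_measurable[OF joint_S[OF f_test_bergman(1)[OF \<xi> c'1 c'2]]] by simp
    show "AE t in M. ennreal (N (S t (f_test p \<alpha> \<xi> (c' n)))) \<le> op_norm X N (S t)" for n
      using f_test_bergman[OF \<xi> c'1 c'2, of n] by (intro AE_I2 op_norm_upper) auto
    show "AE t in M. (\<lambda>n. ennreal (N (S t (f_test p \<alpha> \<xi> (c' n))))) \<longlonglongrightarrow> ennreal (W t)"
      by (intro AE_I2 tendsto_ennrealI S_test_limit c'1 c'2 c'3) (simp only: space_M)
  qed (use op_norm_measurable op_norm_integral_finite in auto)
  then have "(\<lambda>n. \<integral>\<^sup>+t. ennreal (N (S t (f_test p \<alpha> \<xi> (c' n)))) \<partial>M) \<longlonglongrightarrow> ennreal L" by (simp add: L_eq)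
  then show ?thesis
    by (rule Lim_transform_eventually) (use ev in \<open>auto elim: eventually_mono\<close>)
qed

end

theorem theorem2p8:
  fixes p \<alpha> :: real and \<xi> :: complex and u \<phi> :: "real \<Rightarrow> complex \<Rightarrow> complex"
  assumes "p > 1" and "\<alpha> \<ge> 0" and "\<xi> \<in> sphere 0 1"
    and "admissible p \<alpha> \<xi> u \<phi>"
    and "\<exists>\<theta>. \<forall>t\<in>{0<..<1}. is_Arg (boundary_value (u t) \<xi>) \<theta>"
  shows "let X = bergman p \<alpha>; N = bergman_norm p \<alpha>; S = (\<lambda>t. wcomp (u t) (\<phi> t)) in
      (SUP f\<in>W0_sphere X N. limsup (\<lambda>n. ennreal (N (integral_operator X N S (f n))))) =
        (\<integral>\<^sup>+t\<in>{0<..<1}. (SUP f\<in>W0_sphere X N. limsup (\<lambda>n. ennreal (N (S t (f n))))) \<partial>lborel) \<and>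
      (\<forall>c. (\<forall>n. c n < (2 + \<alpha>) / p) \<and> c \<longlonglongrightarrow> (2 + \<alpha>) / p \<longrightarrow>
        (\<lambda>n. \<integral>\<^sup>+t\<in>{0<..<1}. ennreal (N (S t (f_test p \<alpha> \<xi> (c n)))) \<partial>lborel)
          \<longlonglongrightarrow> (\<integral>\<^sup>+t\<in>{0<..<1}. (SUP f\<in>W0_sphere X N. limsup (\<lambda>n. ennreal (N (S t (f n))))) \<partial>lborel)) \<and>
      ess_norm X N (integral_operator X N S) =
        (\<integral>\<^sup>+t\<in>{0<..<1}. ess_norm X N (S t) \<partial>lborel)"
proof -
  interpret admissible_family p \<alpha> \<xi> u \<phi>
    using assms by unfold_locales auto
  obtain \<theta> where \<theta>: "\<And>t. t \<in> I \<Longrightarrow> is_Arg (boundary_value (u t) \<xi>) \<theta>" using assms(5) by blast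
  \<comment> \<open>On the interval both integrands equal \<open>W t\<close>, whose integral is
    \<open>L\<close>; what remains are three statements about \<open>L\<close>.\<close>
  have sup: "(\<integral>\<^sup>+t\<in>I. (SUP f\<in>W0_sphere X N. limsup (\<lambda>n. ennreal (N (S t (f n))))) \<partial>lborel) = ennreal L"
    unfolding nn_integral_M[symmetric] L_eq[symmetric]
    by (intro nn_integral_cong S_norms) (simp only: space_M)
  have ess: "(\<integral>\<^sup>+t\<in>I. ess_norm X N (S t) \<partial>lborel) = ennreal L"
    unfolding nn_integral_M[symmetric] L_eq[symmetric]
    by (intro nn_integral_cong S_norms) (simp only: space_M)
  have "(\<lambda>n. \<integral>\<^sup>+t\<in>I. ennreal (N (S t (f_test p \<alpha> \<xi> (c n)))) \<partial>lborel) \<longlonglongrightarrow> ennreal L"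
    if "(\<forall>n. c n < (2 + \<alpha>) / p) \<and> c \<longlonglongrightarrow> (2 + \<alpha>) / p" for c
    using S_test_integral_limit[of c] that unfolding nn_integral_M by blast
  moreover have "(SUP f\<in>W0_sphere X N. limsup (\<lambda>n. ennreal (N (R (f n))))) = ennreal L" "ess_norm X N R = ennreal L"
    by (rule R_norms[of \<theta>], rule \<theta>, assumption)+
  ultimately show ?thesis
    unfolding Let_def sup ess by blast
qed

end
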